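(* Let $X$ be a compact almost hermitian manifold of real dimension $2n$ with $2n\equiv 2$ or $6 \pmod 8$, let $E$ be a hermitian vector bundle over $X$ with a hermitian connection, and let $D_E:\Gamma(\mathbb{S}^+\otimes E)\to\Gamma(\mathbb{S}^-\otimes E)$ be the twisted $\mathrm{spin}^{\mathrm c}$ Dirac operator. Let $\varphi$ be a section of $K_X\otimes E^*\otimes E^*$ such that $\varphi\in\Gamma(K_X\otimes \mathrm{Sym}^2E^* )$ if $\dim X\equiv 2\pmod 8$, and $\varphi\in\Gamma(K_X\otimes\Lambda^2E^* )$ if $\dim X\equiv 6\pmod 8$. Let $A_\varphi:\mathbb{S}^+\otimes E\to\mathbb{S}^-\otimes E$ be the associated conjugate-linear bundle map (defined in the context). Then $$\sigma_{D_E^*}(\gamma)\circ A_\varphi + A_\varphi^*\circ\sigma_{D_E}(\gamma)=0\qquad\text{for all }\gamma\in T^*X.$$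
   Context: Setting. $X$ is a compact manifold of real dimension $2n$ with an almost complex structure $J$ and a Riemannian metric $g$ compatible with $J$; $dv_g$ is the volume form (for the orientation induced by $J$). Complexified forms decompose into types $(p,q)$ with respect to $J$: $\Lambda^{p,q}X$ is the bundle, $\Omega^{p,q}(X)$ its sections; $K_X=\Lambda^{n,0}X$. Let $g_{\mathbb C}$ be the complex bilinear extension of $g$ to $\Lambda^*_{\mathbb C}X=\Lambda^*X\otimes\mathbb C$ and $\langle\alpha,\beta\rangle:=g_{\mathbb C}(\alpha,\bar\beta)$ the associated hermitian metric. Spinors. The canonical $\mathrm{spin}^{\mathrm c}$ structure has spinor bundle $\mathbb S=\mathbb S^+\oplus\mathbb S^-$, $\mathbb S^{\pm}=\Lambda^{0,\mathrm{even/odd}}X$, with Clifford multiplication, for a real covector $\gamma\in T^*X$ with type components $\gamma^{1,0},\gamma^{0,1}$, $$\mathrm c(\gamma)\alpha=\sqrt2\big(\gamma^{0,1}\wedge\alpha-\iota(\gamma^{1,0})\alpha\big),$$ where $\iota(\gamma^{1,0})$ is contraction by the $(0,1)$-vector dual to $\gamma^{1,0}$ with respect to $g_{\mathbb C}$. Dirac operator. Let $\nabla$ be a $\mathrm{spin}^{\mathrm c}$ connection on $\mathbb S$, induced from the Levi-Civita connection and a hermitian connection on $K_X^{-1}$ (it preserves $\mathbb S^\pm$; $\nabla^+$ is its restriction to $\mathbb S^+$), and let $\nabla^E$ be a hermitian connection on $E$. Then $D_E=(\mathrm c\otimes \mathrm{Id}_E)\circ(\nabla^+\otimes\mathrm{Id}_E+\mathrm{Id}_{\mathbb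 S^+}\otimes\nabla^E):\Gamma(\mathbb S^+\otimes E)\to\Gamma(\mathbb S^-\otimes E)$, and $D_E^*$ is its formal adjoint. The principal symbols (with the convention used here) are $\sigma_{D_E}(\gamma)=\mathrm c(\gamma)\otimes\mathrm{Id}_E$ on $\mathbb S^+\otimes E$ and $\sigma_{D_E^*}(\gamma)=-\sigma_{D_E}(\gamma)^*=\mathrm c(\gamma)\otimes\mathrm{Id}_E$ on $\mathbb S^-\otimes E$. Conjugate-linear Hodge star. $\bar *:\Lambda^{p,q}X\to\Lambda^{n-p,n-q}X$ is defined by $\alpha\wedge\bar*(\beta)=\langle\alpha,\beta\rangle\,dv_g$ for $\alpha,\beta\in\Omega^{p,q}(X)$. Put $\tau:=\epsilon_k\bar*$ on $\Lambda^k_{\mathbb C}X$, where $\epsilon_k=i^{k(k-1)+n}$. The hermitian metric on $E$ gives the conjugate-linear isomorphism $E\to E^*$, $\xi\mapsto\xi^*:=\langle\,\cdot\,,\xi\rangle$; define the conjugate-linear map $\tau_E:\Lambda^{p,q}X\otimes E^*\to\Lambda^{n-p,n-q}X\otimes E$ by $\tau_E(\alpha\otimes\xi^* )=\tau(\alpha)\otimes\xi$. The map $A_\varphi$. A section $\varphi\in\Gamma(K_X\otimes E^*\otimes E^* )$ is viewed as a complex-linear bundle map $\varphi:E\to K_X\otimes E^*$: if locally $\varphi=\sum\varphi_{ij}\,\eta\otimes\phi^i\otimes\phi^j$ with $\eta$ a unit frame of $K_X$ and $\{\phi^i\}$ the coframe dual to a unitary frame $\{\phi_i\}$ of $E$,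 then $\varphi(\sum\xi_k\phi_k)=\sum\varphi_{ij}\xi_j\,\eta\otimes\phi^i$. The conjugate-linear bundle map $A_\varphi:\Lambda^{0,p}X\otimes E\to\Lambda^{0,n-p}X\otimes E$ is the composition $$\Lambda^{0,p}X\otimes E\xrightarrow{\mathrm{Id}\otimes\varphi}\Lambda^{0,p}X\otimes K_X\otimes E^*\cong\Lambda^{n,p}X\otimes E^*\xrightarrow{\tau_E}\Lambda^{0,n-p}X\otimes E,$$ where the isomorphism is $\beta\otimes\eta\mapsto\eta\wedge\beta$. When $\dim X\equiv2,6\pmod 8$, $n$ is odd, so $A_\varphi$ maps $\mathbb S^\pm\otimes E$ to $\mathbb S^\mp\otimes E$. The adjoint $A_\varphi^*$ of the conjugate-linear map $A_\varphi:\mathbb S^+\otimes E\to\mathbb S^-\otimes E$ is taken with respect to the real parts of the hermitian metrics. The decomposition $E^*\otimes E^*=\mathrm{Sym}^2E^*\oplus\Lambda^2E^*$ is used. *)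

theory Defs
  imports "HOL-Analysis.Analysis" "HOL-Library.Function_Algebras"
begin

section \<open>Smooth manifolds, tangent spaces, bundles\<close>

primrec Ck_on :: "nat \<Rightarrow> 'a::real_normed_vector set \<Rightarrow> ('a \<Rightarrow> 'b::real_normed_vector) \<Rightarrow> bool" where
  "Ck_on 0 U f \<longleftrightarrow> continuous_on U f"
| "Ck_on (Suc k) U f \<longleftrightarrow>
     (\<forall>x\<in>U. f differentiable (at x)) \<and> (\<forall>v. Ck_on k U (\<lambda>x. frechet_derivative f (at x) v))"

definition smooth_on :: "'a::real_normed_vector set \<Rightarrow> ('a \<Rightarrow> 'b::real_normed_vector) \<Rightarrow> bool" where
  "smooth_on U f \<longleftrightarrow> (\<forall>k. Ck_on k U f)"

type_synonym ('x, 'm) chart = "'x set \<times> ('x \<Rightarrow> real^'m)"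

definition is_chart :: "('x::topological_space, 'm::finite) chart \<Rightarrow> bool" where
  "is_chart c \<longleftrightarrow> (case c of (U, \<psi>) \<Rightarrow>
     open U \<and> open (\<psi> ` U) \<and> homeomorphism U (\<psi> ` U) \<psi> (inv_into U \<psi>))"

definition smooth_atlas :: "('x::topological_space, 'm::finite) chart set \<Rightarrow> bool" where
  "smooth_atlas A \<longleftrightarrow> (\<forall>c\<in>A. is_chart c) \<and> (\<Union>c\<in>A. fst c) = UNIV \<and>
     (\<forall>(U, \<psi>)\<in>A. \<forall>(V, \<psi>')\<in>A. smooth_on (\<psi> ` (U \<inter> V)) (\<psi>' \<circ> inv_into U \<psi>))"

text \<open>Smoothness of a map on an open subset \<open>W\<close> of the manifold.\<close>

definition smooth_map_on ::
  "('x, 'm::finite) chart set \<Rightarrow> 'x set \<Rightarrow> ('x \<Rightarrow> 'b::real_normed_vector) \<Rightarrow> bool" where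
  "smooth_map_on A W f \<longleftrightarrow> (\<forall>(U, \<psi>)\<in>A. smooth_on (\<psi> ` (U \<inter> W)) (f \<circ> inv_into U \<psi>))"

text \<open>
  The tangent space at \<open>x\<close> is the model space \<^typ>\<open>real^'m\<close>, identified with classes of pairs
  (chart, coordinate vector) through a chosen chart around \<open>x\<close>.  The choice varies with \<open>x\<close>
  without any continuity, so smoothness of a tensor field is always tested on the
  coordinate fields of a fixed chart: \<open>from_chart A c x u\<close> is the tangent vector at \<open>x\<close> with
  coordinates \<open>u\<close> in the chart \<open>c\<close>, and \<open>to_chart A c x v\<close> are the coordinates of
  \<open>v\<close> in \<open>c\<close>.
\<close>

definition chart_at :: "('x, 'm::finite) chart set \<Rightarrow> 'x \<Rightarrow> ('x, 'm) chart" where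
  "chart_at A x = (SOME c. c \<in> A \<and> x \<in> fst c)"

definition chart_change :: "('x, 'm::finite) chart \<Rightarrow> ('x, 'm) chart \<Rightarrow> 'x \<Rightarrow> real^'m \<Rightarrow> real^'m" where
  "chart_change c d x u =
     frechet_derivative (snd d \<circ> inv_into (fst c) (snd c)) (at (snd c x)) u"

definition from_chart :: "('x, 'm::finite) chart set \<Rightarrow> ('x, 'm) chart \<Rightarrow> 'x \<Rightarrow> real^'m \<Rightarrow> real^'m" where
  "from_chart A c x u = chart_change c (chart_at A x) x u"

definition to_chart :: "('x, 'm::finite) chart set \<Rightarrow> ('x, 'm) chart \<Rightarrow> 'x \<Rightarrow> real^'m \<Rightarrow> real^'m" where
  "to_chart A c x v = chart_change (chart_at A x) c x v"

definition differential ::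
  "('x, 'm::finite) chart set \<Rightarrow> ('x \<Rightarrow> 'b::real_normed_vector) \<Rightarrow> 'x \<Rightarrow> real^'m \<Rightarrow> 'b" where
  "differential A f x v =
     (case chart_at A x of (U, \<psi>) \<Rightarrow> frechet_derivative (f \<circ> inv_into U \<psi>) (at (\<psi> x)) v)"

definition vector_fields :: "('x, 'm::finite) chart set \<Rightarrow> ('x \<Rightarrow> real^'m) set" where
  "vector_fields A = {Y. \<forall>c\<in>A. smooth_map_on A (fst c) (\<lambda>x. to_chart A c x (Y x))}"

definition riemannian_metric ::
  "('x, 'm::finite) chart set \<Rightarrow> ('x \<Rightarrow> real^'m \<Rightarrow> real^'m \<Rightarrow> real) \<Rightarrow> bool" where
  "riemannian_metric A g \<longleftrightarrow>
     (\<forall>x. bilinear (g x) \<and> (\<forall>u v. g x u v = g x v u) \<and> (\<forall>v. v \<noteq> 0 \<longrightarrow> g x v v > 0)) \<and>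
     (\<forall>c\<in>A. \<forall>u v. smooth_map_on A (fst c) (\<lambda>x. g x (from_chart A c x u) (from_chart A c x v)))"

definition almost_complex_structure ::
  "('x, 'm::finite) chart set \<Rightarrow> ('x \<Rightarrow> real^'m \<Rightarrow> real^'m) \<Rightarrow> bool" where
  "almost_complex_structure A J \<longleftrightarrow>
     (\<forall>x. linear (J x) \<and> (\<forall>v. J x (J x v) = - v)) \<and>
     (\<forall>c\<in>A. \<forall>u. smooth_map_on A (fst c) (\<lambda>x. to_chart A c x (J x (from_chart A c x u))))"

definition almost_hermitian_manifold ::
  "('x::t2_space, 'm::finite) chart set \<Rightarrow> ('x \<Rightarrow> real^'m \<Rightarrow> real^'m) \<Rightarrow>
     ('x \<Rightarrow> real^'m \<Rightarrow> real^'m \<Rightarrow> real) \<Rightarrow> bool" where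
  "almost_hermitian_manifold A J g \<longleftrightarrow>
     smooth_atlas A \<and> almost_complex_structure A J \<and> riemannian_metric A g \<and>
     (\<forall>x u v. g x (J x u) (J x v) = g x u v)"

text \<open>
  The Riemannian measure, i.e. the measure of integration against the volume form: it has
  density \<open>sqrt (det (g\<^sub>i\<^sub>j))\<close> in every chart.
\<close>

definition riemannian_measure ::
  "('x::topological_space, 'm::finite) chart set \<Rightarrow> ('x \<Rightarrow> real^'m \<Rightarrow> real^'m \<Rightarrow> real) \<Rightarrow>
     'x measure \<Rightarrow> bool" where
  "riemannian_measure A g \<mu> \<longleftrightarrow> sets \<mu> = sets borel \<and>
     (\<forall>c\<in>A. \<forall>B\<in>sets borel. B \<subseteq> fst c \<longrightarrow>
        emeasure \<mu> B = (\<integral>\<^sup>+ p. indicator (snd c ` B) p *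
          (let x = inv_into (fst c) (snd c) p in
            ennreal (sqrt (det (\<chi> i j. g x (from_chart A c x (axis i 1)) (from_chart A c x (axis j 1)))))) \<partial>lborel))"

text \<open>
  A complex vector bundle \<open>E\<close> of rank \<open>CARD('r)\<close>: every fibre is a copy of \<^typ>\<open>complex^'r\<close>, and
  the bundle structure is given by the local trivializations \<open>t x\<close>, \<open>x \<in> W\<close>; as for
  tangent spaces, only the transition maps between trivializations are required to be smooth.
\<close>

type_synonym ('x, 'r) triv = "'x set \<times> ('x \<Rightarrow> complex^'r \<Rightarrow> complex^'r)"

definition complex_vector_bundle ::
  "('x::topological_space, 'm::finite) chart set \<Rightarrow> ('x, 'r::finite) triv set \<Rightarrow> bool" where
  "complex_vector_bundle A Tr \<longleftrightarrow>
     (\<Union>c\<in>Tr. fst c) = UNIV \<and>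
     (\<forall>(W, t)\<in>Tr. open W \<and> (\<forall>x\<in>W. bij (t x) \<and>
        (\<forall>u v. t x (u + v) = t x u + t x v) \<and> (\<forall>a v. t x (a *s v) = a *s t x v))) \<and>
     (\<forall>(W, t)\<in>Tr. \<forall>(W', t')\<in>Tr. \<forall>v. smooth_map_on A (W \<inter> W') (\<lambda>x. t' x (inv (t x) v)))"

definition hermitian_bundle ::
  "('x::topological_space, 'm::finite) chart set \<Rightarrow> ('x, 'r::finite) triv set \<Rightarrow>
     ('x \<Rightarrow> complex^'r \<Rightarrow> complex^'r \<Rightarrow> complex) \<Rightarrow> bool" where
  "hermitian_bundle A Tr h \<longleftrightarrow>
     complex_vector_bundle A Tr \<and>
     (\<forall>x. (\<forall>u v w. h x (u + v) w = h x u w + h x v w) \<and>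
          (\<forall>a u v. h x (a *s u) v = a * h x u v) \<and>
          (\<forall>u v. h x v u = cnj (h x u v)) \<and>
          (\<forall>v. v \<noteq> 0 \<longrightarrow> Re (h x v v) > 0)) \<and>
     (\<forall>(W, t)\<in>Tr. \<forall>u v. smooth_map_on A W (\<lambda>x. h x (inv (t x) u) (inv (t x) v)))"

definition sections :: "('x, 'm::finite) chart set \<Rightarrow> ('x, 'r::finite) triv set \<Rightarrow> ('x \<Rightarrow> complex^'r) set" where
  "sections A Tr = {s. \<forall>(W, t)\<in>Tr. smooth_map_on A W (\<lambda>x. t x (s x))}"


section \<open>Forms at a point\<close>

text \<open>
  A form of possibly mixed degree on a tangent space, with values in a vector space, is a function on
  lists of tangent vectors; its part of degree \<open>k\<close> is the restriction to lists of length
  \<open>k\<close>.  Elements of \<open>\<Lambda>\<^sup>*\<otimes>E\<close> are the forms with values in \<open>E\<close>.  The wedge product is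
  the sum over shuffles, without factorials, so that \<open>(\<alpha> \<and> \<beta>)(u, v) = \<alpha> u \<beta> v - \<alpha> v \<beta> u\<close>
  for covectors.
\<close>

type_synonym ('m, 'v) form = "(real^'m) list \<Rightarrow> 'v"

definition deg_part :: "nat \<Rightarrow> ('m::finite, 'v::zero) form \<Rightarrow> ('m, 'v) form" where
  "deg_part k \<omega> = (\<lambda>vs. if length vs = k then \<omega> vs else 0)"

definition wedge_with ::
  "('v \<Rightarrow> 'w \<Rightarrow> complex) \<Rightarrow> ('m::finite, 'v) form \<Rightarrow> ('m, 'w) form \<Rightarrow> ('m, complex) form" where
  "wedge_with m \<alpha> \<beta> = (\<lambda>vs. \<Sum>S\<in>Pow {..<length vs}.
     (-1) ^ card {(i, j). i \<in> S \<and> j < i \<and> j \<notin> S} * m (\<alpha> (nths vs S)) (\<beta> (nths vs (- S))))"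

abbreviation wedge :: "('m::finite, complex) form \<Rightarrow> ('m, complex) form \<Rightarrow> ('m, complex) form" where
  "wedge \<equiv> wedge_with (*)"

definition covector_form :: "(real^'m::finite \<Rightarrow> complex) \<Rightarrow> ('m, complex) form" where
  "covector_form \<theta> = (\<lambda>vs. case vs of [v] \<Rightarrow> \<theta> v | _ \<Rightarrow> 0)"

definition wedges :: "(real^'m::finite \<Rightarrow> complex) list \<Rightarrow> ('m, complex) form" where
  "wedges \<theta>s = foldr (\<lambda>\<theta>. wedge (covector_form \<theta>)) \<theta>s (\<lambda>vs. if vs = [] then 1 else 0)"

text \<open>Real covectors \<open>\<theta>\<close> with complex values are elements of the complexified cotangent space.\<close>

definition type10 :: "(real^'m::finite \<Rightarrow> real^'m) \<Rightarrow> (real^'m \<Rightarrow> complex) \<Rightarrow> bool" where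
  "type10 J \<theta> \<longleftrightarrow> linear \<theta> \<and> (\<forall>v. \<theta> (J v) = \<i> * \<theta> v)"

definition type01 :: "(real^'m::finite \<Rightarrow> real^'m) \<Rightarrow> (real^'m \<Rightarrow> complex) \<Rightarrow> bool" where
  "type01 J \<theta> \<longleftrightarrow> linear \<theta> \<and> (\<forall>v. \<theta> (J v) = - \<i> * \<theta> v)"

text \<open>\<open>Lambda J p q\<close> is the space \<open>\<Lambda>\<^sup>p\<^sup>,\<^sup>q\<close>, the complex span of the products of
  \<open>p\<close> covectors of type \<open>(1,0)\<close> and \<open>q\<close> covectors of type \<open>(0,1)\<close>.\<close>

inductive_set Lambda :: "(real^'m::finite \<Rightarrow> real^'m) \<Rightarrow> nat \<Rightarrow> nat \<Rightarrow> ('m, complex) form set"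
  for J :: "real^'m \<Rightarrow> real^'m" and p q :: nat where
  zero: "(\<lambda>_. 0) \<in> Lambda J p q"
| add: "\<lbrakk>\<omega> \<in> Lambda J p q; length \<theta>s = p; \<forall>\<theta>\<in>set \<theta>s. type10 J \<theta>;
         length \<eta>s = q; \<forall>\<eta>\<in>set \<eta>s. type01 J \<eta>\<rbrakk>
        \<Longrightarrow> (\<lambda>vs. \<omega> vs + a * wedges (\<theta>s @ \<eta>s) vs) \<in> Lambda J p q"

definition orthonormal_list :: "(real^'m::finite \<Rightarrow> real^'m \<Rightarrow> real) \<Rightarrow> (real^'m) list \<Rightarrow> bool" where
  "orthonormal_list g es \<longleftrightarrow>
     (\<forall>i<length es. \<forall>j<length es. g (es ! i) (es ! j) = (if i = j then 1 else 0))"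

text \<open>
  The hermitian metric on forms for which \<open>e\<^sup>I\<close> (\<open>I\<close> increasing) is orthonormal for an
  orthonormal coframe; for alternating forms the sum over all
  \<open>k\<close>-tuples counts every increasing one \<open>k!\<close> times.  The result does not depend on the basis.
  The argument \<open>h\<close> is the metric on values.
\<close>

definition form_inner ::
  "(real^'m::finite \<Rightarrow> real^'m \<Rightarrow> real) \<Rightarrow> ('v \<Rightarrow> 'v \<Rightarrow> complex) \<Rightarrow>
     ('m, 'v) form \<Rightarrow> ('m, 'v) form \<Rightarrow> complex" where
  "form_inner g h \<alpha> \<beta> =
     (let es = (SOME es. length es = CARD('m) \<and> orthonormal_list g es) in
      \<Sum>k\<le>CARD('m). (\<Sum>vs\<in>{vs. length vs = k \<and> set vs \<subseteq> set es}. h (\<alpha> vs) (\<beta> vs)) / fact k)"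

abbreviation cform_inner ::
  "(real^'m::finite \<Rightarrow> real^'m \<Rightarrow> real) \<Rightarrow> ('m, complex) form \<Rightarrow> ('m, complex) form \<Rightarrow> complex" where
  "cform_inner g \<equiv> form_inner g (\<lambda>a b. a * cnj b)"

text \<open>
  The volume form for the orientation induced by \<open>J\<close>: the alternating \<open>2n\<close>-form with value \<open>1\<close> on
  \<open>(e\<^sub>1, J e\<^sub>1, \<dots>, e\<^sub>n, J e\<^sub>n)\<close> for a unitary frame; all unitary frames give the same form.
\<close>

definition alternating_form :: "nat \<Rightarrow> ('m::finite, complex) form \<Rightarrow> bool" where
  "alternating_form k \<omega> \<longleftrightarrow>
     (\<forall>vs. length vs \<noteq> k \<longrightarrow> \<omega> vs = 0) \<and>
     (\<forall>vs i. i < length vs \<longrightarrow> linear (\<lambda>v. \<omega> (vs[i := v]))) \<and>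
     (\<forall>vs. \<not> distinct vs \<longrightarrow> \<omega> vs = 0)"

definition real_frame :: "(real^'m::finite \<Rightarrow> real^'m) \<Rightarrow> (real^'m) list \<Rightarrow> (real^'m) list" where
  "real_frame J es = concat (map (\<lambda>e. [e, J e]) es)"

definition vol_form ::
  "nat \<Rightarrow> (real^'m::finite \<Rightarrow> real^'m) \<Rightarrow> (real^'m \<Rightarrow> real^'m \<Rightarrow> real) \<Rightarrow> ('m, complex) form" where
  "vol_form n J g =
     (let es = (SOME es. length es = n \<and> orthonormal_list g (real_frame J es)) in
      (THE \<omega>. alternating_form (2 * n) \<omega> \<and> \<omega> (real_frame J es) = 1))"


section \<open>Spinors and Clifford multiplication\<close>

text \<open>\<open>spinors J P\<close> is the sum of the \<open>\<Lambda>\<^sup>0\<^sup>,\<^sup>q\<close> with \<open>P q\<close>;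
  \<open>spinorsE J P\<close> is its tensor product with \<open>E\<close>.\<close>

definition spinors :: "(real^'m::finite \<Rightarrow> real^'m) \<Rightarrow> (nat \<Rightarrow> bool) \<Rightarrow> ('m, complex) form set" where
  "spinors J P = {\<omega>. \<forall>q. if P q then deg_part q \<omega> \<in> Lambda J 0 q else deg_part q \<omega> = 0}"

definition spinorsE ::
  "(real^'m::finite \<Rightarrow> real^'m) \<Rightarrow> (nat \<Rightarrow> bool) \<Rightarrow> ('m, complex^'r::finite) form set" where
  "spinorsE J P = {\<omega>. \<forall>i. (\<lambda>vs. \<omega> vs $ i) \<in> spinors J P}"

text \<open>Complex tangent vectors \<open>a + \<i>b\<close> are pairs \<open>(a, b)\<close>; \<open>sharp g \<theta>\<close> is the one dual to
  \<open>\<theta>\<close> with respect to the complex bilinear extension of \<open>g\<close>.\<close>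

definition sharp ::
  "(real^'m::finite \<Rightarrow> real^'m \<Rightarrow> real) \<Rightarrow> (real^'m \<Rightarrow> complex) \<Rightarrow> (real^'m) \<times> (real^'m)" where
  "sharp g \<theta> = (THE w. \<forall>v. complex_of_real (g (fst w) v) + \<i> * complex_of_real (g (snd w) v) = \<theta> v)"

definition contract :: "(real^'m::finite) \<times> (real^'m) \<Rightarrow> ('m, complex) form \<Rightarrow> ('m, complex) form" where
  "contract w \<alpha> = (\<lambda>vs. \<alpha> (fst w # vs) + \<i> * \<alpha> (snd w # vs))"

definition part10 :: "(real^'m::finite \<Rightarrow> real^'m) \<Rightarrow> (real^'m \<Rightarrow> real) \<Rightarrow> real^'m \<Rightarrow> complex" where
  "part10 J \<gamma> v = (complex_of_real (\<gamma> v) - \<i> * complex_of_real (\<gamma> (J v))) / 2"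

definition part01 :: "(real^'m::finite \<Rightarrow> real^'m) \<Rightarrow> (real^'m \<Rightarrow> real) \<Rightarrow> real^'m \<Rightarrow> complex" where
  "part01 J \<gamma> v = (complex_of_real (\<gamma> v) + \<i> * complex_of_real (\<gamma> (J v))) / 2"

definition clifford ::
  "(real^'m::finite \<Rightarrow> real^'m) \<Rightarrow> (real^'m \<Rightarrow> real^'m \<Rightarrow> real) \<Rightarrow> (real^'m \<Rightarrow> real) \<Rightarrow>
     ('m, complex) form \<Rightarrow> ('m, complex) form" where
  "clifford J g \<gamma> \<alpha> = (\<lambda>vs. complex_of_real (sqrt 2) *
     (wedge (covector_form (part01 J \<gamma>)) \<alpha> vs - contract (sharp g (part10 J \<gamma>)) \<alpha> vs))"

text \<open>\<open>T \<otimes> Id\<close> for a complex linear map \<open>T\<close>.\<close>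

definition tensor_Id ::
  "(('m::finite, complex) form \<Rightarrow> ('m, complex) form) \<Rightarrow>
     ('m, complex^'r::finite) form \<Rightarrow> ('m, complex^'r) form" where
  "tensor_Id T \<omega> = (\<lambda>vs. \<chi> i. T (\<lambda>us. \<omega> us $ i) vs)"


section \<open>Connections\<close>

text \<open>
  A connection is a map \<open>D\<close>, where \<open>D x v s\<close> is the derivative at \<open>x\<close> of the section \<open>s\<close> in
  direction \<open>v\<close>.  The set \<open>\<Gamma>\<close> consists of the smooth sections of the bundle
  and \<open>sc\<close> is the scalar multiplication on the fibres.
\<close>

definition connection ::
  "('x, 'm::finite) chart set \<Rightarrow> (real \<Rightarrow> 'v \<Rightarrow> 'v) \<Rightarrow> ('x \<Rightarrow> 'v::ab_group_add) set \<Rightarrow>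
     ('x \<Rightarrow> real^'m \<Rightarrow> ('x \<Rightarrow> 'v) \<Rightarrow> 'v) \<Rightarrow> bool" where
  "connection A sc \<Gamma> D \<longleftrightarrow>
     (\<forall>s\<in>\<Gamma>. \<forall>x u v. D x (u + v) s = D x u s + D x v s) \<and>
     (\<forall>s\<in>\<Gamma>. \<forall>x a v. D x (a *\<^sub>R v) s = sc a (D x v s)) \<and>
     (\<forall>s\<in>\<Gamma>. \<forall>t\<in>\<Gamma>. \<forall>x v. D x v (\<lambda>y. s y + t y) = D x v s + D x v t) \<and>
     (\<forall>f s. smooth_map_on A UNIV f \<longrightarrow> s \<in> \<Gamma> \<longrightarrow>
        (\<forall>x v. D x v (\<lambda>y. sc (f y) (s y)) = sc (differential A f x v) (s x) + sc (f x) (D x v s))) \<and>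
     (\<forall>Y\<in>vector_fields A. \<forall>s\<in>\<Gamma>. (\<lambda>x. D x (Y x) s) \<in> \<Gamma>)"

definition complex_connection ::
  "('x, 'm::finite) chart set \<Rightarrow> (complex \<Rightarrow> 'v \<Rightarrow> 'v) \<Rightarrow> ('x \<Rightarrow> 'v::ab_group_add) set \<Rightarrow>
     ('x \<Rightarrow> real^'m \<Rightarrow> ('x \<Rightarrow> 'v) \<Rightarrow> 'v) \<Rightarrow> bool" where
  "complex_connection A sc \<Gamma> D \<longleftrightarrow>
     connection A (\<lambda>a. sc (complex_of_real a)) \<Gamma> D \<and>
     (\<forall>s\<in>\<Gamma>. \<forall>x v a. D x v (\<lambda>y. sc a (s y)) = sc a (D x v s))"

definition hermitian_connection ::
  "('x, 'm::finite) chart set \<Rightarrow> (complex \<Rightarrow> 'v \<Rightarrow> 'v) \<Rightarrow> ('x \<Rightarrow> 'v::ab_group_add) set \<Rightarrow>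
     ('x \<Rightarrow> 'v \<Rightarrow> 'v \<Rightarrow> complex) \<Rightarrow> ('x \<Rightarrow> real^'m \<Rightarrow> ('x \<Rightarrow> 'v) \<Rightarrow> 'v) \<Rightarrow> bool" where
  "hermitian_connection A sc \<Gamma> ip D \<longleftrightarrow> complex_connection A sc \<Gamma> D \<and>
     (\<forall>s\<in>\<Gamma>. \<forall>t\<in>\<Gamma>. \<forall>x v. differential A (\<lambda>y. ip y (s y) (t y)) x v =
        ip x (D x v s) (t x) + ip x (s x) (D x v t))"

text \<open>The last condition says \<open>D\<^sub>Y Z - D\<^sub>Z Y = [Y, Z]\<close>, with both sides acting on functions.\<close>

definition levi_civita ::
  "('x, 'm::finite) chart set \<Rightarrow> ('x \<Rightarrow> real^'m \<Rightarrow> real^'m \<Rightarrow> real) \<Rightarrow>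
     ('x \<Rightarrow> real^'m \<Rightarrow> ('x \<Rightarrow> real^'m) \<Rightarrow> real^'m) \<Rightarrow> bool" where
  "levi_civita A g D \<longleftrightarrow> connection A (*\<^sub>R) (vector_fields A) D \<and>
     (\<forall>Y\<in>vector_fields A. \<forall>Z\<in>vector_fields A. \<forall>x v.
        differential A (\<lambda>y. g y (Y y) (Z y)) x v = g x (D x v Y) (Z x) + g x (Y x) (D x v Z)) \<and>
     (\<forall>Y\<in>vector_fields A. \<forall>Z\<in>vector_fields A. \<forall>f::'x \<Rightarrow> real. \<forall>x. smooth_map_on A UNIV f \<longrightarrow>
        differential A f x (D x (Y x) Z - D x (Z x) Y) =
        differential A (\<lambda>y. differential A f y (Z y)) x (Y x) -
        differential A (\<lambda>y. differential A f y (Y y)) x (Z x))"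

definition smooth_form :: "('x, 'm::finite) chart set \<Rightarrow> ('x \<Rightarrow> ('m, complex) form) \<Rightarrow> bool" where
  "smooth_form A s \<longleftrightarrow>
     (\<forall>c\<in>A. \<forall>vs. smooth_map_on A (fst c) (\<lambda>x. s x (map (from_chart A c x) vs)))"

definition smooth_formE ::
  "('x, 'm::finite) chart set \<Rightarrow> ('x, 'r::finite) triv set \<Rightarrow> ('x \<Rightarrow> ('m, complex^'r) form) \<Rightarrow> bool" where
  "smooth_formE A Tr s \<longleftrightarrow> (\<forall>c\<in>A. \<forall>(W, t)\<in>Tr. \<forall>vs.
     smooth_map_on A (fst c \<inter> W) (\<lambda>x. t x (s x (map (from_chart A c x) vs))))"

definition spinor_fields ::
  "('x, 'm::finite) chart set \<Rightarrow> ('x \<Rightarrow> real^'m \<Rightarrow> real^'m) \<Rightarrow> (nat \<Rightarrow> bool) \<Rightarrow>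
     ('x \<Rightarrow> ('m, complex) form) set" where
  "spinor_fields A J P = {s. smooth_form A s \<and> (\<forall>x. s x \<in> spinors (J x) P)}"

definition spinorE_fields ::
  "('x, 'm::finite) chart set \<Rightarrow> ('x, 'r::finite) triv set \<Rightarrow> ('x \<Rightarrow> real^'m \<Rightarrow> real^'m) \<Rightarrow>
     (nat \<Rightarrow> bool) \<Rightarrow> ('x \<Rightarrow> ('m, complex^'r) form) set" where
  "spinorE_fields A Tr J P = {s. smooth_formE A Tr s \<and> (\<forall>x. s x \<in> spinorsE (J x) P)}"

definition form_scale :: "complex \<Rightarrow> ('m::finite, complex) form \<Rightarrow> ('m, complex) form" where
  "form_scale a \<omega> = (\<lambda>vs. a * \<omega> vs)"

definition formE_scale :: "complex \<Rightarrow> ('m::finite, complex^'r::finite) form \<Rightarrow> ('m, complex^'r) form" where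
  "formE_scale a \<omega> = (\<lambda>vs. a *s \<omega> vs)"

text \<open>
  The metric identifies \<open>K\<^sup>-\<^sup>1\<close> with \<open>\<Lambda>\<^sup>0\<^sup>,\<^sup>n\<close>.  The pairing of spinors
  \<open>(\<alpha>, \<beta>) \<mapsto> (\<alpha>\<^sup>t \<and> \<beta>)\<^sub>n\<close>, where the transpose \<open>\<alpha>\<^sup>t\<close> reverses the order of the arguments,
  has values in this determinant line and satisfies
  \<open>det_pairing n (c(\<gamma>)\<alpha>) \<beta> = det_pairing n \<alpha> (c(\<gamma>)\<beta>)\<close>; it is the
  equivariant pairing that relates the spinor bundle to its determinant line.
\<close>

definition det_pairing ::
  "nat \<Rightarrow> ('m::finite, complex) form \<Rightarrow> ('m, complex) form \<Rightarrow> ('m, complex) form" where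
  "det_pairing n \<alpha> \<beta> = deg_part n (wedge (\<lambda>vs. \<alpha> (rev vs)) \<beta>)"

text \<open>
  \<open>D\<close> is the \<open>spin\<^sup>c\<close> connection induced from the Levi-Civita connection \<open>L\<close> and the hermitian
  connection \<open>K\<close> on the determinant line: the hermitian connection preserving the two half-spinor
  bundles for which Clifford multiplication is parallel with respect to \<open>L\<close>
  and which induces \<open>K\<close> on the determinant line.
\<close>

definition spinc_connection ::
  "nat \<Rightarrow> ('x, 'm::finite) chart set \<Rightarrow> ('x \<Rightarrow> real^'m \<Rightarrow> real^'m) \<Rightarrow>
     ('x \<Rightarrow> real^'m \<Rightarrow> real^'m \<Rightarrow> real) \<Rightarrow>
     ('x \<Rightarrow> real^'m \<Rightarrow> ('x \<Rightarrow> real^'m) \<Rightarrow> real^'m) \<Rightarrow>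
     ('x \<Rightarrow> real^'m \<Rightarrow> ('x \<Rightarrow> ('m, complex) form) \<Rightarrow> ('m, complex) form) \<Rightarrow>
     ('x \<Rightarrow> real^'m \<Rightarrow> ('x \<Rightarrow> ('m, complex) form) \<Rightarrow> ('m, complex) form) \<Rightarrow> bool" where
  "spinc_connection n A J g L K D \<longleftrightarrow>
     levi_civita A g L \<and>
     hermitian_connection A form_scale (spinor_fields A J (\<lambda>q. q = n)) (\<lambda>x. cform_inner (g x)) K \<and>
     hermitian_connection A form_scale (spinor_fields A J (\<lambda>_. True)) (\<lambda>x. cform_inner (g x)) D \<and>
     (\<forall>s\<in>spinor_fields A J even. \<forall>x v. D x v s \<in> spinors (J x) even) \<and>
     (\<forall>s\<in>spinor_fields A J odd. \<forall>x v. D x v s \<in> spinors (J x) odd) \<and>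
     (\<forall>Z\<in>vector_fields A. \<forall>s\<in>spinor_fields A J (\<lambda>_. True). \<forall>x v.
        D x v (\<lambda>y. clifford (J y) (g y) (g y (Z y)) (s y)) =
        clifford (J x) (g x) (g x (L x v Z)) (s x) + clifford (J x) (g x) (g x (Z x)) (D x v s)) \<and>
     (\<forall>s\<in>spinor_fields A J (\<lambda>_. True). \<forall>t\<in>spinor_fields A J (\<lambda>_. True). \<forall>x v.
        K x v (\<lambda>y. det_pairing n (s y) (t y)) =
        det_pairing n (D x v s) (t x) + det_pairing n (s x) (D x v t))"

definition pure_tensor ::
  "('m::finite, complex) form \<Rightarrow> complex^'r::finite \<Rightarrow> ('m, complex^'r) form" where
  "pure_tensor \<alpha> \<xi> = (\<lambda>vs. \<alpha> vs *s \<xi>)"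

text \<open>\<open>N\<close> is the connection \<open>D \<otimes> Id + Id \<otimes> DE\<close>, characterized by its values on
  products of sections.\<close>

definition tensor_connection ::
  "('x, 'm::finite) chart set \<Rightarrow> ('x, 'r::finite) triv set \<Rightarrow> ('x \<Rightarrow> real^'m \<Rightarrow> real^'m) \<Rightarrow>
     (nat \<Rightarrow> bool) \<Rightarrow>
     ('x \<Rightarrow> real^'m \<Rightarrow> ('x \<Rightarrow> ('m, complex) form) \<Rightarrow> ('m, complex) form) \<Rightarrow>
     ('x \<Rightarrow> real^'m \<Rightarrow> ('x \<Rightarrow> complex^'r) \<Rightarrow> complex^'r) \<Rightarrow>
     ('x \<Rightarrow> real^'m \<Rightarrow> ('x \<Rightarrow> ('m, complex^'r) form) \<Rightarrow> ('m, complex^'r) form) \<Rightarrow> bool" where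
  "tensor_connection A Tr J P D DE N \<longleftrightarrow>
     complex_connection A formE_scale (spinorE_fields A Tr J P) N \<and>
     (\<forall>s\<in>spinor_fields A J P. \<forall>\<xi>\<in>sections A Tr. \<forall>x v.
        N x v (\<lambda>y. pure_tensor (s y) (\<xi> y)) =
        pure_tensor (D x v s) (\<xi> x) + pure_tensor (s x) (DE x v \<xi>))"


section \<open>Dirac operator, formal adjoints and principal symbols\<close>

text \<open>The standard basis serves as a basis of the tangent space at \<open>x\<close>; \<open>\<lambda>v. v \<bullet> b\<close> is the dual basis.\<close>

definition dirac ::
  "('x \<Rightarrow> real^'m \<Rightarrow> real^'m) \<Rightarrow> ('x \<Rightarrow> real^'m \<Rightarrow> real^'m \<Rightarrow> real) \<Rightarrow>
     ('x \<Rightarrow> real^'m \<Rightarrow> ('x \<Rightarrow> ('m, complex^'r) form) \<Rightarrow> ('m, complex^'r) form) \<Rightarrow>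
     ('x \<Rightarrow> ('m::finite, complex^'r::finite) form) \<Rightarrow> 'x \<Rightarrow> ('m, complex^'r) form" where
  "dirac J g N s x = (\<Sum>b\<in>Basis. tensor_Id (clifford (J x) (g x) (\<lambda>v. v \<bullet> b)) (N x b s))"

definition formal_adjoint ::
  "'x measure \<Rightarrow> ('x \<Rightarrow> 'v \<Rightarrow> 'v \<Rightarrow> complex) \<Rightarrow> ('x \<Rightarrow> 'v) set \<Rightarrow> ('x \<Rightarrow> 'v) set \<Rightarrow>
     (('x \<Rightarrow> 'v) \<Rightarrow> 'x \<Rightarrow> 'v) \<Rightarrow> (('x \<Rightarrow> 'v) \<Rightarrow> 'x \<Rightarrow> 'v) \<Rightarrow> bool" where
  "formal_adjoint \<mu> ip \<Gamma>1 \<Gamma>2 P Q \<longleftrightarrow>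
     (\<forall>t\<in>\<Gamma>2. Q t \<in> \<Gamma>1) \<and>
     (\<forall>s\<in>\<Gamma>1. \<forall>t\<in>\<Gamma>2. \<exists>I. has_bochner_integral \<mu> (\<lambda>x. ip x (P s x) (t x)) I \<and>
                        has_bochner_integral \<mu> (\<lambda>x. ip x (s x) (Q t x)) I)"

text \<open>
  The principal symbol at the covector \<open>\<gamma>\<close> at \<open>x\<close> of a first order operator \<open>P\<close>, with the
  convention without a factor \<open>\<i>\<close>: \<open>e \<mapsto> P (f s) x\<close>
  for any section \<open>s\<close> with \<open>s x = e\<close> and function \<open>f\<close> with \<open>f x = 0\<close>, \<open>df\<^sub>x = \<gamma>\<close>.
\<close>

definition principal_symbol ::
  "('x, 'm::finite) chart set \<Rightarrow> (complex \<Rightarrow> 'v \<Rightarrow> 'v) \<Rightarrow> ('x \<Rightarrow> 'v) set \<Rightarrow>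
     (('x \<Rightarrow> 'v) \<Rightarrow> 'x \<Rightarrow> 'w) \<Rightarrow> 'x \<Rightarrow> (real^'m \<Rightarrow> real) \<Rightarrow> 'v \<Rightarrow> 'w" where
  "principal_symbol A sc \<Gamma> P x \<gamma> e =
     (THE w. \<forall>f s. smooth_map_on A UNIV f \<and> f x = 0 \<and> differential A f x = \<gamma> \<and> s \<in> \<Gamma> \<and> s x = e \<longrightarrow>
        P (\<lambda>y. sc (complex_of_real (f y)) (s y)) x = w)"


section \<open>The conjugate-linear map associated with \<open>\<phi>\<close>\<close>

definition bar_star ::
  "nat \<Rightarrow> (real^'m::finite \<Rightarrow> real^'m) \<Rightarrow> (real^'m \<Rightarrow> real^'m \<Rightarrow> real) \<Rightarrow> nat \<Rightarrow> nat \<Rightarrow>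
     ('m, complex) form \<Rightarrow> ('m, complex) form" where
  "bar_star n J g p q \<beta> =
     (THE \<sigma>. \<sigma> \<in> Lambda J (n - p) (n - q) \<and>
        (\<forall>\<alpha>\<in>Lambda J p q. wedge \<alpha> \<sigma> = form_scale (cform_inner g \<alpha> \<beta>) (vol_form n J g)))"

definition tau ::
  "nat \<Rightarrow> (real^'m::finite \<Rightarrow> real^'m) \<Rightarrow> (real^'m \<Rightarrow> real^'m \<Rightarrow> real) \<Rightarrow> nat \<Rightarrow> nat \<Rightarrow>
     ('m, complex) form \<Rightarrow> ('m, complex) form" where
  "tau n J g p q \<beta> =
     form_scale (let k = p + q in \<i> ^ (k * (k - 1) + n)) (bar_star n J g p q \<beta>)"

text \<open>
  Elements of \<open>\<Lambda>\<^sup>p\<^sup>,\<^sup>q\<otimes>E\<^sup>*\<close> are forms with values in the linear functionals on \<open>E\<close>; such a form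
  is a sum of products \<open>\<alpha> \<otimes> \<xi>\<^sup>*\<close> with \<open>\<xi>\<^sup>* = h(\<cdot>, \<xi>)\<close>, and \<open>tau_E\<close> maps it to the sum of
  the \<open>\<tau>(\<alpha>) \<otimes> \<xi>\<close>.
\<close>

definition tau_E ::
  "nat \<Rightarrow> (real^'m::finite \<Rightarrow> real^'m) \<Rightarrow> (real^'m \<Rightarrow> real^'m \<Rightarrow> real) \<Rightarrow>
     (complex^'r::finite \<Rightarrow> complex^'r \<Rightarrow> complex) \<Rightarrow> nat \<Rightarrow> nat \<Rightarrow>
     ('m, complex^'r \<Rightarrow> complex) form \<Rightarrow> ('m, complex^'r) form" where
  "tau_E n J g h p q \<omega> =
     (THE \<psi>. \<exists>N. \<exists>\<alpha> :: nat \<Rightarrow> ('m, complex) form. \<exists>\<xi> :: nat \<Rightarrow> complex^'r.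
        (\<forall>j<N. \<alpha> j \<in> Lambda J p q) \<and>
        \<omega> = (\<lambda>vs \<zeta>. \<Sum>j<N. \<alpha> j vs * h \<zeta> (\<xi> j)) \<and>
        \<psi> = (\<Sum>j<N. pure_tensor (tau n J g p q (\<alpha> j)) (\<xi> j)))"

text \<open>
  Elements of \<open>K\<otimes>E\<^sup>*\<otimes>E\<^sup>*\<close> are \<open>(n,0)\<close>-forms with values in the complex bilinear forms
  on \<open>E\<close>.
\<close>

type_synonym ('m, 'r) Kbilinear = "('m, complex^'r \<Rightarrow> complex^'r \<Rightarrow> complex) form"

definition K_EE :: "nat \<Rightarrow> (real^'m::finite \<Rightarrow> real^'m) \<Rightarrow> ('m, 'r::finite) Kbilinear set" where
  "K_EE n J = {\<phi>.
     (\<forall>vs u v w. \<phi> vs (u + v) w = \<phi> vs u w + \<phi> vs v w \<and> \<phi> vs u (v + w) = \<phi> vs u v + \<phi> vs u w) \<and>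
     (\<forall>vs a u v. \<phi> vs (a *s u) v = a * \<phi> vs u v \<and> \<phi> vs u (a *s v) = a * \<phi> vs u v) \<and>
     (\<forall>u v. (\<lambda>vs. \<phi> vs u v) \<in> Lambda J n 0)}"

definition K_Sym2 :: "nat \<Rightarrow> (real^'m::finite \<Rightarrow> real^'m) \<Rightarrow> ('m, 'r::finite) Kbilinear set" where
  "K_Sym2 n J = {\<phi> \<in> K_EE n J. \<forall>vs u v. \<phi> vs u v = \<phi> vs v u}"

definition K_Alt2 :: "nat \<Rightarrow> (real^'m::finite \<Rightarrow> real^'m) \<Rightarrow> ('m, 'r::finite) Kbilinear set" where
  "K_Alt2 n J = {\<phi> \<in> K_EE n J. \<forall>vs u v. \<phi> vs u v = - \<phi> vs v u}"

definition smooth_Kbilinear ::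
  "('x, 'm::finite) chart set \<Rightarrow> ('x, 'r::finite) triv set \<Rightarrow> ('x \<Rightarrow> ('m, 'r) Kbilinear) \<Rightarrow> bool" where
  "smooth_Kbilinear A Tr \<phi> \<longleftrightarrow> (\<forall>c\<in>A. \<forall>(W, t)\<in>Tr. \<forall>vs u v.
     smooth_map_on A (fst c \<inter> W)
       (\<lambda>x. \<phi> x (map (from_chart A c x) vs) (inv (t x) u) (inv (t x) v)))"

text \<open>
  The map \<open>\<Lambda>\<^sup>0\<^sup>,\<^sup>p\<otimes>E \<rightarrow> \<Lambda>\<^sup>0\<^sup>,\<^sup>p\<otimes>K\<otimes>E\<^sup>* \<cong> \<Lambda>\<^sup>n\<^sup>,\<^sup>p\<otimes>E\<^sup>*\<close>: for
  \<open>\<phi> = \<Sum> \<phi>\<^sub>i\<^sub>j \<eta> \<otimes> \<phi>\<^sup>i \<otimes> \<phi>\<^sup>j\<close> it sends \<open>\<beta> \<otimes> \<phi>\<^sub>j\<close> to \<open>\<Sum>\<^sub>i \<phi>\<^sub>i\<^sub>j \<eta> \<and> \<beta> \<otimes> \<phi>\<^sup>i\<close>, so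
  the value of the form in \<open>E\<close> enters the second slot of \<open>\<phi>\<close>, and the form part of
  \<open>\<phi>\<close> stands on the left.
\<close>

definition phi_wedge ::
  "('m::finite, 'r::finite) Kbilinear \<Rightarrow> ('m, complex^'r) form \<Rightarrow> ('m, complex^'r \<Rightarrow> complex) form" where
  "phi_wedge \<phi> \<omega> = (\<lambda>vs \<zeta>. wedge_with (\<lambda>b \<xi>. b \<zeta> \<xi>) \<phi> \<omega> vs)"

definition A_map ::
  "nat \<Rightarrow> (real^'m::finite \<Rightarrow> real^'m) \<Rightarrow> (real^'m \<Rightarrow> real^'m \<Rightarrow> real) \<Rightarrow>
     (complex^'r::finite \<Rightarrow> complex^'r \<Rightarrow> complex) \<Rightarrow> ('m, 'r) Kbilinear \<Rightarrow>
     ('m, complex^'r) form \<Rightarrow> ('m, complex^'r) form" where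
  "A_map n J g h \<phi> \<omega> = (\<Sum>p\<le>n. tau_E n J g h n p (phi_wedge \<phi> (deg_part p \<omega>)))"

text \<open>The adjoint with respect to the real parts of the hermitian metrics of a map defined on \<open>V\<close>.\<close>

definition real_adjoint ::
  "(real^'m::finite \<Rightarrow> real^'m \<Rightarrow> real) \<Rightarrow> (complex^'r::finite \<Rightarrow> complex^'r \<Rightarrow> complex) \<Rightarrow>
     ('m, complex^'r) form set \<Rightarrow> (('m, complex^'r) form \<Rightarrow> ('m, complex^'r) form) \<Rightarrow>
     ('m, complex^'r) form \<Rightarrow> ('m, complex^'r) form" where
  "real_adjoint g h V T \<beta> =
     (THE \<beta>'. \<beta>' \<in> V \<and> (\<forall>\<alpha>\<in>V. Re (form_inner g h (T \<alpha>) \<beta>) = Re (form_inner g h \<alpha> \<beta>')))"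

end

theory Submission
  imports Defs
begin

text \<open>
  The proof has an analytic half, which computes the two principal symbols, and an algebraic half,
  which takes place at one point.

  Both symbols are Clifford multiplication \<open>c(\<gamma>)\<close>. For \<open>D\<close> this is the Leibniz rule
  \<open>D(fs) = f D s + c(df) s\<close>, once every covector is known to be the differential of a function and
  every spinor the value of a smooth field (\<open>function_with_differential\<close>, \<open>field_with_value\<close>). The
  formal adjoint is only known through integrals. These show that the defect \<open>w\<close> of its own
  Leibniz rule is orthogonal to all smooth fields, hence to itself, because it is smooth; the
  Riemannian measure being positive on open sets, \<open>w = 0\<close> (\<open>formal_adjoint_leibniz\<close>).

  It remains to see that the real adjoint of \<open>A\<^sub>\<phi>\<close> maps \<open>c(\<gamma>)\<alpha>\<close> to \<open>- c(\<gamma>) A\<^sub>\<phi> \<alpha>\<close>. As \<open>c(\<gamma>)\<close> is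
  skew-adjoint, this means that the form \<open>(\<beta>, \<alpha>) \<mapsto> \<langle>c(\<gamma>)\<beta>, A\<^sub>\<phi> \<alpha>\<rangle>\<close> is symmetric on even spinors. Let \<open>\<eta>\<close>
  and \<open>\<nu>\<close> span the forms of type (n,0) and (0,n), and let \<open>\<sigma>\<alpha>\<close> be the contraction of \<open>\<nu>\<close> by \<open>\<alpha>\<close>. On
  products \<open>\<eta> \<and> \<alpha>\<close> with \<open>\<alpha>\<close> of type (0,q), the map \<open>\<tau>\<close> is \<open>\<sigma>\<close> up to a factor that depends only on the
  parity of \<open>q\<close> (\<open>tau_eq\<close>). Consequently
  \<open>\<langle>\<beta>, A\<^sub>\<phi> \<alpha>\<rangle>\<close> is a constant times the sum of the \<open>\<phi>\<^sub>i\<^sub>j b(\<beta>\<^sub>i, \<alpha>\<^sub>j)\<close>, where \<open>b(\<beta>, \<alpha>) = \<langle>\<beta>, \<sigma>\<alpha>\<rangle>\<close> is a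
  bilinear form on scalar spinors (\<open>A_map_pairing\<close>). Two facts about \<open>b\<close> suffice
  (\<open>clifford_star_pairing\<close>). First, \<open>\<sigma>\<close> exchanges multiplication by a covector with its adjoint, the
  contraction, so \<open>c(\<gamma>)\<close> can be moved from one argument of \<open>b\<close> to the other. Second, \<open>b\<close> is
  symmetric up to the sign \<open>(-1)\<^sup>n\<^sup>(\<^sup>n\<^sup>-\<^sup>1\<^sup>)\<^sup>/\<^sup>2\<close>, since this is the effect of reversing a product of \<open>n\<close>
  covectors. The sign is 1 in real dimension 2 and -1 in real dimension 6 modulo 8, and there \<open>\<phi>\<close> is
  symmetric and alternating, respectively: the signs compensate.

  The exterior algebra is treated through one recursion (\<open>wedge_Cons\<close>), which makes insertion of a
  vector in the first slot an antiderivation of the wedge product.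
\<close>

section \<open>The shuffle product\<close>

text \<open>Interior multiplication by a real vector.\<close>

definition plug :: "real^'m::finite \<Rightarrow> ('m, complex) form \<Rightarrow> ('m, complex) form" where
  "plug v \<alpha> = (\<lambda>us. \<alpha> (v # us))"

text \<open>The parity involution of the exterior algebra.\<close>

definition grade :: "('m::finite, complex) form \<Rightarrow> ('m, complex) form" where
  "grade \<alpha> = (\<lambda>us. (-1) ^ length us * \<alpha> us)"

definition unit_form :: "('m::finite, complex) form" where
  "unit_form = (\<lambda>vs. if vs = [] then 1 else 0)"

lemma wedge_with_Nil: "wedge_with m \<alpha> \<beta> [] = m (\<alpha> []) (\<beta> [])"
  by (simp add: wedge_with_def)

lemma inversions_Suc:
  fixes T :: "nat set"
  assumes "finite T"
  shows "card {(i, j). i \<in> Suc ` T \<and> j < i \<and> j \<notin> Suc ` T} =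
           card {(i, j). i \<in> T \<and> j < i \<and> j \<notin> T} + card T"
    and "card {(i, j). i \<in> insert 0 (Suc ` T) \<and> j < i \<and> j \<notin> insert 0 (Suc ` T)} =
           card {(i, j). i \<in> T \<and> j < i \<and> j \<notin> T}"
proof -
  let ?I = "{(i, j). i \<in> T \<and> j < i \<and> j \<notin> T}"
  have fin: "finite ?I"
    by (rule finite_subset[of _ "SIGMA i:T. {..<i}"]) (use assms in auto)
  have inj: "inj_on (map_prod Suc Suc) ?I" by (auto simp: inj_on_def)
  have "{(i, j). i \<in> Suc ` T \<and> j < i \<and> j \<notin> Suc ` T} = map_prod Suc Suc ` ?I \<union> (\<lambda>i. (Suc i, 0)) ` T"
    (is "?L = ?R")
  proof (rule set_eqI)
    fix p :: "nat \<times> nat"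
    obtain a b where p: "p = (a, b)" by (cases p)
    show "p \<in> ?L \<longleftrightarrow> p \<in> ?R" unfolding p by (cases a; cases b) (auto simp: image_iff)
  qed
  moreover have "card (map_prod Suc Suc ` ?I \<union> (\<lambda>i. (Suc i, 0)) ` T) = card ?I + card T"
    by (subst card_Un_disjoint) (auto simp: fin assms card_image[OF inj] card_image inj_on_def)
  ultimately show "card {(i, j). i \<in> Suc ` T \<and> j < i \<and> j \<notin> Suc ` T} = card ?I + card T" by simp
  have "{(i, j). i \<in> insert 0 (Suc ` T) \<and> j < i \<and> j \<notin> insert 0 (Suc ` T)} = map_prod Suc Suc ` ?I"
    (is "?L = ?R")
  proof (rule set_eqI)
    fix p :: "nat \<times> nat"
    obtain a b where p: "p = (a, b)" by (cases p)
    show "p \<in> ?L \<longleftrightarrow> p \<in> ?R" unfolding p by (cases a; cases b) (auto simp: image_iff)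
  qed
  then show "card {(i, j). i \<in> insert 0 (Suc ` T) \<and> j < i \<and> j \<notin> insert 0 (Suc ` T)} = card ?I"
    by (simp add: card_image[OF inj])
qed

text \<open>The first argument \<open>v\<close> goes to \<open>\<alpha>\<close> or to \<open>\<beta>\<close>; in the second case it is an inversion with every
  argument of \<open>\<alpha>\<close>, which explains the parity involution. So insertion of a vector is an antiderivation
  already on arbitrary functions of argument lists, and this recursion replaces the sum over shuffles
  in all later proofs, which are inductions on the argument list.\<close>

lemma wedge_Cons:
  "wedge \<alpha> \<beta> (v # vs) = wedge (plug v \<alpha>) \<beta> vs + wedge (grade \<alpha>) (plug v \<beta>) vs"
proof -
  let ?n = "length vs"
  define f where "f S = (-1) ^ card {(i, j). i \<in> S \<and> j < i \<and> j \<notin> S} *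
    (\<alpha> (nths (v # vs) S) * \<beta> (nths (v # vs) (- S)))" for S
  have P: "Pow {..<Suc ?n} = (`) Suc ` Pow {..<?n} \<union> (\<lambda>T. insert 0 (Suc ` T)) ` Pow {..<?n}"
    unfolding lessThan_Suc_eq_insert_0 Pow_insert by (simp add: image_Pow_surj[OF refl, symmetric] image_image)
  have "wedge \<alpha> \<beta> (v # vs) = (\<Sum>S\<in>Pow {..<Suc ?n}. f S)"
    unfolding wedge_with_def f_def by simp
  also have "\<dots> = sum f ((`) Suc ` Pow {..<?n}) + sum f ((\<lambda>T. insert 0 (Suc ` T)) ` Pow {..<?n})"
    unfolding P by (rule sum.union_disjoint) auto
  also have "sum f ((`) Suc ` Pow {..<?n}) = (\<Sum>T\<in>Pow {..<?n}. f (Suc ` T))"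
    by (subst sum.reindex) (auto simp: inj_on_def inj_image_eq_iff)
  also have "\<dots> = wedge (grade \<alpha>) (plug v \<beta>) vs"
    unfolding wedge_with_def
  proof (rule sum.cong[OF refl])
    fix T assume T: "T \<in> Pow {..<?n}"
    then have fT: "finite T" by (auto intro: finite_subset)
    have "{i. i < ?n \<and> i \<in> T} = T" using T by auto
    then have l: "length (nths vs T) = card T" by (simp add: length_nths)
    have s: "{j. Suc j \<in> Suc ` T} = T" "{j. Suc j \<in> - (Suc ` T)} = - T" by auto
    show "f (Suc ` T) = (-1) ^ card {(i, j). i \<in> T \<and> j < i \<and> j \<notin> T} *
        (grade \<alpha> (nths vs T) * plug v \<beta> (nths vs (- T)))"
      unfolding f_def inversions_Suc(1)[OF fT]
      unfolding nths_Cons grade_def plug_def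
      using s by (simp add: l power_add)
  qed
  also have "sum f ((\<lambda>T. insert 0 (Suc ` T)) ` Pow {..<?n}) = (\<Sum>T\<in>Pow {..<?n}. f (insert 0 (Suc ` T)))"
    by (subst sum.reindex) (auto simp: inj_on_def inj_image_eq_iff insert_ident)
  also have "\<dots> = wedge (plug v \<alpha>) \<beta> vs"
    unfolding wedge_with_def
  proof (rule sum.cong[OF refl])
    fix T assume T: "T \<in> Pow {..<?n}"
    then have fT: "finite T" by (auto intro: finite_subset)
    have s: "{j. Suc j \<in> insert 0 (Suc ` T)} = T" "{j. Suc j \<in> - insert 0 (Suc ` T)} = - T" by auto
    show "f (insert 0 (Suc ` T)) = (-1) ^ card {(i, j). i \<in> T \<and> j < i \<and> j \<notin> T} *
        (plug v \<alpha> (nths vs T) * \<beta> (nths vs (- T)))"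
      unfolding f_def inversions_Suc(2)[OF fT]
      unfolding nths_Cons plug_def using s by simp
  qed
  finally show ?thesis by simp
qed

lemma plug_wedge: "plug v (wedge \<alpha> \<beta>) = wedge (plug v \<alpha>) \<beta> + wedge (grade \<alpha>) (plug v \<beta>)"
  by (rule ext) (simp add: plug_def[of v "wedge \<alpha> \<beta>"] wedge_Cons)

lemma form_scale_simps [simp]:
  "form_scale 1 \<alpha> = \<alpha>" "form_scale 0 \<alpha> = 0" "form_scale a 0 = 0"
  "form_scale a (form_scale b \<alpha>) = form_scale (a * b) \<alpha>"
  by (auto simp: form_scale_def)

lemma form_scale_add: "form_scale a (\<alpha> + \<beta>) = form_scale a \<alpha> + form_scale a \<beta>"
  and form_scale_diff: "form_scale a (\<alpha> - \<beta>) = form_scale a \<alpha> - form_scale a \<beta>"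
  and form_scale_minus1: "form_scale (- 1) \<alpha> = - \<alpha>"
  and form_scale_add_left: "form_scale (a + b) \<alpha> = form_scale a \<alpha> + form_scale b \<alpha>"
  by (auto simp: form_scale_def algebra_simps)

lemma wedge_add_left: "wedge (\<alpha> + \<alpha>') \<beta> = wedge \<alpha> \<beta> + wedge \<alpha>' \<beta>"
  and wedge_add_right: "wedge \<alpha> (\<beta> + \<beta>') = wedge \<alpha> \<beta> + wedge \<alpha> \<beta>'"
  and wedge_scale_left: "wedge (form_scale a \<alpha>) \<beta> = form_scale a (wedge \<alpha> \<beta>)"
  and wedge_scale_right: "wedge \<alpha> (form_scale a \<beta>) = form_scale a (wedge \<alpha> \<beta>)"
  by (auto simp: wedge_with_def form_scale_def algebra_simps sum.distrib sum_distrib_left intro!: ext sum.cong)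

lemma wedge_zero [simp]: "wedge 0 \<beta> = 0" "wedge \<alpha> 0 = 0"
  by (auto simp: wedge_with_def intro!: ext)

lemma wedge_minus_left: "wedge (- \<alpha>) \<beta> = - wedge \<alpha> \<beta>"
  and wedge_minus_right: "wedge \<alpha> (- \<beta>) = - wedge \<alpha> \<beta>"
  using wedge_scale_left[of "-1" \<alpha> \<beta>] wedge_scale_right[of \<alpha> "-1" \<beta>] by (simp_all add: form_scale_minus1)

lemma wedge_diff_right: "wedge \<alpha> (\<beta> - \<beta>') = wedge \<alpha> \<beta> - wedge \<alpha> \<beta>'"
  using wedge_add_right[of \<alpha> \<beta> "- \<beta>'"] by (simp add: wedge_minus_right)

lemma plug_grade: "plug v (grade \<alpha>) = - grade (plug v \<alpha>)"
  and plug_unit [simp]: "plug v unit_form = 0"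
  by (auto simp: plug_def grade_def form_scale_def unit_form_def)

lemma grade_unit [simp]: "grade unit_form = unit_form"
  and grade_grade [simp]: "grade (grade \<alpha>) = \<alpha>"
  by (auto simp: grade_def unit_form_def distrib_left power_mult_distrib[symmetric] mult.assoc[symmetric])

lemma grade_wedge: "grade (wedge \<alpha> \<beta>) = wedge (grade \<alpha>) (grade \<beta>)"
proof
  fix vs show "grade (wedge \<alpha> \<beta>) vs = wedge (grade \<alpha>) (grade \<beta>) vs"
  proof (induction vs arbitrary: \<alpha> \<beta>)
    case Nil then show ?case by (simp add: grade_def wedge_with_Nil)
  next
    case (Cons v vs)
    have "grade (wedge \<alpha> \<beta>) (v # vs) = - (grade (wedge (plug v \<alpha>) \<beta>) vs + grade (wedge (grade \<alpha>) (plug v \<beta>)) vs)"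
      by (simp add: grade_def[of "wedge _ _"] wedge_Cons algebra_simps)
    then show ?case unfolding Cons by (simp add: wedge_Cons plug_grade wedge_minus_left wedge_minus_right)
  qed
qed

lemma wedge_assoc: "wedge (wedge \<alpha> \<beta>) \<gamma> = wedge \<alpha> (wedge \<beta> \<gamma>)"
proof
  fix vs show "wedge (wedge \<alpha> \<beta>) \<gamma> vs = wedge \<alpha> (wedge \<beta> \<gamma>) vs"
    by (induction vs arbitrary: \<alpha> \<beta> \<gamma>)
      (simp_all add: wedge_with_Nil wedge_Cons plug_wedge wedge_add_left wedge_add_right grade_wedge)
qed

lemma wedge_unit_left [simp]: "wedge unit_form \<alpha> = \<alpha>"
proof
  fix vs show "wedge unit_form \<alpha> vs = \<alpha> vs"
    by (induction vs arbitrary: \<alpha>) (simp_all add: wedge_with_Nil wedge_Cons, simp_all add: unit_form_def plug_def)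
qed

lemma wedge_unit_right [simp]: "wedge \<alpha> unit_form = \<alpha>"
proof
  fix vs show "wedge \<alpha> unit_form vs = \<alpha> vs"
    by (induction vs arbitrary: \<alpha>) (simp_all add: wedge_with_Nil wedge_Cons, simp_all add: unit_form_def plug_def)
qed

lemma plug_covector: "plug v (covector_form \<theta>) = form_scale (\<theta> v) unit_form"
  and grade_covector: "grade (covector_form \<theta>) = - covector_form \<theta>"
  by (auto simp: plug_def grade_def covector_form_def form_scale_def unit_form_def split: list.splits)

lemma plug_covector_wedge:
  "plug v (wedge (covector_form \<theta>) \<alpha>) = form_scale (\<theta> v) \<alpha> - wedge (covector_form \<theta>) (plug v \<alpha>)"
  by (simp add: plug_wedge plug_covector grade_covector wedge_scale_left wedge_minus_left)

lemma covector_wedge_Nil [simp]: "wedge (covector_form \<theta>) \<alpha> [] = 0"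
  by (simp add: wedge_with_Nil covector_form_def)

lemma covector_wedge_Cons:
  "wedge (covector_form \<theta>) \<alpha> (v # vs) = \<theta> v * \<alpha> vs - wedge (covector_form \<theta>) (plug v \<alpha>) vs"
  using fun_cong[OF plug_covector_wedge[of v \<theta> \<alpha>], of vs] by (simp add: plug_def[of v "wedge _ _"] form_scale_def)

text \<open>The case of graded commutativity from which all reorderings of products of covectors follow.\<close>

lemma covector_anticommute:
  "wedge (covector_form \<theta>) (wedge (covector_form \<theta>') \<alpha>) = - wedge (covector_form \<theta>') (wedge (covector_form \<theta>) \<alpha>)"
proof
  fix vs show "wedge (covector_form \<theta>) (wedge (covector_form \<theta>') \<alpha>) vs =
      (- wedge (covector_form \<theta>') (wedge (covector_form \<theta>) \<alpha>)) vs"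
    by (induction vs arbitrary: \<alpha>)
      (simp_all add: covector_wedge_Cons plug_covector_wedge wedge_diff_right wedge_scale_right, simp_all add: form_scale_def)
qed

text \<open>The value of a covector on the complex vector \<open>fst w + \<i> snd w\<close>.\<close>

definition evalC :: "(real^'m::finite \<Rightarrow> complex) \<Rightarrow> (real^'m) \<times> (real^'m) \<Rightarrow> complex" where
  "evalC \<theta> w = \<theta> (fst w) + \<i> * \<theta> (snd w)"

lemma contract_plug: "contract w \<alpha> = plug (fst w) \<alpha> + form_scale \<i> (plug (snd w) \<alpha>)"
  by (auto simp: contract_def plug_def form_scale_def)

lemma contract_wedge: "contract w (wedge \<alpha> \<beta>) = wedge (contract w \<alpha>) \<beta> + wedge (grade \<alpha>) (contract w \<beta>)"
  by (simp add: contract_plug plug_wedge form_scale_add wedge_add_left wedge_add_right wedge_scale_left wedge_scale_right)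

lemma contract_covector_wedge:
  "contract w (wedge (covector_form \<theta>) \<alpha>) = form_scale (evalC \<theta> w) \<alpha> - wedge (covector_form \<theta>) (contract w \<alpha>)"
  by (simp add: contract_plug plug_covector_wedge evalC_def form_scale_diff form_scale_add_left
      wedge_add_right wedge_scale_right)

lemma contract_add: "contract w (\<alpha> + \<beta>) = contract w \<alpha> + contract w \<beta>"
  and contract_diff: "contract w (\<alpha> - \<beta>) = contract w \<alpha> - contract w \<beta>"
  and contract_minus: "contract w (- \<alpha>) = - contract w \<alpha>"
  and contract_zero [simp]: "contract w 0 = 0"
  and contract_scale: "contract w (form_scale a \<alpha>) = form_scale a (contract w \<alpha>)"
  and contract_unit [simp]: "contract w unit_form = 0"
  by (auto simp: contract_def form_scale_def unit_form_def algebra_simps)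

lemma wedges_Nil [simp]: "wedges [] = unit_form"
  and wedges_Cons: "wedges (\<theta> # \<theta>s) = wedge (covector_form \<theta>) (wedges \<theta>s)"
  by (simp_all add: wedges_def unit_form_def)

lemma wedges_append: "wedges (as @ bs) = wedge (wedges as) (wedges bs)"
  by (induction as) (simp_all add: wedges_Cons wedge_assoc)

lemma wedges_snoc: "wedges (cs @ [c]) = form_scale ((-1) ^ length cs) (wedges (c # cs))"
proof (induction cs)
  case (Cons d cs)
  then show ?case
    by (simp add: wedges_Cons wedge_scale_right covector_anticommute[of c d])
      (auto simp: form_scale_def)
qed simp

text \<open>Moving the first of \<open>m\<close> covectors to the end costs the sign \<open>(-1)\<^sup>m\<^sup>-\<^sup>1\<close>, and these signs multiply up
  to a triangular exponent. It is the source of the dependence on the dimension modulo 8.\<close>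

lemma wedges_rev: "wedges (rev cs) = form_scale ((-1) ^ (length cs * (length cs - 1) div 2)) (wedges cs)"
proof (induction cs)
  case (Cons c cs)
  have e: "length (c # cs) * (length (c # cs) - 1) div 2 = length cs + length cs * (length cs - 1) div 2"
    by (cases cs) (auto simp: algebra_simps)
  show ?case unfolding e
    using Cons by (simp add: wedges_snoc wedges_Cons wedge_scale_right power_add)
qed simp

definition homog :: "nat \<Rightarrow> ('m::finite, complex) form \<Rightarrow> bool" where
  "homog k \<alpha> \<longleftrightarrow> (\<forall>vs. length vs \<noteq> k \<longrightarrow> \<alpha> vs = 0)"

lemma homog_grade: "homog k \<alpha> \<Longrightarrow> grade \<alpha> = form_scale ((-1) ^ k) \<alpha>"
  by (rule ext) (auto simp: homog_def grade_def form_scale_def)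

lemma homog_wedge:
  assumes "homog k \<alpha>" "homog l \<beta>" shows "homog (k + l) (wedge \<alpha> \<beta>)"
  unfolding homog_def wedge_with_def
proof (intro allI impI sum.neutral ballI)
  fix vs :: "(real^'a) list" and S
  assume vs: "length vs \<noteq> k + l" and S: "S \<in> Pow {..<length vs}"
  have "length (nths vs S) + length (nths vs (- S)) = card ({i. i < length vs \<and> i \<in> S} \<union> {i. i < length vs \<and> i \<in> - S})"
    unfolding length_nths by (subst card_Un_disjoint) auto
  also have "{i. i < length vs \<and> i \<in> S} \<union> {i. i < length vs \<and> i \<in> - S} = {..<length vs}" by auto
  finally have "length (nths vs S) \<noteq> k \<or> length (nths vs (- S)) \<noteq> l" using vs by auto
  then show "(-1) ^ card {(i, j). i \<in> S \<and> j < i \<and> j \<notin> S} * (\<alpha> (nths vs S) * \<beta> (nths vs (- S))) = 0"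
    using assms by (auto simp: homog_def)
qed

lemma homog_covector [simp]: "homog (Suc 0) (covector_form \<theta>)" and homog_unit [simp]: "homog 0 unit_form"
  by (auto simp: homog_def covector_form_def unit_form_def split: list.splits)

lemma homog_wedges: "homog (length \<theta>s) (wedges \<theta>s)"
  by (induction \<theta>s) (auto simp: wedges_Cons dest: homog_wedge[OF homog_covector])

lemma homog_add: "homog k \<alpha> \<Longrightarrow> homog k \<beta> \<Longrightarrow> homog k (\<alpha> + \<beta>)"
  and homog_scale: "homog k \<alpha> \<Longrightarrow> homog k (form_scale a \<alpha>)"
  and homog_zero: "homog k 0"
  by (auto simp: homog_def form_scale_def contract_def)

lemma homog_deg_part: "homog k \<alpha> \<Longrightarrow> deg_part q \<alpha> = (if q = k then \<alpha> else 0)"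
  by (auto simp: homog_def deg_part_def)

lemma homog_0_eq: "homog 0 \<alpha> \<Longrightarrow> \<alpha> = form_scale (\<alpha> []) unit_form"
  by (rule ext) (auto simp: homog_def form_scale_def unit_form_def)

section \<open>Alternating forms with slots of a given type\<close>

text \<open>The spaces \<open>Q\<close> of covectors that occur below are that of all real linear ones and those of type
  (1,0) and (0,1).\<close>

definition slot_space :: "((real^'m::finite \<Rightarrow> complex) \<Rightarrow> bool) \<Rightarrow> bool" where
  "slot_space Q \<longleftrightarrow> Q 0 \<and> (\<forall>f g. Q f \<longrightarrow> Q g \<longrightarrow> Q (f + g)) \<and> (\<forall>a f. Q f \<longrightarrow> Q (\<lambda>v. a * f v)) \<and>
     (\<forall>f. Q f \<longrightarrow> linear f)"

text \<open>Only equal neighbours are asked to give 0; in this form the condition is inherited through the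
  recursion of the wedge product. The condition on the slots says that inserting all arguments but one
  leaves an element of \<open>Q\<close>.\<close>

definition alt_slots :: "((real^'m::finite \<Rightarrow> complex) \<Rightarrow> bool) \<Rightarrow> ('m, complex) form \<Rightarrow> bool" where
  "alt_slots Q \<omega> \<longleftrightarrow> (\<forall>us vs. Q (\<lambda>v. \<omega> (us @ v # vs))) \<and> (\<forall>us v vs. \<omega> (us @ v # v # vs) = 0)"

text \<open>For the space of all linear functionals, \<open>bs\<close> has to span. For functionals of pure type with respect
  to \<open>J\<close> half as many vectors suffice, and this is why forms of type (0,q) vanish for q above the complex
  dimension.\<close>

definition determined_by :: "((real^'m::finite \<Rightarrow> complex) \<Rightarrow> bool) \<Rightarrow> (real^'m) list \<Rightarrow> bool" where
  "determined_by Q bs \<longleftrightarrow> (\<forall>f. Q f \<longrightarrow> (\<forall>b\<in>set bs. f b = 0) \<longrightarrow> f = 0)"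

lemma linear_cmult: "linear f \<Longrightarrow> linear (\<lambda>v. a * f v :: complex)"
  by (auto simp: linear_iff algebra_simps)

lemma linear_plus: "linear f \<Longrightarrow> linear g \<Longrightarrow> linear (f + g :: 'a::real_vector \<Rightarrow> 'b::real_vector)"
  by (auto simp: linear_iff algebra_simps)

lemma linear_fun_zero: "linear (0 :: 'a::real_vector \<Rightarrow> 'b::real_vector)"
  by (auto simp: linear_iff)

lemma slot_space_linear [simp]: "slot_space linear"
  by (simp add: slot_space_def linear_cmult linear_plus linear_fun_zero)

lemma slot_space_type10 [simp]: "slot_space (type10 J)" and slot_space_type01 [simp]: "slot_space (type01 J)"
  by (auto simp: slot_space_def type10_def type01_def linear_cmult linear_plus linear_fun_zero algebra_simps)

context
  fixes Q :: "(real^'m::finite \<Rightarrow> complex) \<Rightarrow> bool"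
  assumes Q: "slot_space Q"
begin

lemma slot_ops: "Q 0" "Q (\<lambda>_. 0)" "Q f \<Longrightarrow> Q g \<Longrightarrow> Q (f + g)" "Q f \<Longrightarrow> Q g \<Longrightarrow> Q (\<lambda>v. f v + g v)" "Q f \<Longrightarrow> Q (\<lambda>v. a * f v)"
  "Q f \<Longrightarrow> linear f" "Q f \<Longrightarrow> Q g \<Longrightarrow> Q (\<lambda>v. f v - g v)"
proof -
  show 1: "Q 0" "Q f \<Longrightarrow> Q g \<Longrightarrow> Q (f + g)" "Q f \<Longrightarrow> Q (\<lambda>v. a * f v)" "Q f \<Longrightarrow> linear f" for f g a
    using Q by (auto simp: slot_space_def)
  then show "Q (\<lambda>_. 0)" by (simp add: zero_fun_def)
  show "Q f \<Longrightarrow> Q g \<Longrightarrow> Q (\<lambda>v. f v + g v)" for f g using 1(2)[of f g] by (simp add: plus_fun_def)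
  then have "Q f \<Longrightarrow> Q (\<lambda>v. - 1 * g v) \<Longrightarrow> Q (\<lambda>v. f v + - 1 * g v)" .
  then show "Q f \<Longrightarrow> Q g \<Longrightarrow> Q (\<lambda>v. f v - g v)" using 1(3)[of g "-1"] by simp
qed

lemma alt_slots_add: "alt_slots Q \<alpha> \<Longrightarrow> alt_slots Q \<beta> \<Longrightarrow> alt_slots Q (\<alpha> + \<beta>)"
  and alt_slots_scale: "alt_slots Q \<alpha> \<Longrightarrow> alt_slots Q (form_scale a \<alpha>)"
  and alt_slots_zero: "alt_slots Q 0"
  and alt_slots_unit: "alt_slots Q unit_form"
  by (simp_all add: alt_slots_def form_scale_def unit_form_def slot_ops(1,2,4,5))

lemma alt_slots_plug: "alt_slots Q \<alpha> \<Longrightarrow> alt_slots Q (plug v \<alpha>)"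
  unfolding alt_slots_def plug_def append_Cons[symmetric] by blast

lemma alt_slots_covector_wedge:
  assumes \<theta>: "Q \<theta>" and \<alpha>: "alt_slots Q \<alpha>"
  shows "alt_slots Q (wedge (covector_form \<theta>) \<alpha>)"
proof -
  have lin: "Q (\<lambda>v. wedge (covector_form \<theta>) (plug v \<beta>) vs)" if \<beta>: "\<And>us. Q (\<lambda>v. \<beta> (v # us))" for \<beta> vs
  proof -
    have "Q (\<lambda>v. \<Sum>S\<in>X. c S * \<beta> (v # us S))" if "finite X" for X and c :: "nat set \<Rightarrow> complex" and us
      using that
    proof (induction X)
      case empty then show ?case using slot_ops(2) by simp
    next
      case (insert S X)
      have "Q (\<lambda>v. c S * \<beta> (v # us S))" by (rule slot_ops(5)[OF \<beta>])
      from slot_ops(4)[OF this insert.IH] show ?case using insert.hyps by simp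
    qed
    note this[of "Pow {..<length vs}" "\<lambda>S. (-1) ^ card {(i, j). i \<in> S \<and> j < i \<and> j \<notin> S} * covector_form \<theta> (nths vs S)" "\<lambda>S. nths vs (- S)"]
    then show ?thesis by (simp add: wedge_with_def plug_def mult.assoc)
  qed
  have "Q (\<lambda>v. wedge (covector_form \<theta>) \<alpha> (us @ v # vs))" if "alt_slots Q \<alpha>" for us vs \<alpha>
    using that
  proof (induction us arbitrary: \<alpha>)
    case Nil
    then have "Q (\<lambda>v. \<alpha> ([] @ v # us))" for us unfolding alt_slots_def by blast
    then have "Q (\<lambda>v. \<alpha> (v # us))" for us by simp
    from slot_ops(7)[OF slot_ops(5)[OF \<theta>, of "\<alpha> vs"] lin[OF this]] show ?case
      by (simp add: covector_wedge_Cons mult.commute)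
  next
    case (Cons u us)
    have "Q (\<lambda>v. \<alpha> (us @ v # vs))" using Cons.prems by (simp add: alt_slots_def)
    from slot_ops(7)[OF slot_ops(5)[OF this, of "\<theta> u"] Cons.IH[OF alt_slots_plug[OF Cons.prems]]]
    show ?case by (simp add: covector_wedge_Cons)
  qed
  moreover have "wedge (covector_form \<theta>) \<alpha> (us @ v # v # vs) = 0" if "alt_slots Q \<alpha>" for us v vs \<alpha>
    using that
  proof (induction us arbitrary: \<alpha>)
    case Nil
    have "\<alpha> ([] @ v # v # us) = 0" for us using Nil unfolding alt_slots_def by blast
    then have "plug v (plug v \<alpha>) = 0" by (auto simp: plug_def)
    then show ?case by (simp add: covector_wedge_Cons plug_covector_wedge) (simp add: plug_def form_scale_def)
  next
    case (Cons u us)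
    have "\<alpha> (us @ v # v # vs) = 0" using Cons.prems by (simp add: alt_slots_def)
    then show ?case using Cons.IH[OF alt_slots_plug[OF Cons.prems]] by (simp add: covector_wedge_Cons)
  qed
  ultimately show ?thesis using \<alpha> unfolding alt_slots_def[of Q "wedge _ _"] by blast
qed

lemma alt_slots_wedges: "\<forall>\<theta>\<in>set \<theta>s. Q \<theta> \<Longrightarrow> alt_slots Q (wedges \<theta>s)"
  by (induction \<theta>s) (simp_all add: wedges_Cons alt_slots_unit alt_slots_covector_wedge)

lemma alt_slots_swap:
  assumes "alt_slots Q \<alpha>"
  shows "\<alpha> (us @ u # v # vs) = - \<alpha> (us @ v # u # vs)"
proof -
  have l: "\<alpha> (us @ (x + y) # vs) = \<alpha> (us @ x # vs) + \<alpha> (us @ y # vs)" for us x y vs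
    using linear_add[OF slot_ops(6), of "\<lambda>v. \<alpha> (us @ v # vs)"] assms by (simp add: alt_slots_def)
  have "0 = \<alpha> (us @ (u + v) # (u + v) # vs)" using assms by (simp add: alt_slots_def)
  also have "\<dots> = \<alpha> (us @ u # u # vs) + \<alpha> (us @ u # v # vs) + (\<alpha> (us @ v # u # vs) + \<alpha> (us @ v # v # vs))"
    unfolding l[of us] using l[of "us @ [u]"] l[of "us @ [v]"] by simp
  also have "\<dots> = \<alpha> (us @ u # v # vs) + \<alpha> (us @ v # u # vs)" using assms by (simp add: alt_slots_def)
  finally show ?thesis by (simp add: eq_neg_iff_add_eq_0)
qed

lemma alt_slots_move_front:
  assumes "alt_slots Q \<alpha>"
  shows "\<alpha> (us @ u # vs) = (-1) ^ length us * \<alpha> (u # us @ vs)"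
proof (induction us arbitrary: vs rule: rev_induct)
  case (snoc x us)
  have "\<alpha> ((us @ [x]) @ u # vs) = - \<alpha> (us @ u # x # vs)" using alt_slots_swap[OF assms, of us x u vs] by simp
  then show ?case by (simp add: snoc)
qed simp

text \<open>The second copy of a repeated vector can be moved next to the first one.\<close>

lemma alt_slots_repeat:
  assumes "alt_slots Q \<alpha>" "\<not> distinct vs" shows "\<alpha> vs = 0"
proof -
  obtain xs ys zs y where vs: "vs = xs @ [y] @ ys @ [y] @ zs" using not_distinct_decomp[OF assms(2)] by blast
  have "\<alpha> vs = (-1) ^ length ys * \<alpha> ((xs @ [y]) @ y # ys @ zs)"
  proof -
    have "alt_slots Q (\<lambda>us. \<alpha> ((xs @ [y]) @ us))"
      using assms(1) unfolding alt_slots_def by (simp only: append.assoc[symmetric] simp_thms)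
    from alt_slots_move_front[OF this, of ys y zs] show ?thesis by (simp add: vs)
  qed
  also have "\<dots> = 0" using assms(1) by (simp add: alt_slots_def)
  finally show ?thesis .
qed

lemma alt_slots_mset:
  assumes "alt_slots Q \<alpha>" "mset us = mset vs" "\<alpha> us = 0" shows "\<alpha> vs = 0"
  using assms
proof (induction us arbitrary: \<alpha> vs)
  case (Cons u us)
  have "u \<in> set vs" using Cons.prems(2) by (metis list.set_intros(1) set_mset_mset)
  then obtain xs ys where vs: "vs = xs @ u # ys" by (meson split_list)
  have "plug u \<alpha> (xs @ ys) = 0"
    by (rule Cons.IH[OF alt_slots_plug[OF Cons.prems(1)]]) (use Cons.prems vs in \<open>auto simp: plug_def\<close>)
  then show ?case unfolding vs alt_slots_move_front[OF Cons.prems(1)] by (simp add: plug_def)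
qed simp

text \<open>The arguments are replaced by members of \<open>bs\<close> one at a time, from the left.\<close>

lemma alt_slots_determined:
  assumes \<alpha>: "alt_slots Q \<alpha>"
    and det: "determined_by Q bs"
    and base: "\<And>us. length us = length vs \<Longrightarrow> set us \<subseteq> set bs \<Longrightarrow> \<alpha> us = 0"
  shows "\<alpha> vs = 0"
proof -
  have "\<alpha> (xs @ ys) = 0" if "length (xs @ ys) = length vs" "set xs \<subseteq> set bs" for xs ys
    using that
  proof (induction ys arbitrary: xs)
    case Nil then show ?case using base by simp
  next
    case (Cons y ys)
    have "(\<lambda>v. \<alpha> (xs @ v # ys)) = 0"
    proof (rule det[unfolded determined_by_def, rule_format])
      show "Q (\<lambda>v. \<alpha> (xs @ v # ys))" using \<alpha> by (simp add: alt_slots_def)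
      show "\<alpha> (xs @ b # ys) = 0" if "b \<in> set bs" for b
      proof -
        note that
        then have "\<alpha> ((xs @ [b]) @ ys) = 0" using Cons.prems by (intro Cons.IH) auto
        then show "\<alpha> (xs @ b # ys) = 0" by simp
      qed
    qed
    from fun_cong[OF this, of y] show ?case by simp
  qed
  from this[of "[]" vs] show ?thesis by simp
qed

text \<open>A list of members of \<open>bs\<close> that is at least as long as \<open>bs\<close> repeats a vector or is a permutation of
  \<open>bs\<close>. Hence there are no forms above the top degree, and a form of top degree is determined by its value
  on \<open>bs\<close>.\<close>

lemma alt_slots_eq_zero:
  assumes \<alpha>: "alt_slots Q \<alpha>"
    and det: "determined_by Q bs"
    and k: "length vs > length bs \<or> length vs = length bs \<and> distinct bs \<and> \<alpha> bs = 0"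
  shows "\<alpha> vs = 0"
proof (rule alt_slots_determined[OF \<alpha> det])
  fix us assume us: "length us = length vs" "set us \<subseteq> set bs"
  show "\<alpha> us = 0"
  proof (cases "distinct us")
    case False then show ?thesis using alt_slots_repeat[OF \<alpha>] by simp
  next
    case True
    have "card (set us) = length us" using True by (simp add: distinct_card)
    moreover have "card (set us) \<le> card (set bs)" using us(2) by (simp add: card_mono)
    ultimately have "length bs = length us" "distinct bs" "\<alpha> bs = 0" "card (set bs) = card (set us)"
      using k us(1) card_length[of bs] by auto
    then have "set us = set bs" using us(2) by (simp add: card_subset_eq)
    then have "mset bs = mset us" using True \<open>distinct bs\<close> set_eq_iff_mset_eq_distinct by blast
    then show ?thesis using alt_slots_mset[OF \<alpha> _ \<open>\<alpha> bs = 0\<close>] by simp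
  qed
qed

end

lemma linear_list_update_iff:
  "(\<forall>us vs. linear (\<lambda>v. \<alpha> (us @ v # vs) :: complex)) \<longleftrightarrow> (\<forall>vs i. i < length vs \<longrightarrow> linear (\<lambda>v. \<alpha> (vs[i := v])))"
proof (intro iffI allI impI)
  fix vs :: "'a list" and i assume *: "\<forall>us vs. linear (\<lambda>v. \<alpha> (us @ v # vs))" "i < length vs"
  then show "linear (\<lambda>v. \<alpha> (vs[i := v]))" by (simp add: upd_conv_take_nth_drop)
next
  fix us vs :: "'a list" assume *: "\<forall>vs i. i < length vs \<longrightarrow> linear (\<lambda>v. \<alpha> (vs[i := v]))"
  have "linear (\<lambda>v. \<alpha> ((us @ undefined # vs)[length us := v]))"
    by (rule *[rule_format]) simp
  then show "linear (\<lambda>v. \<alpha> (us @ v # vs))" by simp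
qed

lemma alternating_form_iff: "alternating_form k \<omega> \<longleftrightarrow> homog k \<omega> \<and> alt_slots linear \<omega>"
proof
  assume a: "alternating_form k \<omega>"
  then have "homog k \<omega>" "\<forall>us vs. linear (\<lambda>v. \<omega> (us @ v # vs))"
    unfolding linear_list_update_iff by (simp_all add: alternating_form_def homog_def)
  moreover have "\<omega> (us @ v # v # vs) = 0" for us v vs using a by (simp add: alternating_form_def)
  ultimately show "homog k \<omega> \<and> alt_slots linear \<omega>" by (simp add: alt_slots_def)
next
  assume a: "homog k \<omega> \<and> alt_slots linear \<omega>"
  then have "\<forall>us vs. linear (\<lambda>v. \<omega> (us @ v # vs))" by (simp add: alt_slots_def)
  with a show "alternating_form k \<omega>"
    unfolding linear_list_update_iff alternating_form_def
    using alt_slots_repeat[OF slot_space_linear, of \<omega>] by (simp add: homog_def)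
qed

section \<open>Orthonormal frames\<close>

lemma orthonormal_list_iff:
  "orthonormal_list g es \<longleftrightarrow> distinct es \<and> (\<forall>a\<in>set es. \<forall>b\<in>set es. g a b = (if a = b then 1 else 0))"
proof
  assume o: "orthonormal_list g es"
  have d: "distinct es"
  proof (rule ccontr)
    assume "\<not> distinct es"
    then obtain i j where ij: "i < length es" "j < length es" "i \<noteq> j" "es ! i = es ! j"
      by (auto simp: distinct_conv_nth)
    have "g (es ! i) (es ! j) = 0" "g (es ! i) (es ! i) = 1"
      using o[unfolded orthonormal_list_def, rule_format] ij(1-3) by simp_all
    then show False using ij by simp
  qed
  then show "distinct es \<and> (\<forall>a\<in>set es. \<forall>b\<in>set es. g a b = (if a = b then 1 else 0))"
    using o by (auto simp: orthonormal_list_def in_set_conv_nth nth_eq_iff_index_eq)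
qed (auto simp: orthonormal_list_def nth_eq_iff_index_eq)

lemma real_frame_simps [simp]: "real_frame J [] = []" "real_frame J (e # es) = e # J e # real_frame J es"
  "real_frame J (es @ fs) = real_frame J es @ real_frame J fs"
  by (simp_all add: real_frame_def)

lemma length_real_frame [simp]: "length (real_frame J es) = 2 * length es"
  by (induction es) auto

lemma set_real_frame: "set (real_frame J es) = set es \<union> J ` set es"
  by (induction es) auto

locale hermitian_space =
  fixes J :: "real^'m::finite \<Rightarrow> real^'m" and g :: "real^'m \<Rightarrow> real^'m \<Rightarrow> real" and n :: nat
  assumes J_linear: "linear J" and JJ [simp]: "J (J v) = - v"
    and g_bilinear: "bilinear g" and g_sym: "g u v = g v u" and g_pos: "v \<noteq> 0 \<Longrightarrow> g v v > 0"
    and g_JJ: "g (J u) (J v) = g u v"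
    and dim: "CARD('m) = 2 * n"
begin

lemma g_simps: "g (u + v) w = g u w + g v w" "g u (v + w) = g u v + g u w"
  "g (a *\<^sub>R u) v = a * g u v" "g u (a *\<^sub>R v) = a * g u v" "g (- u) v = - g u v" "g u (- v) = - g u v"
  "g (u - v) w = g u w - g v w" "g u (v - w) = g u v - g u w" "g 0 v = 0" "g u 0 = 0"
  using g_bilinear
  by (auto simp: bilinear_ladd bilinear_radd bilinear_lmul bilinear_rmul bilinear_lneg bilinear_rneg
      bilinear_lsub bilinear_rsub bilinear_lzero bilinear_rzero)

lemma g_sum: "g (\<Sum>i\<in>S. f i) v = (\<Sum>i\<in>S. g (f i) v)" "g v (\<Sum>i\<in>S. f i) = (\<Sum>i\<in>S. g v (f i))"
  by (induction S rule: infinite_finite_induct) (simp_all add: g_simps)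

lemma g_linear: "linear (g u)" "linear (\<lambda>v. g v u)"
  by (auto simp: linear_iff g_simps)

lemma g_eq_zero: "g v v = 0 \<longleftrightarrow> v = 0"
  using g_pos[of v] by (cases "v = 0") (auto simp: g_simps)

lemma g_ext: "(\<And>v. g a v = g b v) \<Longrightarrow> a = b"
  using g_eq_zero[of "a - b"] by (simp add: g_simps)

lemma g_J: "g (J u) v = - g u (J v)"
  using g_JJ[of u "J v"] by (simp add: g_simps)

lemma g_J_self: "g u (J u) = 0"
  using g_J[of u u] g_sym[of u "J u"] by simp

lemma J_simps: "J (u + v) = J u + J v" "J (u - v) = J u - J v" "J (- u) = - J u" "J (a *\<^sub>R u) = a *\<^sub>R J u" "J 0 = 0"
  using J_linear by (auto simp: linear_add linear_diff linear_neg linear_cmul linear_0)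

text \<open>A Gram-Schmidt step: a vector outside of the span of the frame is made orthogonal to it. The image
  under \<open>J\<close> of the result is then orthogonal to the frame too, because the frame is invariant under \<open>J\<close>
  up to sign and \<open>J\<close> is an isometry.\<close>

lemma unitary_frame_extend:
  assumes "orthonormal_list g (real_frame J es)" "length es < n"
  shows "\<exists>e. orthonormal_list g (real_frame J (es @ [e]))"
proof -
  let ?F = "set (real_frame J es)"
  have "card ?F \<le> 2 * length es" using card_length[of "real_frame J es"] by simp
  then have "dim (span ?F) < DIM(real^'m)"
    using dim_le_card'[of ?F] assms(2) dim by simp
  then have "span ?F \<noteq> UNIV" by (metis dim_UNIV less_irrefl)
  then obtain v where v: "v \<notin> span ?F" by auto
  define u where "u = v - (\<Sum>e\<in>?F. g v e *\<^sub>R e)"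
  have "(\<Sum>e\<in>?F. g v e *\<^sub>R e) \<in> span ?F" by (intro span_sum span_scale span_base)
  then have u0: "u \<noteq> 0" using v by (auto simp: u_def)
  have uF: "g u e = 0" if e: "e \<in> ?F" for e
  proof -
    have "(\<Sum>f\<in>?F. g v f * g f e) = (\<Sum>f\<in>?F. if f = e then g v f else 0)"
      using assms(1) e by (intro sum.cong) (auto simp: orthonormal_list_iff)
    then show ?thesis using e by (simp add: u_def g_simps g_sum)
  qed
  define w where "w = (1 / sqrt (g u u)) *\<^sub>R u"
  have ww: "g w w = 1" using g_pos[OF u0] by (simp add: w_def g_simps)
  have wF: "g w e = 0" if "e \<in> ?F" for e using uF[OF that] by (simp add: w_def g_simps)
  have JF: "g (J w) e = 0" if e: "e \<in> ?F" for e
  proof -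
    have "J e \<in> ?F \<or> - J e \<in> ?F" using e by (auto simp: set_real_frame)
    then show ?thesis using wF[of "J e"] wF[of "- J e"] by (auto simp: g_J g_simps)
  qed
  have ne: "w \<notin> ?F" "J w \<notin> ?F" "w \<noteq> J w"
    using wF[of w] JF[of "J w"] ww g_JJ[of w w] g_J_self[of w] by auto
  have s: "g e w = 0" "g e (J w) = 0" if "e \<in> ?F" for e
    using wF[OF that] JF[OF that] g_sym by metis+
  have "orthonormal_list g (real_frame J (es @ [w]))"
    using assms(1) ne ww wF JF s g_J_self[of w] g_JJ[of w w] g_sym[of "J w" w]
    unfolding orthonormal_list_iff by auto
  then show ?thesis by blast
qed

lemma unitary_frame_exists: "\<exists>es. length es = n \<and> orthonormal_list g (real_frame J es)"
proof -
  have "\<exists>es. length es = k \<and> orthonormal_list g (real_frame J es)" if "k \<le> n" for k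
    using that
  proof (induction k)
    case 0 then show ?case by (intro exI[of _ "[]"]) (simp add: orthonormal_list_def)
  next
    case (Suc k)
    then obtain es where "length es = k" "orthonormal_list g (real_frame J es)" by auto
    then show ?case using unitary_frame_extend[of es] Suc.prems by (metis length_append_singleton less_eq_Suc_le)
  qed
  then show ?thesis by blast
qed

text \<open>The unitary frame that occurs in the volume form.\<close>

definition uframe :: "(real^'m) list" where
  "uframe = (SOME es. length es = n \<and> orthonormal_list g (real_frame J es))"

lemma uframe: "length uframe = n" "orthonormal_list g (real_frame J uframe)"
  using someI_ex[OF unitary_frame_exists] by (auto simp: uframe_def)

text \<open>The orthonormal basis that occurs in the metric on forms.\<close>

definition onb :: "(real^'m) list" where
  "onb = (SOME es. length es = CARD('m) \<and> orthonormal_list g es)"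

lemma onb: "length onb = CARD('m)" "orthonormal_list g onb"
proof -
  have "length (real_frame J uframe) = CARD('m)" using uframe dim by simp
  then have "\<exists>es. length es = CARD('m) \<and> orthonormal_list g es" using uframe(2) by blast
  from someI_ex[OF this] show "length onb = CARD('m)" "orthonormal_list g onb" by (auto simp: onb_def)
qed

lemma orthonormal_expand:
  assumes es: "orthonormal_list g es" "length es = CARD('m)"
  shows "v = (\<Sum>e\<in>set es. g v e *\<^sub>R e)"
proof -
  have ind: "independent (set es)"
  proof (rule independent_if_scalars_zero)
    fix f x assume f: "(\<Sum>x\<in>set es. f x *\<^sub>R x) = 0" and x: "x \<in> set es"
    have "0 = g (\<Sum>y\<in>set es. f y *\<^sub>R y) x" by (simp add: f g_simps)
    also have "\<dots> = (\<Sum>y\<in>set es. if y = x then f y else 0)"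
      unfolding g_sum using es x by (intro sum.cong) (auto simp: g_simps orthonormal_list_iff)
    finally show "f x = 0" using x by simp
  qed simp
  have "card (set es) = DIM(real^'m)" using es by (simp add: orthonormal_list_iff distinct_card)
  then have sp: "span (set es) = UNIV"
    using ind card_eq_dim[of "set es" UNIV] by (metis dim_UNIV subset_UNIV finite_set top.extremum_uniqueI dim_eq_card)
  define u where "u = v - (\<Sum>e\<in>set es. g v e *\<^sub>R e)"
  have uF: "g u e = 0" if e: "e \<in> set es" for e
  proof -
    have "(\<Sum>f\<in>set es. g v f * g f e) = (\<Sum>f\<in>set es. if f = e then g v f else 0)"
      using es(1) e by (intro sum.cong) (auto simp: orthonormal_list_iff)
    then show ?thesis using e by (simp add: u_def g_simps g_sum)
  qed
  have "u \<in> span (set es)" using sp by simp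
  then have "g u u = 0"
    using real_vector.linear_eq_0_on_span[OF g_linear(1)[of u], of "set es" u] uF by blast
  then show ?thesis by (simp add: g_eq_zero u_def)
qed

lemma determined_orthonormal:
  assumes "orthonormal_list g es" "length es = CARD('m)"
  shows "determined_by linear es"
  unfolding determined_by_def
proof (intro allI impI ext)
  fix f :: "real^'m \<Rightarrow> complex" and v assume f: "linear f" "\<forall>b\<in>set es. f b = 0"
   have "f v = (\<Sum>e\<in>set es. g v e *\<^sub>R f e)"
    by (subst orthonormal_expand[OF assms(1,2), of v]) (simp add: linear_sum[OF f(1)] linear_cmul[OF f(1)])
  then show "f v = 0 v" using f(2) by simp
qed

text \<open>On \<open>J e\<close> a functional of pure type is \<open>\<plusminus>\<i>\<close> times its value on \<open>e\<close>, so vanishing on the unitary frame implies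
  vanishing on the real basis that belongs to it.\<close>

lemma determined_uframe: "determined_by (type01 J) uframe" "determined_by (type10 J) uframe"
proof -
  have "length (real_frame J uframe) = CARD('m)" using uframe dim by simp
  then have d: "determined_by linear (real_frame J uframe)" by (rule determined_orthonormal[OF uframe(2)])
  have "f = 0" if "type01 J f \<or> type10 J f" "\<forall>b\<in>set uframe. f b = 0" for f
  proof (rule d[unfolded determined_by_def, rule_format])
    show "linear f" using that by (auto simp: type01_def type10_def)
    show "f b = 0" if "b \<in> set (real_frame J uframe)" for b
      using that \<open>type01 J f \<or> type10 J f\<close> \<open>\<forall>b\<in>set uframe. f b = 0\<close>
      by (auto simp: set_real_frame type01_def type10_def)
  qed
  then show "determined_by (type01 J) uframe" "determined_by (type10 J) uframe" by (simp_all add: determined_by_def)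
qed

section \<open>Covectors and their dual vectors\<close>

lemma sharp_ex1:
  assumes "linear \<theta>"
  shows "\<exists>!w. \<forall>v. complex_of_real (g (fst w) v) + \<i> * complex_of_real (g (snd w) v) = \<theta> v"
proof (rule ex1I)
  let ?w = "((\<Sum>e\<in>set onb. Re (\<theta> e) *\<^sub>R e), (\<Sum>e\<in>set onb. Im (\<theta> e) *\<^sub>R e))"
  show "\<forall>v. complex_of_real (g (fst ?w) v) + \<i> * complex_of_real (g (snd ?w) v) = \<theta> v"
  proof
    fix v
    have "\<theta> v = (\<Sum>e\<in>set onb. g v e *\<^sub>R \<theta> e)"
      by (subst orthonormal_expand[OF onb(2,1), of v]) (simp add: linear_sum[OF assms] linear_cmul[OF assms])
    then show "complex_of_real (g (fst ?w) v) + \<i> * complex_of_real (g (snd ?w) v) = \<theta> v"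
      by (simp add: complex_eq_iff g_sum g_simps g_sym[of v] mult.commute)
  qed
next
  fix w assume w: "\<forall>v. complex_of_real (g (fst w) v) + \<i> * complex_of_real (g (snd w) v) = \<theta> v"
  have 1: "g (fst w) v = Re (\<theta> v)" "g (snd w) v = Im (\<theta> v)" for v
    using arg_cong[OF w[rule_format, of v], of Re] arg_cong[OF w[rule_format, of v], of Im] by simp_all
  have 2: "(\<Sum>e\<in>set onb. Re (\<theta> e) *\<^sub>R e) = fst w" "(\<Sum>e\<in>set onb. Im (\<theta> e) *\<^sub>R e) = snd w"
    unfolding 1[symmetric] using orthonormal_expand[OF onb(2,1)] by metis+
  show "w = ((\<Sum>e\<in>set onb. Re (\<theta> e) *\<^sub>R e), (\<Sum>e\<in>set onb. Im (\<theta> e) *\<^sub>R e))"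
    by (simp add: 2)
qed

lemma sharp_eq:
  assumes "linear \<theta>"
  shows "complex_of_real (g (fst (sharp g \<theta>)) v) + \<i> * complex_of_real (g (snd (sharp g \<theta>)) v) = \<theta> v"
  using theI'[OF sharp_ex1[OF assms]] unfolding sharp_def by blast

lemma sharp_unique:
  assumes "\<And>v. complex_of_real (g (fst w) v) + \<i> * complex_of_real (g (snd w) v) = \<theta> v"
  shows "sharp g \<theta> = w"
proof -
  have \<theta>: "\<theta> = (\<lambda>v. complex_of_real (g (fst w) v) + \<i> * complex_of_real (g (snd w) v))" using assms by auto
  have "linear \<theta>" unfolding \<theta> by (auto simp: linear_iff g_simps algebra_simps) (simp add: scaleR_conv_of_real algebra_simps)
  from the1_equality[OF sharp_ex1[OF this]] assms show ?thesis unfolding sharp_def by blast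
qed

lemma sharp_components:
  assumes "linear \<theta>" shows "g (fst (sharp g \<theta>)) v = Re (\<theta> v)" "g (snd (sharp g \<theta>)) v = Im (\<theta> v)"
  using arg_cong[OF sharp_eq[OF assms, of v], of Re] arg_cong[OF sharp_eq[OF assms, of v], of Im] by simp_all

lemma sharp_expand:
  assumes "linear \<theta>"
  shows "fst (sharp g \<theta>) = (\<Sum>e\<in>set onb. Re (\<theta> e) *\<^sub>R e)" "snd (sharp g \<theta>) = (\<Sum>e\<in>set onb. Im (\<theta> e) *\<^sub>R e)"
  using orthonormal_expand[OF onb(2,1)] unfolding sharp_components[OF assms, symmetric] by metis+

text \<open>Contraction with the complex vector that is metrically dual to the conjugate of \<open>\<theta>\<close>. It is the
  adjoint of multiplication by \<open>\<theta>\<close>.\<close>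

definition dualct :: "(real^'m \<Rightarrow> complex) \<Rightarrow> ('m, complex) form \<Rightarrow> ('m, complex) form" where
  "dualct \<theta> = contract (sharp g (\<lambda>v. cnj (\<theta> v)))"

lemma linear_cnj: "linear \<theta> \<Longrightarrow> linear (\<lambda>v. cnj (\<theta> v))"
  by (auto simp: linear_iff)

lemma dualct_onb:
  assumes \<theta>: "linear \<theta>" and \<alpha>: "alt_slots linear \<alpha>"
  shows "dualct \<theta> \<alpha> vs = (\<Sum>e\<in>set onb. cnj (\<theta> e) * \<alpha> (e # vs))"
proof -
  have "linear (\<lambda>v. \<alpha> ([] @ v # vs))" using \<alpha> unfolding alt_slots_def by blast
  then have l: "linear (\<lambda>v. \<alpha> (v # vs))" by simp
  have s: "\<alpha> ((\<Sum>e\<in>set onb. f e *\<^sub>R e) # vs) = (\<Sum>e\<in>set onb. f e *\<^sub>R \<alpha> (e # vs))" for f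
    by (simp add: linear_sum[OF l] linear_cmul[OF l])
  show ?thesis
    unfolding dualct_def contract_def sharp_expand[OF linear_cnj[OF \<theta>]] s
    by (simp add: sum_distrib_left flip: sum.distrib)
      (rule sum.cong, auto simp: complex_eq_iff algebra_simps)
qed

text \<open>The hermitian product of covectors.\<close>

definition cip :: "(real^'m \<Rightarrow> complex) \<Rightarrow> (real^'m \<Rightarrow> complex) \<Rightarrow> complex" where
  "cip \<theta>' \<theta> = evalC \<theta>' (sharp g (\<lambda>v. cnj (\<theta> v)))"

lemma dualct_covector_wedge:
  "dualct \<theta> (wedge (covector_form \<theta>') \<alpha>) = form_scale (cip \<theta>' \<theta>) \<alpha> - wedge (covector_form \<theta>') (dualct \<theta> \<alpha>)"
  by (simp add: dualct_def cip_def contract_covector_wedge)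

lemma dualct_wedge: "dualct \<theta> (wedge \<alpha> \<beta>) = wedge (dualct \<theta> \<alpha>) \<beta> + wedge (grade \<alpha>) (dualct \<theta> \<beta>)"
  by (simp add: dualct_def contract_wedge)

lemma cip_onb:
  assumes "linear \<theta>" "linear \<theta>'" shows "cip \<theta>' \<theta> = (\<Sum>e\<in>set onb. cnj (\<theta> e) * \<theta>' e)"
  unfolding cip_def evalC_def sharp_expand[OF linear_cnj[OF assms(1)]]
  by (simp add: linear_sum[OF assms(2)] linear_cmul[OF assms(2)] linear_neg[OF assms(2)] sum_distrib_left flip: sum.distrib)
    (rule sum.cong, auto simp: complex_eq_iff algebra_simps linear_cmul[OF assms(2)] linear_neg[OF assms(2)])

lemma cip_cnj: "linear \<theta> \<Longrightarrow> linear \<theta>' \<Longrightarrow> cip \<theta> \<theta>' = cnj (cip \<theta>' \<theta>)"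
  by (simp add: cip_onb mult.commute)

lemma dualct_ops:
  "dualct \<theta> (\<alpha> + \<beta>) = dualct \<theta> \<alpha> + dualct \<theta> \<beta>" "dualct \<theta> (\<alpha> - \<beta>) = dualct \<theta> \<alpha> - dualct \<theta> \<beta>"
  "dualct \<theta> (- \<alpha>) = - dualct \<theta> \<alpha>" "dualct \<theta> 0 = 0" "dualct \<theta> (form_scale a \<alpha>) = form_scale a (dualct \<theta> \<alpha>)"
  "dualct \<theta> unit_form = 0"
  by (simp_all add: dualct_def contract_add contract_diff contract_minus contract_scale)

text \<open>The hermitian product pairs \<open>\<theta>'\<close> with the vector dual to the conjugate of \<open>\<theta>\<close>; on this vector \<open>J\<close> acts by
  the eigenvalue that belongs to the type of \<open>\<theta>\<close>, and on \<open>\<theta>'\<close> by the opposite one.\<close>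

lemma type_orthogonal:
  assumes "type10 J \<theta> \<and> type01 J \<theta>' \<or> type01 J \<theta> \<and> type10 J \<theta>'"
  shows "cip \<theta>' \<theta> = 0"
proof -
  have lin: "linear \<theta>" "linear \<theta>'" using assms by (auto simp: type10_def type01_def)
  let ?c = "\<lambda>v. cnj (\<theta> v)" let ?w = "sharp g ?c"
  obtain s where s: "s = \<i> \<or> s = - \<i>" "\<And>v. \<theta> (J v) = s * \<theta> v" "\<And>v. \<theta>' (J v) = - s * \<theta>' v"
    using assms unfolding type10_def type01_def by (metis minus_minus minus_mult_left)
  \<comment> \<open>the dual vector of a covector of one type is an eigenvector of J for the eigenvalue \<open>s\<close>\<close>
  have "g (J (fst ?w)) v = g (- Im s *\<^sub>R snd ?w) v" "g (J (snd ?w)) v = g (Im s *\<^sub>R fst ?w) v" for v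
    using s(1) s(2)[of v] by (auto simp: g_J g_simps sharp_components[OF linear_cnj[OF lin(1)]])
  then have w: "J (fst ?w) = - Im s *\<^sub>R snd ?w" "J (snd ?w) = Im s *\<^sub>R fst ?w" by (blast intro: g_ext)+
  have "- s * \<theta>' (fst ?w) = - Im s *\<^sub>R \<theta>' (snd ?w)" "- s * \<theta>' (snd ?w) = Im s *\<^sub>R \<theta>' (fst ?w)"
    unfolding s(3)[symmetric] w by (simp_all add: linear_cmul[OF lin(2)] linear_neg[OF lin(2)])
  then show ?thesis using s(1) unfolding cip_def evalC_def by (auto simp: complex_eq_iff)
qed

section \<open>The hermitian metric on forms\<close>

definition onlists :: "nat \<Rightarrow> (real^'m) list set" where
  "onlists k = {vs. length vs = k \<and> set vs \<subseteq> set onb}"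

lemma finite_onlists: "finite (onlists k)"
  unfolding onlists_def using finite_lists_length_eq[of "set onb" k] by (simp add: conj_commute)

lemma sum_onlists_0: "(\<Sum>vs\<in>onlists 0. F vs) = F []"
proof -
  have "onlists 0 = {[]}" by (auto simp: onlists_def)
  then show ?thesis by simp
qed

lemma sum_onlists_Suc: "(\<Sum>vs\<in>onlists (Suc k). F vs) = (\<Sum>v\<in>set onb. \<Sum>vs\<in>onlists k. F (v # vs))"
proof -
  have "onlists (Suc k) = (\<lambda>(v, vs). v # vs) ` (set onb \<times> onlists k)"
    by (auto simp: onlists_def length_Suc_conv image_iff)
  then have "(\<Sum>vs\<in>onlists (Suc k). F vs) = (\<Sum>(v, vs)\<in>set onb \<times> onlists k. F (v # vs))"
    by (simp add: sum.reindex inj_on_def split_def)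
  then show ?thesis by (simp add: sum.cartesian_product)
qed

lemma form_inner_onlists:
  "form_inner g h \<alpha> \<beta> = (\<Sum>k\<le>CARD('m). (\<Sum>vs\<in>onlists k. h (\<alpha> vs) (\<beta> vs)) / fact k)"
  by (simp add: form_inner_def onlists_def flip: onb_def)

abbreviation ip :: "('m, complex) form \<Rightarrow> ('m, complex) form \<Rightarrow> complex" where
  "ip \<equiv> cform_inner g"

lemma ip_simps:
  "ip (\<alpha> + \<beta>) \<gamma> = ip \<alpha> \<gamma> + ip \<beta> \<gamma>" "ip \<alpha> (\<beta> + \<gamma>) = ip \<alpha> \<beta> + ip \<alpha> \<gamma>"
  "ip (\<alpha> - \<beta>) \<gamma> = ip \<alpha> \<gamma> - ip \<beta> \<gamma>" "ip \<alpha> (\<beta> - \<gamma>) = ip \<alpha> \<beta> - ip \<alpha> \<gamma>"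
  "ip (- \<alpha>) \<gamma> = - ip \<alpha> \<gamma>" "ip \<alpha> (- \<gamma>) = - ip \<alpha> \<gamma>"
  "ip (form_scale a \<alpha>) \<gamma> = a * ip \<alpha> \<gamma>" "ip \<alpha> (form_scale a \<gamma>) = cnj a * ip \<alpha> \<gamma>"
  "ip 0 \<gamma> = 0" "ip \<alpha> 0 = 0"
  by (simp_all add: form_inner_onlists form_scale_def algebra_simps sum.distrib sum_subtractf sum_negf
      add_divide_distrib diff_divide_distrib flip: sum_distrib_left times_divide_eq_right)

lemma ip_cnj: "ip \<beta> \<alpha> = cnj (ip \<alpha> \<beta>)"
  by (simp add: form_inner_onlists mult.commute)

lemma alt_eq_zero_onb:
  assumes "alt_slots linear \<alpha>" "\<And>us. us \<in> onlists (length vs) \<Longrightarrow> \<alpha> us = 0"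
  shows "\<alpha> vs = 0"
  by (rule alt_slots_determined[OF slot_space_linear assms(1) determined_orthonormal[OF onb(2,1)]])
    (use assms(2) in \<open>auto simp: onlists_def\<close>)

lemma alt_above_dim:
  fixes \<alpha> :: "('m, complex) form"
  assumes "alt_slots linear \<alpha>" "length vs > CARD('m)" shows "\<alpha> vs = 0"
  by (rule alt_slots_eq_zero[OF slot_space_linear assms(1) determined_orthonormal[OF onb(2,1)]])
    (use assms(2) onb in auto)

text \<open>Interior multiplications anticommute on alternating forms.\<close>

lemma dualct_plug:
  assumes "alt_slots linear \<beta>" "linear \<theta>" shows "dualct \<theta> (plug v \<beta>) = - plug v (dualct \<theta> \<beta>)"
proof
  fix vs
  have "\<beta> (v # e # vs) = - \<beta> (e # v # vs)" for e
    using alt_slots_swap[OF slot_space_linear assms(1), of "[]" v e vs] by simp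
  then show "dualct \<theta> (plug v \<beta>) vs = (- plug v (dualct \<theta> \<beta>)) vs"
    by (simp add: dualct_onb alt_slots_plug assms) (simp add: plug_def dualct_onb assms sum_negf)
qed

text \<open>The sum is split according to the first argument \<open>v\<close>. The term of the recursion where \<open>v\<close> goes into
  \<open>\<theta>\<close> gives one copy of the right-hand side, and the term where \<open>v\<close> goes into \<open>\<alpha>\<close> gives \<open>k + 1\<close> more by the induction
  hypothesis for the forms with \<open>v\<close> inserted.\<close>

lemma adjoint_onlists:
  assumes "linear \<theta>" "alt_slots linear \<beta>"
  shows "(\<Sum>vs\<in>onlists (Suc k). wedge (covector_form \<theta>) \<alpha> vs * cnj (\<beta> vs)) =
     of_nat (Suc k) * (\<Sum>vs\<in>onlists k. \<alpha> vs * cnj (dualct \<theta> \<beta> vs))"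
  using assms(2)
proof (induction k arbitrary: \<alpha> \<beta>)
  case 0
  then show ?case
    by (simp add: sum_onlists_Suc sum_onlists_0 covector_wedge_Cons dualct_onb assms(1) sum_distrib_left algebra_simps)
next
  case (Suc k)
  let ?W = "wedge (covector_form \<theta>)"
  have *: "(\<Sum>vs\<in>onlists (Suc k). ?W (plug v \<alpha>) vs * cnj (\<beta> (v # vs))) =
      - of_nat (Suc k) * (\<Sum>vs\<in>onlists k. \<alpha> (v # vs) * cnj (dualct \<theta> \<beta> (v # vs)))" for v
    using Suc.IH[of "plug v \<beta>" "plug v \<alpha>"] Suc.prems assms(1)
    by (simp add: alt_slots_plug dualct_plug) (simp add: plug_def sum_negf algebra_simps)
  have "(\<Sum>vs\<in>onlists (Suc (Suc k)). ?W \<alpha> vs * cnj (\<beta> vs)) =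
    (\<Sum>v\<in>set onb. \<Sum>vs\<in>onlists (Suc k). \<theta> v * \<alpha> vs * cnj (\<beta> (v # vs))) -
    (\<Sum>v\<in>set onb. \<Sum>vs\<in>onlists (Suc k). ?W (plug v \<alpha>) vs * cnj (\<beta> (v # vs)))"
    by (subst sum_onlists_Suc) (simp add: covector_wedge_Cons left_diff_distrib sum_subtractf)
  also have "(\<Sum>v\<in>set onb. \<Sum>vs\<in>onlists (Suc k). \<theta> v * \<alpha> vs * cnj (\<beta> (v # vs))) =
      (\<Sum>vs\<in>onlists (Suc k). \<alpha> vs * cnj (dualct \<theta> \<beta> vs))"
    by (subst sum.swap) (simp add: dualct_onb assms(1) Suc.prems sum_distrib_left algebra_simps)
  also have "(\<Sum>v\<in>set onb. \<Sum>vs\<in>onlists (Suc k). ?W (plug v \<alpha>) vs * cnj (\<beta> (v # vs))) =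
      - of_nat (Suc k) * (\<Sum>vs\<in>onlists (Suc k). \<alpha> vs * cnj (dualct \<theta> \<beta> vs))"
    unfolding * by (simp only: sum_distrib_left[symmetric] sum_onlists_Suc)
  finally show ?case by (simp add: algebra_simps)
qed

text \<open>The factor \<open>k + 1\<close> of the preceding lemma turns \<open>k!\<close> into \<open>(k + 1)!\<close>. The part of \<open>\<alpha>\<close> of top degree
  contributes to neither side, since the metric on forms stops at the top degree and the contraction of
  \<open>\<beta>\<close> has no component there.\<close>

theorem wedge_adjoint:
  assumes \<theta>: "linear \<theta>" and \<beta>: "alt_slots linear \<beta>"
  shows "ip (wedge (covector_form \<theta>) \<alpha>) \<beta> = ip \<alpha> (dualct \<theta> \<beta>)"
proof -
  let ?N = "CARD('m)"
  define S where "S k \<alpha> \<beta> = (\<Sum>vs\<in>onlists k. \<alpha> vs * cnj (\<beta> vs))" for k and \<alpha> \<beta> :: "('m, complex) form"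
  obtain N where N: "?N = Suc N" using not0_implies_Suc[of ?N] by auto
  have 0: "S 0 (wedge (covector_form \<theta>) \<alpha>) \<beta> = 0" by (simp add: S_def sum_onlists_0)
  have "dualct \<theta> \<beta> vs = 0" if "vs \<in> onlists ?N" for vs
    using that alt_above_dim[OF \<beta>] by (simp add: dualct_def contract_def onlists_def)
  then have top: "S (Suc N) \<alpha> (dualct \<theta> \<beta>) = 0" by (simp add: S_def N)
  have step: "S (Suc k) (wedge (covector_form \<theta>) \<alpha>) \<beta> / fact (Suc k) = S k \<alpha> (dualct \<theta> \<beta>) / fact k" for k
    using adjoint_onlists[OF \<theta> \<beta>, of \<alpha> k] by (simp add: S_def del: of_nat_Suc)
  have "ip (wedge (covector_form \<theta>) \<alpha>) \<beta> = (\<Sum>k\<le>Suc N. S k (wedge (covector_form \<theta>) \<alpha>) \<beta> / fact k)"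
    unfolding form_inner_onlists S_def N ..
  also have "\<dots> = (\<Sum>k\<le>N. S (Suc k) (wedge (covector_form \<theta>) \<alpha>) \<beta> / fact (Suc k))"
    unfolding sum.atMost_Suc_shift 0 by simp
  also have "\<dots> = (\<Sum>k\<le>N. S k \<alpha> (dualct \<theta> \<beta>) / fact k)" unfolding step ..
  also have "\<dots> = (\<Sum>k\<le>Suc N. S k \<alpha> (dualct \<theta> \<beta>) / fact k)" using top by simp
  also have "\<dots> = ip \<alpha> (dualct \<theta> \<beta>)" unfolding form_inner_onlists S_def N ..
  finally show ?thesis .
qed

lemma ip_unit: "ip unit_form \<alpha> = cnj (\<alpha> [])"
proof -
  have "(\<Sum>vs\<in>onlists k. unit_form vs * cnj (\<alpha> vs)) = (if k = 0 then cnj (\<alpha> []) else 0)" for k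
  proof (cases "k = 0")
    case False
    then have "unit_form vs = 0" if "vs \<in> onlists k" for vs using that by (auto simp: onlists_def unit_form_def)
    then show ?thesis using False by simp
  qed (simp add: sum_onlists_0, simp add: unit_form_def)
  then have "ip unit_form \<alpha> = (\<Sum>k\<le>CARD('m). if k = 0 then cnj (\<alpha> []) else 0)"
    unfolding form_inner_onlists by (intro sum.cong) auto
  then show ?thesis by simp
qed

text \<open>Definiteness only gives vanishing on lists of basis vectors of length at most the dimension;
  multilinearity and the absence of forms of higher degree do the rest.\<close>

lemma form_inner_definite:
  fixes \<alpha> :: "('m, complex^'r::finite) form"
  assumes h: "\<And>v. v \<noteq> 0 \<Longrightarrow> Re (h v v) > 0" "h 0 0 = 0"
    and \<alpha>: "\<And>i. alt_slots linear (\<lambda>vs. \<alpha> vs $ i)"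
  shows "Re (form_inner g h \<alpha> \<alpha>) \<ge> 0" "Re (form_inner g h \<alpha> \<alpha>) = 0 \<Longrightarrow> \<alpha> = 0"
proof -
  have nn: "Re (h v v) \<ge> 0" for v using h by (cases "v = 0") (auto intro: less_imp_le)
  have eq: "Re (form_inner g h \<alpha> \<alpha>) = (\<Sum>k\<le>CARD('m). (\<Sum>vs\<in>onlists k. Re (h (\<alpha> vs) (\<alpha> vs))) / fact k)"
    by (simp add: form_inner_onlists Re_divide_of_real[of _ "fact _", simplified])
  show "Re (form_inner g h \<alpha> \<alpha>) \<ge> 0" unfolding eq by (intro sum_nonneg divide_nonneg_pos) (auto intro: nn sum_nonneg)
  assume 0: "Re (form_inner g h \<alpha> \<alpha>) = 0"
  have "\<alpha> vs = 0" if k: "k \<le> CARD('m)" and vs: "vs \<in> onlists k" for k vs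
  proof -
    have "(\<Sum>vs\<in>onlists k. Re (h (\<alpha> vs) (\<alpha> vs))) / fact k = 0"
      using 0 k unfolding eq
      by (subst (asm) sum_nonneg_eq_0_iff) (auto intro!: sum_nonneg divide_nonneg_pos nn)
    then have "(\<Sum>vs\<in>onlists k. Re (h (\<alpha> vs) (\<alpha> vs))) = 0" by simp
    then have "Re (h (\<alpha> vs) (\<alpha> vs)) = 0"
      using vs by (subst (asm) sum_nonneg_eq_0_iff) (auto intro!: nn finite_onlists)
    then show ?thesis using h(1) by force
  qed
  then have "\<alpha> vs $ i = 0" for vs i
    using alt_eq_zero_onb[OF \<alpha>, of vs i] alt_above_dim[OF \<alpha>, of vs i] by (cases "length vs \<le> CARD('m)") force+
  then show "\<alpha> = 0" by (simp add: fun_eq_iff vec_eq_iff)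
qed

lemma ip_definite:
  assumes \<alpha>: "alt_slots linear \<alpha>" and 0: "ip \<alpha> \<alpha> = 0" shows "\<alpha> = 0"
proof -
  let ?A = "\<lambda>vs. \<chi> i::1. \<alpha> vs"
  have "?A = 0"
  proof (rule form_inner_definite(2)[where h = "\<lambda>a b. a $ 1 * cnj (b $ 1)"])
    show "Re (form_inner g (\<lambda>a b. a $ 1 * cnj (b $ 1)) ?A ?A) = 0" using 0 by (simp add: form_inner_onlists)
    fix v :: "complex^1" assume "v \<noteq> 0"
    then have "v $ 1 \<noteq> 0" by (simp add: vec_eq_iff)
    then have "(Re (v$1))\<^sup>2 + (Im (v$1))\<^sup>2 > 0" by (simp add: complex_neq_0)
    then show "Re (v $ 1 * cnj (v $ 1)) > 0" by (simp add: power2_eq_square)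
  qed (use \<alpha> in auto)
  from fun_cong[OF this] have "?A vs $ 1 = 0" for vs by (metis zero_fun_apply zero_index)
  then show ?thesis by (auto simp: fun_eq_iff)
qed

end

text \<open>Forms are used as vectors from here on; their values are unfolded only on request.\<close>

lemmas pointwise = plus_fun_apply zero_fun_apply minus_apply uminus_apply
declare pointwise [simp del]

section \<open>Forms of type (p,q)\<close>

lemma Lambda_zero: "0 \<in> Lambda J p q"
  using Lambda.zero[of J p q] by (simp add: zero_fun_def)

lemma Lambda_add_wedges:
  "\<omega> \<in> Lambda J p q \<Longrightarrow> length \<theta>s = p \<Longrightarrow> \<forall>\<theta>\<in>set \<theta>s. type10 J \<theta> \<Longrightarrow> length \<eta>s = q \<Longrightarrow> \<forall>\<eta>\<in>set \<eta>s. type01 J \<eta> \<Longrightarrow>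
     \<omega> + form_scale a (wedges (\<theta>s @ \<eta>s)) \<in> Lambda J p q"
  using Lambda.add[of \<omega> J p q \<theta>s \<eta>s a] by (simp add: plus_fun_def form_scale_def)

lemma Lambda_induct [consumes 1, case_names zero add]:
  assumes "\<omega> \<in> Lambda J p q" "R 0"
    and "\<And>\<omega> \<theta>s \<eta>s a. \<omega> \<in> Lambda J p q \<Longrightarrow> R \<omega> \<Longrightarrow> length \<theta>s = p \<Longrightarrow> \<forall>\<theta>\<in>set \<theta>s. type10 J \<theta> \<Longrightarrow>
       length \<eta>s = q \<Longrightarrow> \<forall>\<eta>\<in>set \<eta>s. type01 J \<eta> \<Longrightarrow> R (\<omega> + form_scale a (wedges (\<theta>s @ \<eta>s)))"
  shows "R \<omega>"
  using assms(1)
proof induction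
  case zero then show ?case using assms(2) by (simp add: zero_fun_def)
next
  case (add \<omega> \<theta>s \<eta>s a)
  then show ?case using assms(3)[of \<omega> \<theta>s \<eta>s a] by (simp add: plus_fun_def form_scale_def)
qed

lemma Lambda0_induct [consumes 1, case_names zero add]:
  assumes "\<omega> \<in> Lambda J 0 q" "R 0"
    and "\<And>\<omega> \<eta>s a. \<omega> \<in> Lambda J 0 q \<Longrightarrow> R \<omega> \<Longrightarrow> length \<eta>s = q \<Longrightarrow> \<forall>\<eta>\<in>set \<eta>s. type01 J \<eta> \<Longrightarrow>
       R (\<omega> + form_scale a (wedges \<eta>s))"
  shows "R \<omega>"
  using assms(1)
proof (induction rule: Lambda_induct)
  case (add \<omega> \<theta>s \<eta>s a)
  then show ?case using assms(3)[of \<omega> \<eta>s a] by simp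
qed (rule assms(2))

lemma Lambda_add: "\<beta> \<in> Lambda J p q \<Longrightarrow> \<alpha> \<in> Lambda J p q \<Longrightarrow> \<alpha> + \<beta> \<in> Lambda J p q"
  by (induction rule: Lambda_induct) (auto simp: Lambda_add_wedges simp flip: add.assoc)

lemma Lambda_scale: "\<alpha> \<in> Lambda J p q \<Longrightarrow> form_scale c \<alpha> \<in> Lambda J p q"
  by (induction rule: Lambda_induct) (auto simp: Lambda_zero form_scale_add Lambda_add_wedges)

lemma Lambda_minus: "\<alpha> \<in> Lambda J p q \<Longrightarrow> - \<alpha> \<in> Lambda J p q"
  using Lambda_scale[of \<alpha> J p q "-1"] by (simp add: form_scale_minus1)

lemma Lambda_diff: "\<alpha> \<in> Lambda J p q \<Longrightarrow> \<beta> \<in> Lambda J p q \<Longrightarrow> \<alpha> - \<beta> \<in> Lambda J p q"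
  using Lambda_add[OF Lambda_minus, of \<beta> J p q \<alpha>] by simp

lemma Lambda_sum: "(\<And>i. i \<in> S \<Longrightarrow> f i \<in> Lambda J p q) \<Longrightarrow> (\<Sum>i\<in>S. f i) \<in> Lambda J p q"
  by (induction S rule: infinite_finite_induct) (auto simp: Lambda_zero intro: Lambda_add)

lemma Lambda_wedges:
  assumes "\<forall>\<theta>\<in>set \<theta>s. type10 J \<theta>" "\<forall>\<eta>\<in>set \<eta>s. type01 J \<eta>"
  shows "wedges (\<theta>s @ \<eta>s) \<in> Lambda J (length \<theta>s) (length \<eta>s)"
  using Lambda_add_wedges[OF Lambda_zero refl assms(1) refl assms(2), of 1] by simp

lemma Lambda0_wedges: "\<forall>\<eta>\<in>set \<eta>s. type01 J \<eta> \<Longrightarrow> wedges \<eta>s \<in> Lambda J 0 (length \<eta>s)"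
  using Lambda_wedges[of "[]" J \<eta>s] by simp

lemma Lambda_homog: "\<alpha> \<in> Lambda J p q \<Longrightarrow> homog (p + q) \<alpha>"
proof (induction rule: Lambda_induct)
  case (add \<omega> \<theta>s \<eta>s a)
  then show ?case using homog_wedges[of "\<theta>s @ \<eta>s"] by (auto intro: homog_add homog_scale)
qed (rule homog_zero)

lemma Lambda_alt: "\<alpha> \<in> Lambda J p q \<Longrightarrow> alt_slots linear \<alpha>"
proof (induction rule: Lambda_induct)
  case (add \<omega> \<theta>s \<eta>s a)
  then have "\<forall>\<theta>\<in>set (\<theta>s @ \<eta>s). linear \<theta>" by (auto simp: type10_def type01_def)
  then show ?case by (intro alt_slots_add alt_slots_scale alt_slots_wedges slot_space_linear add.IH)
qed (simp add: alt_slots_zero)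

lemma Lambda0_alt: "\<alpha> \<in> Lambda J 0 q \<Longrightarrow> alt_slots (type01 J) \<alpha>"
  by (induction rule: Lambda0_induct)
    (auto intro!: alt_slots_add alt_slots_scale alt_slots_wedges simp: alt_slots_zero)

lemma Lambdan_alt: "\<alpha> \<in> Lambda J p 0 \<Longrightarrow> alt_slots (type10 J) \<alpha>"
  by (induction rule: Lambda_induct)
    (auto intro!: alt_slots_add alt_slots_scale alt_slots_wedges simp: alt_slots_zero)

lemma Lambda_covector_wedge:
  "\<alpha> \<in> Lambda J 0 q \<Longrightarrow> type01 J \<theta> \<Longrightarrow> wedge (covector_form \<theta>) \<alpha> \<in> Lambda J 0 (Suc q)"
proof (induction rule: Lambda0_induct)
  case (add \<omega> \<eta>s a)
  then show ?case using Lambda0_wedges[of "\<theta> # \<eta>s" J]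
    by (auto simp: wedge_add_right wedge_scale_right wedges_Cons intro!: Lambda_add Lambda_scale)
qed (simp add: Lambda_zero)

lemma Lambda_wedge_wedge:
  assumes "\<alpha> \<in> Lambda J p 0" "\<beta> \<in> Lambda J 0 q" shows "wedge \<alpha> \<beta> \<in> Lambda J p q"
  using assms(1)
proof (induction rule: Lambda_induct)
  case (add \<omega> \<theta>s \<eta>s a)
  have "wedge (wedges \<theta>s) \<beta> \<in> Lambda J p q" using assms(2)
  proof (induction rule: Lambda0_induct)
    case (add \<omega>' \<zeta>s b)
    then show ?case using Lambda_wedges[of \<theta>s J \<zeta>s] \<open>\<forall>\<theta>\<in>set \<theta>s. type10 J \<theta>\<close> \<open>length \<theta>s = p\<close>
      by (auto simp: wedge_add_right wedge_scale_right wedges_append intro!: Lambda_add Lambda_scale)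
  qed (simp add: Lambda_zero)
  then show ?case using add by (auto simp: wedge_add_left wedge_scale_left intro!: Lambda_add Lambda_scale)
qed (simp add: Lambda_zero)

lemma Lambda0_wedge:
  assumes "\<alpha> \<in> Lambda J 0 p" "\<beta> \<in> Lambda J 0 q" shows "wedge \<alpha> \<beta> \<in> Lambda J 0 (p + q)"
  using assms(1)
proof (induction rule: Lambda0_induct)
  case (add \<omega> \<theta>s a)
  have "wedge (wedges \<theta>s) \<beta> \<in> Lambda J 0 (p + q)" using assms(2)
  proof (induction rule: Lambda0_induct)
    case (add \<omega>' \<zeta>s b)
    then show ?case using Lambda0_wedges[of "\<theta>s @ \<zeta>s" J] \<open>\<forall>\<theta>\<in>set \<theta>s. type01 J \<theta>\<close> \<open>length \<theta>s = p\<close>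
      by (auto simp: wedge_add_right wedge_scale_right wedges_append intro!: Lambda_add Lambda_scale)
  qed (simp add: Lambda_zero)
  then show ?case using add by (auto simp: wedge_add_left wedge_scale_left intro!: Lambda_add Lambda_scale)
qed (simp add: Lambda_zero)

lemma Lambda_contract:
  assumes "\<alpha> \<in> Lambda J 0 (Suc q)" shows "contract w \<alpha> \<in> Lambda J 0 q"
proof -
  have *: "contract w (wedges \<eta>s) \<in> Lambda J 0 q" if "length \<eta>s = Suc q" "\<forall>\<eta>\<in>set \<eta>s. type01 J \<eta>" for \<eta>s q
    using that
  proof (induction \<eta>s arbitrary: q)
    case (Cons \<eta> \<eta>s)
    have "wedge (covector_form \<eta>) (contract w (wedges \<eta>s)) \<in> Lambda J 0 q"
    proof (cases q)
      case 0 then show ?thesis using Cons.prems by (simp add: Lambda_zero)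
    next
      case (Suc q')
      then show ?thesis using Lambda_covector_wedge[OF Cons.IH[of q'], of \<eta>] Cons.prems by simp
    qed
    then show ?case using Lambda0_wedges[of \<eta>s J] Cons.prems
      by (auto simp: wedges_Cons contract_covector_wedge intro!: Lambda_diff Lambda_scale)
  qed simp
  show ?thesis using assms
    by (induction rule: Lambda0_induct) (auto simp: Lambda_zero contract_add contract_scale * intro!: Lambda_add Lambda_scale)
qed

lemma Lambda00: "\<alpha> \<in> Lambda J 0 0 \<Longrightarrow> \<alpha> = form_scale (\<alpha> []) unit_form"
  using Lambda_homog[of \<alpha> J 0 0] homog_0_eq by simp

lemma Lambda_contract_0: "\<alpha> \<in> Lambda J 0 0 \<Longrightarrow> contract w \<alpha> = 0"
  using Lambda00[of \<alpha> J] contract_scale[of w "\<alpha> []" unit_form] by simp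

section \<open>The star operator on forms of type (0,q)\<close>

context hermitian_space
begin

lemma distinct_uframe: "distinct uframe"
proof -
  have "distinct es" if "distinct (real_frame J es)" for es
    using that by (induction es) (auto simp: set_real_frame)
  then show ?thesis using uframe(2) unfolding orthonormal_list_iff by blast
qed

text \<open>A form of type (0,q) is determined by its values on the \<open>n\<close> vectors of the unitary frame.\<close>

lemma Lambda0_above: "\<alpha> \<in> Lambda J 0 q \<Longrightarrow> q > n \<Longrightarrow> \<alpha> = 0"
proof
  fix vs assume \<alpha>: "\<alpha> \<in> Lambda J 0 q" "q > n"
  show "\<alpha> vs = 0 vs"
  proof (cases "length vs = q")
    case True
    then have "\<alpha> vs = 0" using \<alpha>(2) uframe(1)
      by (intro alt_slots_eq_zero[OF slot_space_type01 Lambda0_alt[OF \<alpha>(1)] determined_uframe(1)]) simp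
    then show ?thesis by (simp add: pointwise)
  next
    case False then show ?thesis using Lambda_homog[OF \<alpha>(1)] by (simp add: homog_def pointwise)
  qed
qed

text \<open>The covectors of type (1,0) that belong to a unitary frame; those of type (0,1) are their
  conjugates. They are orthogonal, of squared norm 2.\<close>

definition cov10 :: "real^'m \<Rightarrow> real^'m \<Rightarrow> complex" where
  "cov10 e v = complex_of_real (g e v) + \<i> * complex_of_real (g (J e) v)"

definition cov01 :: "real^'m \<Rightarrow> real^'m \<Rightarrow> complex" where
  "cov01 e v = cnj (cov10 e v)"

lemma cov_types: "type10 J (cov10 e)" "type01 J (cov01 e)"
proof -
  have "linear (cov10 e)" by (auto simp: linear_iff cov10_def g_simps J_simps algebra_simps) (simp add: scaleR_conv_of_real algebra_simps)
  moreover have "cov10 e (J v) = \<i> * cov10 e v" for v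
    using g_J[of e v] by (simp add: cov10_def g_JJ algebra_simps)
  ultimately show "type10 J (cov10 e)" "type01 J (cov01 e)"
    by (auto simp: type10_def type01_def cov01_def[abs_def] linear_cnj)
qed

text \<open>The conjugate of this covector is metrically dual to \<open>e - \<i> J e\<close>.\<close>

lemma cip_cov10: "cip \<theta> (cov10 e) = \<theta> e - \<i> * \<theta> (J e)" if "linear \<theta>"
proof -
  have "sharp g (\<lambda>v. cnj (cov10 e v)) = (e, - J e)"
    by (rule sharp_unique) (simp add: cov10_def g_simps)
  then show ?thesis using that by (simp add: cip_def evalC_def linear_neg)
qed

lemma cip_conj: "linear \<theta> \<Longrightarrow> linear \<theta>' \<Longrightarrow> cip (\<lambda>v. cnj (\<theta>' v)) (\<lambda>v. cnj (\<theta> v)) = cnj (cip \<theta>' \<theta>)"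
  by (simp add: cip_onb linear_cnj)

lemma cip_cov:
  assumes "e \<in> set uframe" "f \<in> set uframe"
  shows "cip (cov10 f) (cov10 e) = (if e = f then 2 else 0)"
    "cip (cov01 f) (cov01 e) = (if e = f then 2 else 0)"
    "cip (cov01 f) (cov10 e) = 0" "cip (cov10 f) (cov01 e) = 0"
proof -
  have lin: "linear (cov10 e)" "linear (cov10 f)" using cov_types by (auto simp: type10_def)
  have "g f e = (if f = e then 1 else 0)" "g (J f) e = (if J f = e then 1 else 0)"
    using assms uframe(2) unfolding orthonormal_list_iff set_real_frame by blast+
  moreover have "J f \<noteq> e"
  proof
    assume "J f = e"
    have "distinct (real_frame J uframe)" using uframe(2) by (simp add: orthonormal_list_iff)
    moreover have "\<not> distinct (real_frame J es)" if "f \<in> set es" "J f \<in> set es" for es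
    proof
      assume d: "distinct (real_frame J es)"
      have "card (set (real_frame J es)) = 2 * length es" using distinct_card[OF d] by simp
      moreover have "card (set es) \<le> length es" "card (J ` set es) \<le> length es"
        using card_length[of es] card_image_le[of "set es" J] by auto
      moreover have "card (set es \<union> J ` set es) < card (set es) + card (J ` set es)"
        using that card_Un_Int[of "set es" "J ` set es"] by (auto simp: card_gt_0_iff intro!: card_gt_0_iff[THEN iffD2])
      ultimately show False by (simp add: set_real_frame)
    qed
    ultimately show False using assms \<open>J f = e\<close> by blast
  qed
  ultimately have "cov10 f e = (if f = e then 1 else 0)" by (auto simp: cov10_def)
  then show 1: "cip (cov10 f) (cov10 e) = (if e = f then 2 else 0)"
    using cov_types(1)[of f] by (simp add: cip_cov10[OF lin(2)] type10_def)
  show "cip (cov01 f) (cov01 e) = (if e = f then 2 else 0)"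
    using cip_conj[OF lin] 1 by (simp add: cov01_def[abs_def])
  show "cip (cov01 f) (cov10 e) = 0" "cip (cov10 f) (cov01 e) = 0"
    by (intro type_orthogonal; use cov_types in blast)+
qed

text \<open>The products \<open>\<eta>\<close> and \<open>\<nu>\<close> of the coframe span the forms of type (n,0) and (0,n).\<close>

definition eta :: "('m, complex) form" where "eta = wedges (map cov10 uframe)"
definition nu :: "('m, complex) form" where "nu = wedges (map cov01 uframe)"

lemma eta_Lambda: "eta \<in> Lambda J n 0" and nu_Lambda: "nu \<in> Lambda J 0 n"
  using Lambda_wedges[of "map cov10 uframe" J "[]"] Lambda_wedges[of "[]" J "map cov01 uframe"] uframe(1) cov_types
  by (auto simp: eta_def nu_def)

abbreviation orth_covs :: "(real^'m \<Rightarrow> complex) list \<Rightarrow> bool" where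
  "orth_covs cs \<equiv> sorted_wrt (\<lambda>\<theta> \<theta>'. cip \<theta>' \<theta> = 0) cs \<and> (\<forall>\<theta>\<in>set cs. cip \<theta> \<theta> = 2)"

lemma dualct_wedges_zero: "\<forall>\<theta>'\<in>set cs. cip \<theta>' \<theta> = 0 \<Longrightarrow> dualct \<theta> (wedges cs) = 0"
  by (induction cs) (auto simp: wedges_Cons dualct_covector_wedge dualct_ops)

text \<open>Contraction with the first covector removes it, since it is orthogonal to the others.\<close>

lemma wedges_nonzero: "orth_covs cs \<Longrightarrow> wedges cs \<noteq> 0"
proof (induction cs)
  case Nil
  have "unit_form [] \<noteq> (0 :: complex)" by (simp add: unit_form_def)
  then show ?case by (auto simp: fun_eq_iff pointwise)
next
  case (Cons c cs)
  then have "dualct c (wedges (c # cs)) = form_scale 2 (wedges cs)"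
    by (simp add: wedges_Cons dualct_covector_wedge dualct_wedges_zero)
  moreover have "form_scale 2 (wedges cs) \<noteq> 0"
  proof
    assume "form_scale 2 (wedges cs) = 0"
    then have "form_scale (1 / 2) (form_scale 2 (wedges cs)) = 0" by (simp del: form_scale_simps(4))
    then show False using Cons by simp
  qed
  ultimately show ?case using dualct_ops(4)[of c] by auto
qed

lemma orth_covs_map:
  assumes "distinct es" "\<And>e f. e \<in> set es \<Longrightarrow> f \<in> set es \<Longrightarrow> cip (F f) (F e) = (if e = f then 2 else 0)"
  shows "orth_covs (map F es)"
  using assms by (induction es) auto

lemma orth_eta: "orth_covs (map cov10 uframe)" and orth_nu: "orth_covs (map cov01 uframe)"
  and orth_top: "orth_covs (map cov10 uframe @ map cov01 uframe)"
proof -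
  show 1: "orth_covs (map cov10 uframe)" and 2: "orth_covs (map cov01 uframe)"
    using cip_cov by (intro orth_covs_map distinct_uframe; simp)+
  show "orth_covs (map cov10 uframe @ map cov01 uframe)"
    using 1 2 cip_cov by (auto simp: sorted_wrt_append)
qed

lemma eta_nonzero: "eta \<noteq> 0" and nu_nonzero: "nu \<noteq> 0" and top_nonzero: "wedge eta nu \<noteq> 0"
  using wedges_nonzero[OF orth_eta] wedges_nonzero[OF orth_nu] wedges_nonzero[OF orth_top]
  by (simp_all add: eta_def nu_def wedges_append)

lemma homog_top_zero:
  assumes Q: "slot_space Q" and \<alpha>: "alt_slots Q \<alpha>" "homog (length bs) \<alpha>" "\<alpha> bs = 0" and bs: "distinct bs"
    and det: "determined_by Q bs"
  shows "\<alpha> = 0"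
proof
  fix vs show "\<alpha> vs = 0 vs"
  proof (cases "length vs = length bs")
    case True
    then have "\<alpha> vs = 0" using \<alpha> bs by (intro alt_slots_eq_zero[OF Q \<alpha>(1) det]) auto
    then show ?thesis by (simp add: pointwise)
  qed (use \<alpha>(2) in \<open>simp add: homog_def pointwise\<close>)
qed

lemma homog_top_multiple:
  assumes Q: "slot_space Q" and \<alpha>: "alt_slots Q \<alpha>" "homog (length bs) \<alpha>" and bs: "distinct bs"
    and det: "determined_by Q bs"
    and \<omega>: "alt_slots Q \<omega>" "homog (length bs) \<omega>" "\<omega> \<noteq> 0"
  shows "\<omega> bs \<noteq> 0" "\<alpha> = form_scale (\<alpha> bs / \<omega> bs) \<omega>"
proof -
  show nz: "\<omega> bs \<noteq> 0"
  proof
    assume "\<omega> bs = 0"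
    with homog_top_zero[OF Q \<omega>(1,2) _ bs det] \<omega>(3) show False by simp
  qed
  have "\<alpha> + form_scale (- (\<alpha> bs / \<omega> bs)) \<omega> = 0"
  proof (rule homog_top_zero[OF Q _ _ _ bs det])
    show "alt_slots Q (\<alpha> + form_scale (- (\<alpha> bs / \<omega> bs)) \<omega>)"
      by (intro alt_slots_add alt_slots_scale Q \<alpha> \<omega>)
    show "homog (length bs) (\<alpha> + form_scale (- (\<alpha> bs / \<omega> bs)) \<omega>)"
      by (intro homog_add homog_scale \<alpha> \<omega>)
    show "(\<alpha> + form_scale (- (\<alpha> bs / \<omega> bs)) \<omega>) bs = 0"
      using nz by (simp add: form_scale_def pointwise)
  qed
  moreover have "form_scale (- (\<alpha> bs / \<omega> bs)) \<omega> = - form_scale (\<alpha> bs / \<omega> bs) \<omega>"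
    by (rule ext) (simp add: form_scale_def pointwise)
  ultimately show "\<alpha> = form_scale (\<alpha> bs / \<omega> bs) \<omega>" by simp
qed

lemma Lambda_n0: "\<alpha> \<in> Lambda J n 0 \<Longrightarrow> \<alpha> = form_scale (\<alpha> uframe / eta uframe) eta"
  using Lambda_homog[of \<alpha> J n 0] Lambda_homog[OF eta_Lambda] uframe(1)
  by (intro homog_top_multiple(2)[OF slot_space_type10 _ _ distinct_uframe determined_uframe(2) _ _ eta_nonzero])
    (simp_all add: Lambdan_alt[of _ J n] eta_Lambda)

lemma top_alternating: "homog (2 * n) (wedge eta nu)" "alt_slots linear (wedge eta nu)"
  using Lambda_wedge_wedge[OF eta_Lambda nu_Lambda] Lambda_alt Lambda_homog[of _ J n n] by (auto simp: mult_2)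

text \<open>The constant scales the map \<open>\<tau>\<close>, in which the main result is homogeneous. Forms of top degree being unique up to a factor, it suffices
  that \<open>\<eta> \<and> \<nu>\<close> is not 0.\<close>

lemma vol_form_eq: "\<exists>c. c \<noteq> 0 \<and> vol_form n J g = form_scale c (wedge eta nu)"
proof -
  let ?F = "real_frame J uframe" let ?O = "wedge eta nu"
  have d: "distinct ?F" using uframe(2) by (simp add: orthonormal_list_iff)
  have len: "length ?F = CARD('m)" "length ?F = 2 * n" using uframe dim by auto
  note det = determined_orthonormal[OF uframe(2) len(1)]
  have nz: "?O ?F \<noteq> 0"
  proof
    assume "?O ?F = 0"
    with homog_top_zero[OF slot_space_linear top_alternating(2) _ _ d det] top_alternating(1) len(2)
    have "?O = 0" by simp
    then show False using top_nonzero by simp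
  qed
  let ?v = "form_scale (1 / ?O ?F) ?O"
  have "(THE \<omega>. alternating_form (2 * n) \<omega> \<and> \<omega> ?F = 1) = ?v"
  proof (rule the_equality)
    show "alternating_form (2 * n) ?v \<and> ?v ?F = 1"
      using top_alternating nz by (auto simp: alternating_form_iff homog_scale alt_slots_scale) (simp add: form_scale_def)
    fix \<omega> assume \<omega>: "alternating_form (2 * n) \<omega> \<and> \<omega> ?F = 1"
    then show "\<omega> = ?v"
      using homog_top_multiple(2)[OF slot_space_linear _ _ d det top_alternating(2) _ top_nonzero, of \<omega>] len top_alternating(1)
      by (auto simp: alternating_form_iff)
  qed
  then have "vol_form n J g = ?v" by (simp add: vol_form_def Let_def flip: uframe_def)
  then show ?thesis using nz by (intro exI[of _ "1 / ?O ?F"]) auto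
qed

text \<open>The contraction of \<open>\<nu>\<close> by \<open>\<alpha>\<close>, conjugate linear in \<open>\<alpha>\<close>. The arguments of \<open>\<alpha>\<close> are inserted in
  reverse order, which makes multiplication by a covector correspond to contraction without any sign. On
  forms of type (0,q) this is the star operator of \<open>\<Lambda>\<^sup>0\<^sup>,\<^sup>*\<close> up to sign.\<close>

definition star :: "('m, complex) form \<Rightarrow> ('m, complex) form" where
  "star \<alpha> = (\<lambda>vs. cnj (ip \<alpha> (\<lambda>us. nu (rev us @ vs))))"

lemma star_ops: "star 0 = 0" "star (\<alpha> + \<beta>) = star \<alpha> + star \<beta>" "star (\<alpha> - \<beta>) = star \<alpha> - star \<beta>"
  "star (form_scale c \<alpha>) = form_scale (cnj c) (star \<alpha>)"
  by (auto simp: star_def ip_simps pointwise) (auto simp: form_scale_def)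

lemma star_sum: "star (\<Sum>i\<in>S. f i) = (\<Sum>i\<in>S. star (f i))"
  by (induction S rule: infinite_finite_induct) (simp_all add: star_ops)

lemma star_unit: "star unit_form = nu"
  by (rule ext) (simp add: star_def ip_unit)

text \<open>This is the adjointness of multiplication and contraction, applied to the arguments of \<open>\<nu>\<close> that are
  paired with \<open>\<alpha>\<close>.\<close>

lemma star_covector_wedge:
  assumes "linear \<theta>" shows "star (wedge (covector_form \<theta>) \<alpha>) = dualct \<theta> (star \<alpha>)"
proof
  fix vs
  have nu: "alt_slots linear nu" using nu_Lambda by (rule Lambda_alt)
  have alt: "alt_slots linear (\<lambda>us. nu (rev us @ vs))" for vs
    unfolding alt_slots_def
  proof (intro conjI allI)
    fix us us' v
    show "linear (\<lambda>v. nu (rev (us @ v # us') @ vs))" using nu[unfolded alt_slots_def] by simp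
    show "nu (rev (us @ v # v # us') @ vs) = 0" using nu[unfolded alt_slots_def] by simp
  qed
  let ?w = "sharp g (\<lambda>v. cnj (\<theta> v))"
  have "dualct \<theta> (\<lambda>us. nu (rev us @ vs)) =
      (\<lambda>us. nu (rev us @ fst ?w # vs)) + form_scale \<i> (\<lambda>us. nu (rev us @ snd ?w # vs))"
    by (auto simp: dualct_def contract_def form_scale_def pointwise)
  then show "star (wedge (covector_form \<theta>) \<alpha>) vs = dualct \<theta> (star \<alpha>) vs"
    by (simp add: star_def wedge_adjoint[OF assms alt] ip_simps) (simp add: dualct_def contract_def)
qed

lemma type01_linear: "type01 J \<theta> \<Longrightarrow> linear \<theta>" by (simp add: type01_def)

lemma star_wedges:
  "\<forall>\<theta>\<in>set as. type01 J \<theta> \<Longrightarrow> length as \<le> n \<Longrightarrow> star (wedges as) \<in> Lambda J 0 (n - length as)"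
proof (induction as)
  case Nil then show ?case by (simp add: star_unit nu_Lambda)
next
  case (Cons a as)
  then have "star (wedges as) \<in> Lambda J 0 (Suc (n - length (a # as)))" by (simp add: Suc_diff_Suc)
  then show ?case using Cons.prems unfolding wedges_Cons
    by (subst star_covector_wedge) (auto simp: type01_linear dualct_def Lambda_contract)
qed

lemma star_Lambda: "\<alpha> \<in> Lambda J 0 q \<Longrightarrow> q \<le> n \<Longrightarrow> star \<alpha> \<in> Lambda J 0 (n - q)"
  by (induction rule: Lambda0_induct) (auto simp: star_ops Lambda_zero intro!: Lambda_add Lambda_scale dest: star_wedges)

lemma ip_dualct_left:
  assumes "linear \<theta>" "alt_slots linear \<alpha>" shows "ip (dualct \<theta> \<alpha>) \<beta> = ip \<alpha> (wedge (covector_form \<theta>) \<beta>)"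
  using wedge_adjoint[OF assms, of \<beta>] ip_cnj by metis

abbreviation sgn_tri :: "nat \<Rightarrow> complex" where "sgn_tri q \<equiv> (-1) ^ (q * (q - 1) div 2)"

lemma sgn_tri_Suc: "sgn_tri (Suc q) = (-1) ^ q * sgn_tri q"
proof -
  have "Suc q * (Suc q - 1) div 2 = q + q * (q - 1) div 2" by (cases q) (auto simp: algebra_simps)
  then show ?thesis by (simp add: power_add)
qed

text \<open>Let \<open>Y\<close> be the star of the product of \<open>as\<close>. For degree reasons \<open>X \<and> Y\<close> is 0, and contracting this
  equation with the covector \<open>a\<close> moves the contraction from \<open>Y\<close> to \<open>X\<close>. When all factors have been moved, \<open>\<nu>\<close>
  remains on the right, multiplied by the full contraction of \<open>X\<close>.\<close>

lemma wedge_star_wedges: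
  assumes "\<forall>\<theta>\<in>set as. type01 J \<theta>" "length as \<le> n" "X \<in> Lambda J 0 (length as)"
  shows "wedge X (star (wedges as)) = form_scale (sgn_tri (length as) * ip X (wedges as)) nu"
  using assms
proof (induction as arbitrary: X)
  case Nil
  from Lambda00[of X J] Nil obtain c where X: "X = form_scale c unit_form" by auto
  have "ip X unit_form = cnj (ip unit_form X)" by (rule ip_cnj)
  then show ?case by (simp add: star_unit wedge_scale_left ip_unit X) (simp add: form_scale_def unit_form_def)
next
  case (Cons a as)
  let ?q = "length as" let ?Y = "star (wedges as)"
  have a: "linear a" using Cons.prems by (simp add: type01_linear)
  have Y: "?Y \<in> Lambda J 0 (n - ?q)" using star_wedges Cons.prems by simp
  have "wedge X ?Y \<in> Lambda J 0 (length (a # as) + (n - ?q))" by (rule Lambda0_wedge[OF Cons.prems(3) Y])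
  then have "wedge X ?Y = 0" by (rule Lambda0_above) (use Cons.prems in simp)
  then have "0 = wedge (dualct a X) ?Y + wedge (grade X) (dualct a ?Y)"
    using dualct_wedge[of a X ?Y] by (simp add: dualct_ops)
  also have "grade X = form_scale ((-1) ^ Suc ?q) X" using homog_grade[OF Lambda_homog[OF Cons.prems(3)]] by simp
  finally have "form_scale ((-1) ^ Suc ?q) (wedge X (dualct a ?Y)) + wedge (dualct a X) ?Y = 0"
    by (simp only: wedge_scale_left add.commute)
  moreover have "form_scale ((-1) ^ Suc ?q) \<omega> = - form_scale ((-1) ^ ?q) \<omega>" for \<omega> :: "('m, complex) form"
    by (rule ext) (simp add: form_scale_def pointwise)
  ultimately have "form_scale ((-1) ^ ?q) (wedge X (dualct a ?Y)) = wedge (dualct a X) ?Y" by simp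
  then have "form_scale ((-1) ^ ?q) (form_scale ((-1) ^ ?q) (wedge X (dualct a ?Y))) = form_scale ((-1) ^ ?q) (wedge (dualct a X) ?Y)"
    by simp
  then have "wedge X (dualct a ?Y) = form_scale ((-1) ^ ?q) (wedge (dualct a X) ?Y)"
    by (simp flip: power_mult_distrib)
  also have "dualct a X \<in> Lambda J 0 ?q" unfolding dualct_def using Cons.prems by (intro Lambda_contract) simp
  then have "wedge (dualct a X) ?Y = form_scale (sgn_tri ?q * ip (dualct a X) (wedges as)) nu"
    using Cons.prems by (intro Cons.IH) auto
  also have "ip (dualct a X) (wedges as) = ip X (wedges (a # as))"
    unfolding wedges_Cons by (rule ip_dualct_left[OF a Lambda_alt[OF Cons.prems(3)]])
  finally have "wedge X (star (wedges (a # as))) =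
      form_scale ((-1) ^ ?q * (sgn_tri ?q * ip X (wedges (a # as)))) nu"
    using a by (simp add: wedges_Cons star_covector_wedge)
  then show ?case by (simp only: length_Cons sgn_tri_Suc mult.assoc)
qed

lemma wedge_star:
  assumes "\<alpha> \<in> Lambda J 0 q" "q \<le> n" "X \<in> Lambda J 0 q"
  shows "wedge X (star \<alpha>) = form_scale (sgn_tri q * ip X \<alpha>) nu"
  using assms(1)
proof (induction rule: Lambda0_induct)
  case (add \<omega> \<eta>s a)
  then show ?case using wedge_star_wedges[of \<eta>s X] assms
    by (simp add: star_ops wedge_add_right wedge_scale_right ip_simps)
      (simp add: form_scale_def algebra_simps fun_eq_iff pointwise)
qed (simp add: star_ops ip_simps)

text \<open>The same argument, with the contractions moved to the right factor. It says that the wedge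
  product is a nondegenerate pairing.\<close>

lemma star_wedges_wedge_zero:
  assumes "\<forall>\<theta>\<in>set bs. type01 J \<theta>" "length bs \<le> n" "Z \<in> Lambda J 0 (length bs)" "wedge (star (wedges bs)) Z = 0"
  shows "ip (wedges bs) Z = 0"
  using assms
proof (induction bs arbitrary: Z)
  case Nil
  from Lambda00[of Z J] Nil obtain c where Z: "Z = form_scale c unit_form" by auto
  then have "form_scale c nu = 0" using Nil by (simp add: star_unit wedge_scale_right)
  then have "c = 0" using nu_nonzero by (auto simp: form_scale_def fun_eq_iff pointwise)
  then show ?case by (simp add: Z ip_simps)
next
  case (Cons b bs)
  let ?q = "length bs" let ?Y = "star (wedges bs)"
  have b: "linear b" using Cons.prems by (simp add: type01_linear)
  have Y: "?Y \<in> Lambda J 0 (n - ?q)" using star_wedges Cons.prems by simp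
  have "wedge ?Y Z \<in> Lambda J 0 (n - ?q + length (b # bs))" by (rule Lambda0_wedge[OF Y Cons.prems(3)])
  then have "wedge ?Y Z = 0" by (rule Lambda0_above) (use Cons.prems in simp)
  then have "0 = wedge (dualct b ?Y) Z + wedge (grade ?Y) (dualct b Z)"
    using dualct_wedge[of b ?Y Z] by (simp add: dualct_ops)
  also have "wedge (dualct b ?Y) Z = 0" using Cons.prems(4) by (simp add: wedges_Cons star_covector_wedge b)
  also have "grade ?Y = form_scale ((-1) ^ (n - ?q)) ?Y" using homog_grade[OF Lambda_homog[OF Y]] by simp
  finally have "form_scale ((-1) ^ (n - ?q)) (wedge ?Y (dualct b Z)) = 0" by (simp add: wedge_scale_left)
  then have "wedge ?Y (dualct b Z) vs = 0" for vs
    using fun_cong[of _ _ vs] by (fastforce simp: form_scale_def pointwise)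
  then have "wedge ?Y (dualct b Z) = 0" by (auto simp: pointwise)
  moreover have "dualct b Z \<in> Lambda J 0 ?q" unfolding dualct_def using Cons.prems by (intro Lambda_contract) simp
  ultimately have "ip (wedges bs) (dualct b Z) = 0" using Cons.prems by (intro Cons.IH) auto
  then show ?case unfolding wedges_Cons using wedge_adjoint[OF b Lambda_alt[OF Cons.prems(3)]] by simp
qed

lemma wedge_nondegenerate:
  assumes "q \<le> n" "\<sigma> \<in> Lambda J 0 (n - q)" "\<And>X. X \<in> Lambda J 0 q \<Longrightarrow> wedge X \<sigma> = 0"
  shows "\<sigma> = 0"
proof (rule ip_definite[OF Lambda_alt[OF assms(2)]])
  have "ip \<tau> \<sigma> = 0" if "\<tau> \<in> Lambda J 0 (n - q)" for \<tau> using that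
  proof (induction rule: Lambda0_induct)
    case (add \<omega> \<eta>s a)
    have "star (wedges \<eta>s) \<in> Lambda J 0 q" using star_wedges[of \<eta>s] add assms(1) by simp
    then have "ip (wedges \<eta>s) \<sigma> = 0" using star_wedges_wedge_zero[of \<eta>s \<sigma>] add assms by simp
    then show ?case using add by (simp add: ip_simps)
  qed (simp add: ip_simps)
  then show "ip \<sigma> \<sigma> = 0" using assms(2) .
qed

section \<open>The Hodge star on forms of type (n,q)\<close>

text \<open>The forms of type (n,0) are the multiples of \<open>\<eta>\<close>.\<close>

lemma Lambda_nq: "\<zeta> \<in> Lambda J n q \<Longrightarrow> \<exists>\<zeta>'\<in>Lambda J 0 q. \<zeta> = wedge eta \<zeta>'"
proof (induction rule: Lambda_induct)
  case zero then show ?case by (intro bexI[of _ 0]) (auto simp: Lambda_zero)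
next
  case (add \<omega> \<theta>s \<eta>s a)
  then obtain \<omega>' where w: "\<omega>' \<in> Lambda J 0 q" "\<omega> = wedge eta \<omega>'" by auto
  have "wedges \<theta>s \<in> Lambda J n 0" using Lambda_wedges[of \<theta>s J "[]"] add by simp
  then obtain c where "wedges \<theta>s = form_scale c eta" using Lambda_n0 by blast
  then have "\<omega> + form_scale a (wedges (\<theta>s @ \<eta>s)) = wedge eta (\<omega>' + form_scale (a * c) (wedges \<eta>s))"
    by (simp add: w wedges_append wedge_scale_left wedge_add_right wedge_scale_right)
  moreover have "\<omega>' + form_scale (a * c) (wedges \<eta>s) \<in> Lambda J 0 q"
    using w Lambda0_wedges[of \<eta>s J] add by (auto intro!: Lambda_add Lambda_scale)
  ultimately show ?case by blast
qed

text \<open>Covectors of different type are orthogonal.\<close>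

lemma dualct_cov10_Lambda0:
  assumes "type10 J \<theta>" "\<alpha> \<in> Lambda J 0 q" shows "dualct \<theta> \<alpha> = 0"
  using assms(2)
proof (induction rule: Lambda0_induct)
  case (add \<omega> \<eta>s a)
  have "dualct \<theta> (wedges \<eta>s) = 0" using add assms(1) by (intro dualct_wedges_zero) (auto intro: type_orthogonal)
  then show ?case using add by (simp add: dualct_ops)
qed (simp add: dualct_ops)

text \<open>Multiplication by a covector of the coframe of type (1,0) is an isometry up to the factor 2 on forms
  that are killed by the contraction with this covector, such as those of type (0,q).\<close>

lemma ip_eta_wedge:
  assumes "\<zeta> \<in> Lambda J 0 q" "\<alpha> \<in> Lambda J 0 q"
  shows "ip (wedge eta \<zeta>) (wedge eta \<alpha>) = 2 ^ n * ip \<zeta> \<alpha>"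
proof -
  have "ip (wedge (wedges cs) \<zeta>) (wedge (wedges cs) \<alpha>) = 2 ^ length cs * ip \<zeta> \<alpha> \<and>
      alt_slots linear (wedge (wedges cs) \<alpha>)"
    if "orth_covs cs" "\<forall>\<theta>\<in>set cs. type10 J \<theta>" for cs using that
  proof (induction cs)
    case Nil then show ?case using Lambda_alt[OF assms(2)] by simp
  next
    case (Cons c cs)
    let ?S = "wedge (wedges cs) \<alpha>"
    have c: "linear c" using Cons.prems by (auto simp: type10_def)
    have S: "alt_slots linear ?S" using Cons by simp
    have cS: "alt_slots linear (wedge (covector_form c) ?S)" using alt_slots_covector_wedge[OF slot_space_linear c S] .
    have "dualct c ?S = 0"
      using Cons.prems dualct_cov10_Lambda0[OF _ assms(2), of c] by (simp add: dualct_wedge dualct_wedges_zero)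
    then have "dualct c (wedge (covector_form c) ?S) = form_scale 2 ?S"
      using Cons.prems by (simp add: dualct_covector_wedge)
    then show ?case using Cons cS by (simp add: wedges_Cons wedge_assoc wedge_adjoint[OF c cS] ip_simps)
  qed
  from this[OF orth_eta] cov_types uframe(1) show ?thesis by (auto simp: eta_def)
qed

lemma eta_wedge_inj: "\<alpha> \<in> Lambda J 0 q \<Longrightarrow> wedge eta \<alpha> = 0 \<Longrightarrow> \<alpha> = 0"
  using ip_eta_wedge[of \<alpha> q \<alpha>] ip_definite[OF Lambda_alt, of \<alpha>] by (simp add: ip_simps)

definition vol_factor :: complex where "vol_factor = (SOME c. c \<noteq> 0 \<and> vol_form n J g = form_scale c (wedge eta nu))"

lemma vol_factor: "vol_factor \<noteq> 0" "vol_form n J g = form_scale vol_factor (wedge eta nu)"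
  using someI_ex[OF vol_form_eq] by (auto simp: vol_factor_def)

text \<open>Both existence and uniqueness of the form characterized by the Hodge star reduce to forms of type
  (0,*) by splitting off \<open>\<eta>\<close>.\<close>

lemma bar_star_eq:
  assumes \<alpha>: "\<alpha> \<in> Lambda J 0 q" and q: "q \<le> n"
  shows "bar_star n J g n q (wedge eta \<alpha>) = form_scale (sgn_tri q * 2 ^ n * vol_factor) (star \<alpha>)"
  unfolding bar_star_def
proof (rule the_equality)
  let ?\<sigma> = "form_scale (sgn_tri q * 2 ^ n * vol_factor) (star \<alpha>)"
  have *: "wedge \<zeta> ?\<sigma> = form_scale (ip \<zeta> (wedge eta \<alpha>)) (vol_form n J g)" if \<zeta>: "\<zeta> \<in> Lambda J n q" for \<zeta>
  proof -
    obtain \<zeta>' where z: "\<zeta>' \<in> Lambda J 0 q" "\<zeta> = wedge eta \<zeta>'" using Lambda_nq[OF \<zeta>] by auto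
    have "wedge \<zeta> ?\<sigma> = form_scale (sgn_tri q * 2 ^ n * vol_factor) (wedge eta (wedge \<zeta>' (star \<alpha>)))"
      by (simp add: z wedge_assoc wedge_scale_right)
    also have "\<dots> = form_scale ((sgn_tri q * sgn_tri q) * (2 ^ n * ip \<zeta>' \<alpha>) * vol_factor) (wedge eta nu)"
      unfolding wedge_star[OF \<alpha> q z(1)] by (simp add: wedge_scale_right mult_ac)
    also have "sgn_tri q * sgn_tri q = 1" by (simp flip: power_mult_distrib)
    also have "2 ^ n * ip \<zeta>' \<alpha> = ip \<zeta> (wedge eta \<alpha>)" using ip_eta_wedge[OF z(1) \<alpha>] z(2) by simp
    finally show ?thesis by (simp add: vol_factor(2))
  qed
  then show c: "?\<sigma> \<in> Lambda J (n - n) (n - q) \<and>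
      (\<forall>\<zeta>\<in>Lambda J n q. wedge \<zeta> ?\<sigma> = form_scale (ip \<zeta> (wedge eta \<alpha>)) (vol_form n J g))"
    using star_Lambda[OF \<alpha> q] by (auto intro!: Lambda_scale)
  fix \<sigma> assume \<sigma>: "\<sigma> \<in> Lambda J (n - n) (n - q) \<and>
      (\<forall>\<zeta>\<in>Lambda J n q. wedge \<zeta> \<sigma> = form_scale (ip \<zeta> (wedge eta \<alpha>)) (vol_form n J g))"
  have "\<sigma> - ?\<sigma> = 0"
  proof (rule wedge_nondegenerate[OF q])
    show L: "\<sigma> - ?\<sigma> \<in> Lambda J 0 (n - q)" using c \<sigma> by (auto intro!: Lambda_diff)
    fix X assume X: "X \<in> Lambda J 0 q"
    let ?Z = "wedge X (\<sigma> - ?\<sigma>)"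
    have "?Z \<in> Lambda J 0 n" using Lambda0_wedge[OF X L] q by simp
    moreover have "wedge eta ?Z = 0"
      using \<sigma> c Lambda_wedge_wedge[OF eta_Lambda X] by (simp add: wedge_diff_right flip: wedge_assoc)
    ultimately show "?Z = 0" by (rule eta_wedge_inj)
  qed
  then show "\<sigma> = ?\<sigma>" by simp
qed

text \<open>The factor common to all degrees. The constants \<open>\<epsilon>\<^sub>k\<close> are chosen such that, besides it, only a
  sign depending on the parity of the degree remains.\<close>

definition tau_factor :: complex where "tau_factor = \<i> ^ (n * (n - 1) + n) * 2 ^ n * vol_factor"

text \<open>With \<open>k = n + q\<close>, the exponent \<open>k(k - 1)\<close> is \<open>n(n - 1) + q(q - 1) + 2nq\<close>. The middle term cancels
  the sign of the star operator, and the last one gives \<open>(-1)\<^sup>n\<^sup>q\<close>.\<close>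

lemma tau_eq:
  assumes "\<alpha> \<in> Lambda J 0 q" "q \<le> n"
  shows "tau n J g n q (wedge eta \<alpha>) = form_scale (tau_factor * (-1) ^ (n * q)) (star \<alpha>)"
proof -
  have e: "(n + q) * (n + q - 1) = n * (n - 1) + q * (q - 1) + 2 * (n * q)"
    by (cases n; cases q) (auto simp: algebra_simps)
  have "even (q * (q - 1))" by (cases q) auto
  then have "q * (q - 1) = 2 * (q * (q - 1) div 2)" by (metis dvd_mult_div_cancel)
  then have i: "\<i> ^ (q * (q - 1)) = sgn_tri q" by (metis power_mult power2_i)
  have "\<i> ^ ((n + q) * (n + q - 1) + n) * (sgn_tri q * 2 ^ n * vol_factor) =
      (sgn_tri q * sgn_tri q) * (tau_factor * (-1) ^ (n * q))"
    unfolding e power_add i power_mult[of \<i> 2 "n * q"] by (simp add: tau_factor_def power_add mult_ac)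
  also have "sgn_tri q * sgn_tri q = 1" by (simp flip: power_mult_distrib)
  finally show ?thesis unfolding tau_def bar_star_eq[OF assms] by (simp add: Let_def)
qed

section \<open>The pairing defined by the star operator\<close>

text \<open>Both sides change in the same way when \<open>\<alpha>\<close> is multiplied by a covector, by the anticommutation of
  multiplication and contraction; for \<open>\<alpha> = 1\<close> both vanish, since \<open>\<theta> \<and> \<nu>\<close> has type (0,n+1).\<close>

lemma wedge_star_dualct:
  assumes \<theta>: "type01 J \<theta>" and \<alpha>: "\<alpha> \<in> Lambda J 0 q"
  shows "wedge (covector_form \<theta>) (star \<alpha>) = star (dualct \<theta> \<alpha>)"
proof -
  have "wedge (covector_form \<theta>) (star (wedges as)) = star (dualct \<theta> (wedges as))" if "\<forall>a\<in>set as. type01 J a" for as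
    using that
  proof (induction as)
    case Nil
    have "wedge (covector_form \<theta>) nu = 0" using Lambda_covector_wedge[OF nu_Lambda \<theta>] Lambda0_above by blast
    then show ?case by (simp add: star_unit dualct_ops star_ops)
  next
    case (Cons a as)
    let ?Y = "star (wedges as)"
    have l: "linear a" "linear \<theta>" using Cons.prems \<theta> by (auto simp: type01_linear)
    have "wedge (covector_form \<theta>) (dualct a ?Y) = form_scale (cip \<theta> a) ?Y - dualct a (wedge (covector_form \<theta>) ?Y)"
      by (simp add: dualct_covector_wedge)
    also have "wedge (covector_form \<theta>) ?Y = star (dualct \<theta> (wedges as))" using Cons by simp
    also have "cip \<theta> a = cnj (cip a \<theta>)" by (rule cip_cnj) (use l in auto)
    finally show ?case
      by (simp add: wedges_Cons star_covector_wedge l dualct_covector_wedge star_ops)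
  qed
  from \<alpha> this show ?thesis
    by (induction rule: Lambda0_induct) (auto simp: star_ops dualct_ops wedge_add_right wedge_scale_right)
qed

lemma ip_homog_orth:
  assumes "homog k \<alpha>" "homog l \<beta>" "k \<noteq> l" shows "ip \<alpha> \<beta> = 0"
proof -
  have "\<alpha> vs * cnj (\<beta> vs) = 0" for vs using assms by (cases "length vs = k") (auto simp: homog_def)
  then show ?thesis unfolding form_inner_onlists by (simp only: sum.neutral_const div_0)
qed

lemma ip_star_wedges:
  assumes "\<forall>a\<in>set as. type01 J a" shows "ip \<beta> (star (wedges as)) = ip (wedge (wedges (rev as)) \<beta>) nu"
  using assms
proof (induction as arbitrary: \<beta>)
  case (Cons a as)
  have l: "linear a" using Cons.prems by (auto simp: type01_linear)
  have "alt_slots linear (star (wedges as))"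
  proof (cases "length as \<le> n")
    case True then show ?thesis using star_wedges[of as] Cons.prems by (auto intro: Lambda_alt)
  next
    case False
    then have "wedges as = 0" using Lambda0_wedges[of as J] Cons.prems Lambda0_above[of "wedges as" "length as"] by simp
    then show ?thesis by (simp add: star_ops alt_slots_zero)
  qed
  from wedge_adjoint[OF l this, of \<beta>] Cons show ?case
    by (simp add: wedges_Cons star_covector_wedge[OF l] wedges_append wedge_assoc)
qed (simp add: star_unit)

text \<open>For products of covectors \<open>as\<close> and \<open>bs\<close> the two pairings are the hermitian products of \<open>\<nu>\<close>
  with the wedge products of the lists \<open>rev as @ bs\<close> and \<open>rev bs @ as\<close>. Each list is the reverse of the other one.\<close>

lemma star_pairing_symmetric:
  assumes "\<alpha> \<in> Lambda J 0 q" "\<beta> \<in> Lambda J 0 l"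
  shows "ip \<beta> (star \<alpha>) = sgn_tri n * ip \<alpha> (star \<beta>)"
proof -
  have *: "ip (wedges bs) (star (wedges as)) = sgn_tri n * ip (wedges as) (star (wedges bs))"
    if t: "\<forall>a\<in>set as. type01 J a" "\<forall>a\<in>set bs. type01 J a" for as bs
  proof -
    let ?cs = "rev bs @ as"
    have "ip (wedges bs) (star (wedges as)) = ip (wedges (rev as @ bs)) nu"
      using ip_star_wedges[OF t(1)] by (simp add: wedges_append)
    also have "rev as @ bs = rev ?cs" by simp
    also have "ip (wedges (rev ?cs)) nu = sgn_tri (length ?cs) * ip (wedges ?cs) nu"
      unfolding wedges_rev by (simp add: ip_simps)
    also have "\<dots> = sgn_tri n * ip (wedges ?cs) nu"
    proof (cases "length ?cs = n")
      case False
      then have "ip (wedges ?cs) nu = 0"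
        using ip_homog_orth[OF homog_wedges Lambda_homog[OF nu_Lambda], of ?cs] by simp
      then show ?thesis by simp
    qed simp
    also have "ip (wedges ?cs) nu = ip (wedges as) (star (wedges bs))"
      using ip_star_wedges[OF t(2)] by (simp add: wedges_append)
    finally show ?thesis .
  qed
  have 1: "ip (wedges bs) (star \<alpha>) = sgn_tri n * ip \<alpha> (star (wedges bs))"
    if bs: "\<forall>a\<in>set bs. type01 J a" for bs
    using assms(1)
  proof (induction rule: Lambda0_induct)
    case (add \<omega> \<eta>s a)
    show ?case unfolding ip_simps star_ops add.IH *[OF add.hyps(3) bs] complex_cnj_cnj
      by (simp only: distrib_left mult.left_commute)
  qed (simp add: ip_simps star_ops)
  show ?thesis using assms(2)
  proof (induction rule: Lambda0_induct)
    case (add \<omega> \<eta>s a)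
    show ?case unfolding ip_simps star_ops add.IH 1[OF add.hyps(3)] complex_cnj_cnj
      by (simp only: distrib_left mult.left_commute)
  qed (simp add: ip_simps star_ops)
qed

end

section \<open>Spinors and Clifford multiplication at a point\<close>

lemma fun_sum_apply: "(\<Sum>i\<in>S. f i) x = (\<Sum>i\<in>S. f i x)"
  by (induction S rule: infinite_finite_induct) (simp_all add: pointwise)

lemma deg_part_ops: "deg_part q (\<alpha> + \<beta>) = deg_part q \<alpha> + deg_part q \<beta>"
  "deg_part q (form_scale c \<alpha>) = form_scale c (deg_part q \<alpha>)" "deg_part q 0 = 0"
  by (auto simp: deg_part_def form_scale_def pointwise)

lemma spinors_zero: "0 \<in> spinors J P"
  by (simp add: spinors_def deg_part_ops Lambda_zero)

lemma spinors_add: "\<alpha> \<in> spinors J P \<Longrightarrow> \<beta> \<in> spinors J P \<Longrightarrow> \<alpha> + \<beta> \<in> spinors J P"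
  by (simp add: spinors_def deg_part_ops) (metis Lambda_add add_0)

lemma spinors_scale: "\<alpha> \<in> spinors J P \<Longrightarrow> form_scale c \<alpha> \<in> spinors J P"
  by (simp add: spinors_def deg_part_ops) (metis Lambda_scale form_scale_simps(3))

lemma spinors_sum: "(\<And>i. i \<in> S \<Longrightarrow> f i \<in> spinors J P) \<Longrightarrow> (\<Sum>i\<in>S. f i) \<in> spinors J P"
  by (induction S rule: infinite_finite_induct) (simp_all add: spinors_zero spinors_add)

lemma Lambda_spinors: "\<alpha> \<in> Lambda J 0 q \<Longrightarrow> P q \<Longrightarrow> \<alpha> \<in> spinors J P"
  using homog_deg_part[OF Lambda_homog[of \<alpha> J 0 q]] by (auto simp: spinors_def Lambda_zero)

context hermitian_space
begin

lemma spinors_decompose: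
  assumes "\<alpha> \<in> spinors J P" shows "\<alpha> = (\<Sum>q\<le>n. deg_part q \<alpha>)"
proof
  fix vs
  have "(\<Sum>q\<le>n. deg_part q \<alpha>) vs = (\<Sum>q\<le>n. if q = length vs then \<alpha> vs else 0)"
    unfolding fun_sum_apply by (intro sum.cong) (auto simp: deg_part_def)
  also have "\<dots> = \<alpha> vs"
  proof (cases "length vs \<le> n")
    case False
    have "deg_part (length vs) \<alpha> = 0"
      using assms False Lambda0_above[of "deg_part (length vs) \<alpha>" "length vs"] unfolding spinors_def by (metis (mono_tags, lifting) mem_Collect_eq not_le)
    from fun_cong[OF this, of vs] have "\<alpha> vs = 0" by (simp add: deg_part_def pointwise)
    then show ?thesis by simp
  qed simp
  finally show "\<alpha> vs = (\<Sum>q\<le>n. deg_part q \<alpha>) vs" by simp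
qed

text \<open>Spinors are finite sums of forms of type (0,q), since their components of degree above \<open>n\<close> vanish.
  Statements that are additive in a spinor can therefore be checked on forms of type (0,q).\<close>

lemma spinors_linear_induct [consumes 1, case_names zero add Lambda]:
  assumes "\<alpha> \<in> spinors J P" "R 0" "\<And>\<alpha> \<beta>. R \<alpha> \<Longrightarrow> R \<beta> \<Longrightarrow> R (\<alpha> + \<beta>)"
    "\<And>q \<alpha>. q \<le> n \<Longrightarrow> P q \<Longrightarrow> \<alpha> \<in> Lambda J 0 q \<Longrightarrow> R \<alpha>"
  shows "R \<alpha>"
proof -
  have d: "R (deg_part q \<alpha>)" if "q \<le> n" for q
  proof (cases "P q")
    case True
    then have "deg_part q \<alpha> \<in> Lambda J 0 q" using assms(1) by (simp add: spinors_def)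
    then show ?thesis using assms(4) True that by blast
  next
    case False
    then have "deg_part q \<alpha> = 0" using assms(1) by (simp add: spinors_def)
    then show ?thesis using assms(2) by simp
  qed
  have "R (\<Sum>q\<in>S. deg_part q \<alpha>)" if "S \<subseteq> {..n}" for S
    using finite_subset[OF that finite_atMost] that
  proof (induction S rule: finite_induct)
    case empty then show ?case using assms(2) by simp
  next
    case (insert q S) then show ?case using assms(3)[OF d[of q]] by simp
  qed
  from this[of "{..n}"] show ?thesis using spinors_decompose[OF assms(1)] by simp
qed

lemma spinors_alt: "\<alpha> \<in> spinors J P \<Longrightarrow> alt_slots linear \<alpha>"
  by (rule spinors_linear_induct[where R = "alt_slots linear"])
    (simp_all add: alt_slots_zero alt_slots_add Lambda_alt)

lemma spinors_star:
  assumes "\<alpha> \<in> spinors J P" "\<And>q. q \<le> n \<Longrightarrow> P q \<Longrightarrow> P' (n - q)" shows "star \<alpha> \<in> spinors J P'"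
proof (rule spinors_linear_induct[OF assms(1), where R = "\<lambda>\<alpha>. star \<alpha> \<in> spinors J P'"])
  fix q \<alpha> assume "q \<le> n" "P q" "\<alpha> \<in> Lambda J 0 q"
  then show "star \<alpha> \<in> spinors J P'" using star_Lambda assms(2) Lambda_spinors by blast
qed (simp_all add: star_ops spinors_zero spinors_add)

lemma part_types:
  assumes "linear \<gamma>" shows "type01 J (part01 J \<gamma>)" "linear (part01 J \<gamma>)" "(\<lambda>v. cnj (part01 J \<gamma> v)) = part10 J \<gamma>"
proof -
  show l: "linear (part01 J \<gamma>)"
    by (rule linearI) (simp_all add: part01_def J_simps linear_add[OF assms] linear_cmul[OF assms] scaleR_conv_of_real[where 'a = complex] field_simps)
  show "type01 J (part01 J \<gamma>)"
    unfolding type01_def using l by (auto simp: part01_def linear_neg[OF assms] field_simps)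
  show "(\<lambda>v. cnj (part01 J \<gamma> v)) = part10 J \<gamma>" by (auto simp: part01_def part10_def)
qed

lemma clifford_eq:
  assumes "linear \<gamma>"
  shows "clifford J g \<gamma> \<alpha> = form_scale (complex_of_real (sqrt 2))
     (wedge (covector_form (part01 J \<gamma>)) \<alpha> - dualct (part01 J \<gamma>) \<alpha>)"
  unfolding dualct_def part_types(3)[OF assms] by (rule ext) (simp add: clifford_def form_scale_def pointwise)

lemma clifford_ops:
  "clifford J g \<gamma> (\<alpha> + \<beta>) = clifford J g \<gamma> \<alpha> + clifford J g \<gamma> \<beta>"
  "clifford J g \<gamma> (form_scale c \<alpha>) = form_scale c (clifford J g \<gamma> \<alpha>)" "clifford J g \<gamma> 0 = 0"
proof -
  have *: "clifford J g \<gamma> \<alpha> = form_scale (complex_of_real (sqrt 2))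
     (wedge (covector_form (part01 J \<gamma>)) \<alpha> - contract (sharp g (part10 J \<gamma>)) \<alpha>)" for \<alpha>
    by (rule ext) (simp add: clifford_def form_scale_def pointwise)
  show "clifford J g \<gamma> (\<alpha> + \<beta>) = clifford J g \<gamma> \<alpha> + clifford J g \<gamma> \<beta>"
    unfolding * wedge_add_right contract_add form_scale_diff form_scale_add by simp
  show "clifford J g \<gamma> (form_scale c \<alpha>) = form_scale c (clifford J g \<gamma> \<alpha>)"
    unfolding * wedge_scale_right contract_scale form_scale_diff form_scale_simps by (simp only: mult.commute)
  show "clifford J g \<gamma> 0 = 0" unfolding * by simp
qed

lemma clifford_spinors:
  assumes "linear \<gamma>" "\<alpha> \<in> spinors J P" "\<And>q. P q \<Longrightarrow> P' (Suc q)" "\<And>q. P (Suc q) \<Longrightarrow> P' q"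
  shows "clifford J g \<gamma> \<alpha> \<in> spinors J P'"
proof (rule spinors_linear_induct[OF assms(2), where R = "\<lambda>\<alpha>. clifford J g \<gamma> \<alpha> \<in> spinors J P'"])
  fix q \<alpha> assume q: "P q" and \<alpha>: "\<alpha> \<in> Lambda J 0 q"
  let ?\<theta> = "part01 J \<gamma>"
  have 1: "wedge (covector_form ?\<theta>) \<alpha> \<in> spinors J P'"
    using Lambda_covector_wedge[OF \<alpha> part_types(1)[OF assms(1)]] assms(3)[OF q] by (rule Lambda_spinors)
  have 2: "dualct ?\<theta> \<alpha> \<in> spinors J P'"
  proof (cases q)
    case 0 then show ?thesis using \<alpha> by (simp add: dualct_def Lambda_contract_0 spinors_zero)
  next
    case (Suc q') then show ?thesis using \<alpha> q assms(4) by (auto simp: dualct_def intro: Lambda_spinors Lambda_contract)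
  qed
  have "wedge (covector_form ?\<theta>) \<alpha> - dualct ?\<theta> \<alpha> = wedge (covector_form ?\<theta>) \<alpha> + form_scale (-1) (dualct ?\<theta> \<alpha>)"
    by (simp add: form_scale_minus1)
  then show "clifford J g \<gamma> \<alpha> \<in> spinors J P'"
    unfolding clifford_eq[OF assms(1)] using 1 2 by (simp only: spinors_add spinors_scale)
qed (simp_all add: clifford_ops spinors_zero spinors_add)

text \<open>Multiplication by a covector and the contraction that occurs in \<open>c(\<gamma>)\<close> are adjoint to each other.\<close>

lemma clifford_skew:
  assumes "linear \<gamma>" "alt_slots linear \<alpha>" "alt_slots linear \<beta>"
  shows "ip (clifford J g \<gamma> \<alpha>) \<beta> = - ip \<alpha> (clifford J g \<gamma> \<beta>)"
  using part_types(2)[OF assms(1)] assms(2,3)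
  by (simp add: clifford_eq[OF assms(1)] ip_simps wedge_adjoint ip_dualct_left algebra_simps)

lemma star_pairing_symmetric_spinors:
  assumes "\<alpha> \<in> spinors J P" "\<beta> \<in> spinors J P'"
  shows "ip \<beta> (star \<alpha>) = sgn_tri n * ip \<alpha> (star \<beta>)"
proof (rule spinors_linear_induct[OF assms(1), where R = "\<lambda>\<alpha>. ip \<beta> (star \<alpha>) = sgn_tri n * ip \<alpha> (star \<beta>)"])
  fix q \<alpha> assume \<alpha>: "\<alpha> \<in> Lambda J 0 q"
  show "ip \<beta> (star \<alpha>) = sgn_tri n * ip \<alpha> (star \<beta>)"
    by (rule spinors_linear_induct[OF assms(2), where R = "\<lambda>\<beta>. ip \<beta> (star \<alpha>) = sgn_tri n * ip \<alpha> (star \<beta>)"])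
      (simp_all only: ip_simps star_ops mult_zero_right distrib_left star_pairing_symmetric[OF \<alpha>])
qed (simp_all only: ip_simps star_ops mult_zero_right distrib_left)

lemma wedge_star_dualct_spinors:
  assumes \<theta>: "type01 J \<theta>" and \<alpha>: "\<alpha> \<in> spinors J P"
  shows "wedge (covector_form \<theta>) (star \<alpha>) = star (dualct \<theta> \<alpha>)"
  by (rule spinors_linear_induct[OF \<alpha>, where R = "\<lambda>\<alpha>. wedge (covector_form \<theta>) (star \<alpha>) = star (dualct \<theta> \<alpha>)"])
    (simp_all only: star_ops dualct_ops wedge_zero wedge_add_right wedge_star_dualct[OF \<theta>])

text \<open>The star operator exchanges multiplication and contraction by a covector, so it anticommutes with
  \<open>c(\<gamma>)\<close>, which is also skew-adjoint. The two signs cancel when \<open>c(\<gamma>)\<close> is moved from one argument of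
  the pairing to the other, and the symmetry of the pairing then gives the claim.\<close>

theorem clifford_star_pairing:
  assumes \<gamma>: "linear \<gamma>" and \<alpha>: "\<alpha> \<in> spinors J P" and \<beta>: "\<beta> \<in> spinors J P'"
  shows "ip (clifford J g \<gamma> \<beta>) (star \<alpha>) = sgn_tri n * ip (clifford J g \<gamma> \<alpha>) (star \<beta>)"
proof -
  let ?\<theta> = "part01 J \<gamma>" let ?c = "clifford J g \<gamma>"
  have "star \<alpha> \<in> spinors J (\<lambda>_. True)" using \<alpha> by (rule spinors_star) simp
  then have "ip (?c \<beta>) (star \<alpha>) = - ip \<beta> (?c (star \<alpha>))"
    by (intro clifford_skew \<gamma> spinors_alt[OF \<beta>] spinors_alt)
  also have "?c (star \<alpha>) = form_scale (complex_of_real (sqrt 2)) (star (dualct ?\<theta> \<alpha>) - star (wedge (covector_form ?\<theta>) \<alpha>))"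
    unfolding clifford_eq[OF \<gamma>] star_covector_wedge[OF part_types(2)[OF \<gamma>]] wedge_star_dualct_spinors[OF part_types(1)[OF \<gamma>] \<alpha>] ..
  also have "\<dots> = - star (?c \<alpha>)"
    unfolding clifford_eq[OF \<gamma>] star_ops by (simp add: form_scale_diff)
  finally have "ip (?c \<beta>) (star \<alpha>) = ip \<beta> (star (?c \<alpha>))" by (simp add: ip_simps)
  also have "?c \<alpha> \<in> spinors J (\<lambda>_. True)" using \<gamma> \<alpha> by (rule clifford_spinors) simp_all
  then have "ip \<beta> (star (?c \<alpha>)) = sgn_tri n * ip (?c \<alpha>) (star \<beta>)" by (rule star_pairing_symmetric_spinors[OF _ \<beta>])
  finally show ?thesis .
qed

end

section \<open>Spinors with values in a hermitian space\<close>

locale hermitian_metric =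
  fixes h :: "complex^'r::finite \<Rightarrow> complex^'r \<Rightarrow> complex"
  assumes h_add: "h (u + v) w = h u w + h v w" and h_scale: "h (a *s u) w = a * h u w"
    and h_sym: "h v u = cnj (h u v)" and h_pos: "v \<noteq> 0 \<Longrightarrow> Re (h v v) > 0"
begin

lemma h_simps: "h (u + v) w = h u w + h v w" "h w (u + v) = h w u + h w v"
  "h (a *s u) w = a * h u w" "h w (a *s u) = cnj a * h w u" "h 0 w = 0" "h w 0 = 0"
  "h (u - v) w = h u w - h v w" "h w (u - v) = h w u - h w v" "h (- u) w = - h u w" "h w (- u) = - h w u"
proof -
  show 1: "h (u + v) w = h u w + h v w" "h (a *s u) w = a * h u w" for u v w a by (rule h_add, rule h_scale)
  show 2: "h w (u + v) = h w u + h w v" "h w (a *s u) = cnj a * h w u" for u v w a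
    unfolding h_sym[of w] by (simp_all add: 1)
  have m: "- u = (-1) *s u" for u :: "complex^'r" by (simp add: vec_eq_iff)
  show 3: "h (- u) w = - h u w" "h w (- u) = - h w u" for u w
    using 1(2)[of "-1" u w] 2(2)[of w "-1" u] by (simp_all add: m[symmetric])
  show "h 0 w = 0" "h w 0 = 0" using 1(2)[of 0 0 w] 2(2)[of w 0 0] by simp_all
  show "h (u - v) w = h u w - h v w" "h w (u - v) = h w u - h w v"
    using 1(1)[of u "- v" w] 2(1)[of w u "- v"] 3 by simp_all
qed

lemma h_sum: "h (\<Sum>i\<in>S. f i) v = (\<Sum>i\<in>S. h (f i) v)" "h v (\<Sum>i\<in>S. f i) = (\<Sum>i\<in>S. h v (f i))"
  by (induction S rule: infinite_finite_induct) (simp_all add: h_simps)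

lemma h_nondegenerate: "(\<And>w. h u w = h v w) \<Longrightarrow> u = v"
  using h_pos[of "u - v"] by (force simp: h_simps)

lemma vec_expand: "v = (\<Sum>i\<in>UNIV. v $ i *s axis i (1::complex))"
  by (simp add: vec_eq_iff axis_def if_distrib[of "\<lambda>x. _ * x"] cong: if_cong)

text \<open>The vector of \<open>E\<close> that represents the \<open>i\<close>-th coordinate through the metric.\<close>

definition hdual :: "'r \<Rightarrow> complex^'r" where
  "hdual i = (SOME \<xi>. \<forall>\<zeta>. h \<zeta> \<xi> = \<zeta> $ i)"

text \<open>The map from \<open>E\<close> to its conjugate dual is injective because the metric is definite, hence surjective.\<close>

lemma hdual: "h \<zeta> (hdual i) = \<zeta> $ i"
proof -
  let ?F = "\<lambda>\<xi>. \<chi> k. h \<xi> (axis k 1)"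
  have sc: "r *\<^sub>R x = complex_of_real r *s x" for r and x :: "complex^'r"
    by (simp add: vec_eq_iff scaleR_conv_of_real[where 'a = complex])
  have lin: "linear ?F"
    by (rule linearI) (simp_all add: vec_eq_iff h_simps sc)
  have "inj ?F"
  proof (rule injI)
    fix x y assume "?F x = ?F y"
    then have "?F x $ k = ?F y $ k" for k by simp
    then have k: "h x (axis k 1) = h y (axis k 1)" for k by simp
    have e: "h z w = (\<Sum>k\<in>UNIV. cnj (w $ k) * h z (axis k 1))" for z w
      by (subst vec_expand[of w]) (simp add: h_sum h_simps)
    show "x = y"
    proof (rule h_nondegenerate)
      fix w show "h x w = h y w" unfolding e[of x w] e[of y w] k ..
    qed
  qed
  then have "surj ?F" using lin by (simp add: linear_injective_imp_surjective)
  then obtain \<xi> where "?F \<xi> = axis i 1" using surjD[of ?F "axis i 1"] by auto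
  then have "?F \<xi> $ k = axis i 1 $ k" for k by simp
  then have \<xi>: "h \<xi> (axis k 1) = (if k = i then 1 else 0)" for k by (simp add: axis_def)
  have "h \<zeta> \<xi> = \<zeta> $ i" for \<zeta>
  proof -
    have "h \<xi> \<zeta> = (\<Sum>k\<in>UNIV. cnj (\<zeta> $ k) * h \<xi> (axis k 1))"
      by (subst vec_expand[of \<zeta>]) (simp add: h_sum h_simps)
    then have "h \<xi> \<zeta> = cnj (\<zeta> $ i)" by (simp add: \<xi> if_distrib[of "\<lambda>x. _ * x"] cong: if_cong)
    then show ?thesis using h_sym[of \<zeta> \<xi>] by simp
  qed
  then have "\<exists>\<xi>. \<forall>\<zeta>. h \<zeta> \<xi> = \<zeta> $ i" by blast
  from someI_ex[OF this] show ?thesis by (simp add: hdual_def)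
qed

end

abbreviation coord :: "('m, complex^'r) form \<Rightarrow> 'r::finite \<Rightarrow> ('m::finite, complex) form" where
  "coord \<alpha> i \<equiv> (\<lambda>vs. \<alpha> vs $ i)"

lemma coord_ops: "coord (\<alpha> + \<beta>) i = coord \<alpha> i + coord \<beta> i" "coord (- \<alpha>) i = form_scale (-1) (coord \<alpha> i)"
  "coord (\<alpha> - \<beta>) i = coord \<alpha> i + form_scale (-1) (coord \<beta> i)" "coord 0 i = 0"
  "coord (formE_scale c \<alpha>) i = form_scale c (coord \<alpha> i)"
  by (auto simp: pointwise form_scale_def formE_scale_def)

lemma form_ext_coord: "(\<And>i. coord \<alpha> i = coord \<beta> i) \<Longrightarrow> \<alpha> = \<beta>"
  by (rule ext) (simp add: vec_eq_iff fun_eq_iff)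

lemma tensor_Id_coord: "coord (tensor_Id T \<alpha>) i = T (coord \<alpha> i)"
  by (simp add: tensor_Id_def)

lemma spinorsE_iff: "\<alpha> \<in> spinorsE J P \<longleftrightarrow> (\<forall>i. coord \<alpha> i \<in> spinors J P)"
  by (simp add: spinorsE_def)

lemma spinorsE_ops: "\<alpha> \<in> spinorsE J P \<Longrightarrow> \<beta> \<in> spinorsE J P \<Longrightarrow> \<alpha> + \<beta> \<in> spinorsE J P"
  "\<alpha> \<in> spinorsE J P \<Longrightarrow> - \<alpha> \<in> spinorsE J P" "\<alpha> \<in> spinorsE J P \<Longrightarrow> \<beta> \<in> spinorsE J P \<Longrightarrow> \<alpha> - \<beta> \<in> spinorsE J P"
  "0 \<in> spinorsE J P" "\<alpha> \<in> spinorsE J P \<Longrightarrow> formE_scale c \<alpha> \<in> spinorsE J P"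
  by (simp_all add: spinorsE_iff coord_ops spinors_add spinors_scale spinors_zero)

locale spinor_space = hermitian_space J g n + hermitian_metric h
  for J :: "real^'m::finite \<Rightarrow> real^'m" and g :: "real^'m \<Rightarrow> real^'m \<Rightarrow> real" and n :: nat
    and h :: "complex^'r::finite \<Rightarrow> complex^'r \<Rightarrow> complex"
begin

abbreviation ipE :: "('m, complex^'r) form \<Rightarrow> ('m, complex^'r) form \<Rightarrow> complex" where
  "ipE \<equiv> form_inner g h"

abbreviation cE :: "(real^'m \<Rightarrow> real) \<Rightarrow> ('m, complex^'r) form \<Rightarrow> ('m, complex^'r) form" where
  "cE \<gamma> \<equiv> tensor_Id (clifford J g \<gamma>)"

lemma ipE_expand: "ipE \<alpha> \<beta> = (\<Sum>i\<in>UNIV. \<Sum>j\<in>UNIV. h (axis i 1) (axis j 1) * ip (coord \<alpha> i) (coord \<beta> j))"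
proof -
  have hh: "h u v = (\<Sum>i\<in>UNIV. \<Sum>j\<in>UNIV. h (axis i 1) (axis j 1) * (u $ i * cnj (v $ j)))" for u v
  proof -
    have "h u v = (\<Sum>i\<in>UNIV. u $ i * h (axis i 1) v)"
      by (subst vec_expand[of u]) (simp add: h_sum h_simps)
    also have "\<dots> = (\<Sum>i\<in>UNIV. u $ i * (\<Sum>j\<in>UNIV. cnj (v $ j) * h (axis i 1) (axis j 1)))"
      by (subst vec_expand[of v]) (simp add: h_sum h_simps)
    finally show ?thesis by (simp add: sum_distrib_left mult_ac)
  qed
  have "ipE \<alpha> \<beta> = (\<Sum>k\<le>CARD('m). \<Sum>vs\<in>onlists k. \<Sum>i\<in>UNIV. \<Sum>j\<in>UNIV.
      h (axis i 1) (axis j 1) * (\<alpha> vs $ i * cnj (\<beta> vs $ j)) / fact k)"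
    unfolding form_inner_onlists hh[of "\<alpha> _"] sum_divide_distrib ..
  also have "\<dots> = (\<Sum>i\<in>UNIV. \<Sum>j\<in>UNIV. \<Sum>k\<le>CARD('m). \<Sum>vs\<in>onlists k.
      h (axis i 1) (axis j 1) * (\<alpha> vs $ i * cnj (\<beta> vs $ j)) / fact k)"
    unfolding sum.swap[of _ UNIV "onlists _"] sum.swap[of _ UNIV "{.._}"] ..
  also have "\<dots> = (\<Sum>i\<in>UNIV. \<Sum>j\<in>UNIV. h (axis i 1) (axis j 1) * ip (coord \<alpha> i) (coord \<beta> j))"
    unfolding form_inner_onlists sum_distrib_left sum_divide_distrib times_divide_eq_right ..
  finally show ?thesis .
qed

lemma ipE_simps: "ipE (\<alpha> + \<beta>) \<gamma> = ipE \<alpha> \<gamma> + ipE \<beta> \<gamma>" "ipE \<alpha> (\<beta> + \<gamma>) = ipE \<alpha> \<beta> + ipE \<alpha> \<gamma>"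
  "ipE (- \<alpha>) \<gamma> = - ipE \<alpha> \<gamma>" "ipE \<alpha> (- \<gamma>) = - ipE \<alpha> \<gamma>"
  "ipE (\<alpha> - \<beta>) \<gamma> = ipE \<alpha> \<gamma> - ipE \<beta> \<gamma>" "ipE \<alpha> (\<beta> - \<gamma>) = ipE \<alpha> \<beta> - ipE \<alpha> \<gamma>"
  "ipE (formE_scale c \<alpha>) \<gamma> = c * ipE \<alpha> \<gamma>" "ipE \<alpha> (formE_scale c \<gamma>) = cnj c * ipE \<alpha> \<gamma>"
proof -
  show 1: "ipE (\<alpha> + \<beta>) \<gamma> = ipE \<alpha> \<gamma> + ipE \<beta> \<gamma>" "ipE \<alpha> (\<beta> + \<gamma>) = ipE \<alpha> \<beta> + ipE \<alpha> \<gamma>" for \<alpha> \<beta> \<gamma>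
    by (simp_all add: ipE_expand coord_ops ip_simps distrib_left sum.distrib)
  show 2: "ipE (- \<alpha>) \<gamma> = - ipE \<alpha> \<gamma>" "ipE \<alpha> (- \<gamma>) = - ipE \<alpha> \<gamma>" for \<alpha> \<gamma>
    by (simp_all add: ipE_expand coord_ops ip_simps sum_negf)
  show "ipE (\<alpha> - \<beta>) \<gamma> = ipE \<alpha> \<gamma> - ipE \<beta> \<gamma>" "ipE \<alpha> (\<beta> - \<gamma>) = ipE \<alpha> \<beta> - ipE \<alpha> \<gamma>"
    using 1(1)[of \<alpha> "- \<beta>" \<gamma>] 1(2)[of \<alpha> \<beta> "- \<gamma>"] 2 by simp_all
  show "ipE (formE_scale c \<alpha>) \<gamma> = c * ipE \<alpha> \<gamma>" "ipE \<alpha> (formE_scale c \<gamma>) = cnj c * ipE \<alpha> \<gamma>"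
    by (simp_all add: ipE_expand coord_ops ip_simps sum_distrib_left mult.left_commute)
qed

lemma ipE_cnj: "ipE \<beta> \<alpha> = cnj (ipE \<alpha> \<beta>)"
  by (simp add: form_inner_onlists h_sym[of "\<beta> _" "\<alpha> _"])

lemma ipE_definite:
  assumes "\<alpha> \<in> spinorsE J P" shows "Re (ipE \<alpha> \<alpha>) \<ge> 0" "Re (ipE \<alpha> \<alpha>) = 0 \<Longrightarrow> \<alpha> = 0"
  using form_inner_definite[where h = h, OF h_pos h_simps(5), of \<alpha>] spinors_alt assms by (auto simp: spinorsE_iff)

lemma cE_spinorsE:
  assumes "linear \<gamma>" shows "\<alpha> \<in> spinorsE J even \<Longrightarrow> cE \<gamma> \<alpha> \<in> spinorsE J odd"
    "\<alpha> \<in> spinorsE J odd \<Longrightarrow> cE \<gamma> \<alpha> \<in> spinorsE J even"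
  using clifford_spinors[OF assms, of _ even odd] clifford_spinors[OF assms, of _ odd even]
  by (simp_all add: spinorsE_iff tensor_Id_coord)

lemma cE_skew:
  assumes "linear \<gamma>" "\<alpha> \<in> spinorsE J P" "\<beta> \<in> spinorsE J P'"
  shows "ipE (cE \<gamma> \<alpha>) \<beta> = - ipE \<alpha> (cE \<gamma> \<beta>)"
proof -
  have "alt_slots linear (coord \<alpha> i)" "alt_slots linear (coord \<beta> i)" for i
    using assms(2,3) spinors_alt unfolding spinorsE_iff by blast+
  then show ?thesis by (simp add: ipE_expand tensor_Id_coord clifford_skew[OF assms(1)] sum_negf)
qed

text \<open>The coordinates of a vector of \<open>E\<close> provide one decomposition of \<open>\<omega>\<close> into products. The result does
  not depend on the decomposition because its product with \<open>\<zeta>\<close> is \<open>\<tau>\<close> applied to the form \<open>\<omega>(\<cdot>, \<zeta>)\<close>.\<close>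

lemma tau_E_eq:
  assumes p: "p \<le> n" and \<beta>: "\<And>i. \<beta> i \<in> Lambda J 0 p"
    and \<omega>: "\<omega> = (\<lambda>vs \<zeta>. \<Sum>i\<in>UNIV. \<zeta> $ i * wedge eta (\<beta> i) vs)"
  shows "tau_E n J g h n p \<omega> = (\<lambda>vs. \<Sum>i\<in>UNIV. (tau_factor * (-1) ^ (n * p) * star (\<beta> i) vs) *s hdual i)"
    (is "_ = ?\<psi>")
  unfolding tau_E_def
proof (rule the_equality)
  let ?c = "tau_factor * (-1) ^ (n * p)"
  obtain e :: "nat \<Rightarrow> 'r" where e: "bij_betw e {..<CARD('r)} UNIV"
    using ex_bij_betw_nat_finite[of "UNIV :: 'r set"] by (auto simp: atLeast0LessThan)
  let ?\<alpha> = "\<lambda>j. wedge eta (\<beta> (e j))" let ?\<xi> = "\<lambda>j. hdual (e j)"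
  have c1: "\<forall>j<CARD('r). ?\<alpha> j \<in> Lambda J n p" using Lambda_wedge_wedge[OF eta_Lambda \<beta>] by blast
  have c2: "\<omega> = (\<lambda>vs \<zeta>. \<Sum>j<CARD('r). ?\<alpha> j vs * h \<zeta> (?\<xi> j))"
    unfolding \<omega> hdual using sum.reindex_bij_betw[OF e, of "\<lambda>i. _ $ i * wedge eta (\<beta> i) _"] by (simp add: mult.commute)
  have c3: "?\<psi> = (\<Sum>j<CARD('r). pure_tensor (tau n J g n p (?\<alpha> j)) (?\<xi> j))"
  proof
    fix vs
    have "(\<Sum>j<CARD('r). pure_tensor (tau n J g n p (?\<alpha> j)) (?\<xi> j)) vs =
        (\<Sum>j<CARD('r). (?c * star (\<beta> (e j)) vs) *s hdual (e j))"
      unfolding fun_sum_apply pure_tensor_def tau_eq[OF \<beta> p] by (simp add: form_scale_def)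
    also have "\<dots> = ?\<psi> vs"
      using sum.reindex_bij_betw[OF e, of "\<lambda>i. (?c * star (\<beta> i) vs) *s hdual i"] .
    finally show "?\<psi> vs = (\<Sum>j<CARD('r). pure_tensor (tau n J g n p (?\<alpha> j)) (?\<xi> j)) vs" by simp
  qed
  show "\<exists>N::nat. \<exists>\<alpha> \<xi>. (\<forall>j<N. \<alpha> j \<in> Lambda J n p) \<and> \<omega> = (\<lambda>vs \<zeta>. \<Sum>j<N. \<alpha> j vs * h \<zeta> (\<xi> j)) \<and>
      ?\<psi> = (\<Sum>j<N. pure_tensor (tau n J g n p (\<alpha> j)) (\<xi> j))"
    by (rule exI[of _ "CARD('r)"], rule exI[of _ ?\<alpha>], rule exI[of _ ?\<xi>]) (intro conjI c1 c2 c3)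
  fix \<psi>
  assume "\<exists>N::nat. \<exists>\<alpha> \<xi>. (\<forall>j<N. \<alpha> j \<in> Lambda J n p) \<and> \<omega> = (\<lambda>vs \<zeta>. \<Sum>j<N. \<alpha> j vs * h \<zeta> (\<xi> j)) \<and>
      \<psi> = (\<Sum>j<N. pure_tensor (tau n J g n p (\<alpha> j)) (\<xi> j))"
  then obtain N :: nat and \<alpha> \<xi> where \<alpha>: "\<forall>j<N. \<alpha> j \<in> Lambda J n p"
    and \<omega>': "\<omega> = (\<lambda>vs \<zeta>. \<Sum>j<N. \<alpha> j vs * h \<zeta> (\<xi> j))"
    and \<psi>: "\<psi> = (\<Sum>j<N. pure_tensor (tau n J g n p (\<alpha> j)) (\<xi> j))" by blast
  have "\<exists>a. \<forall>j<N. a j \<in> Lambda J 0 p \<and> \<alpha> j = wedge eta (a j)"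
  proof -
    have "\<forall>j. \<exists>b. j < N \<longrightarrow> b \<in> Lambda J 0 p \<and> \<alpha> j = wedge eta b" using \<alpha> Lambda_nq by blast
    from choice[OF this] show ?thesis by blast
  qed
  then obtain a where a: "\<And>j. j < N \<Longrightarrow> a j \<in> Lambda J 0 p" "\<And>j. j < N \<Longrightarrow> \<alpha> j = wedge eta (a j)" by blast
  show "\<psi> = ?\<psi>"
  proof
    fix vs show "\<psi> vs = ?\<psi> vs"
    proof (rule h_nondegenerate)
      fix \<zeta>
      \<comment> \<open>the forms of type (0,p) that become \<open>\<omega>(\<cdot>, \<zeta>)\<close> after multiplication by \<open>\<eta>\<close>, from the two decompositions\<close>
      define X where "X = (\<Sum>j<N. form_scale (h \<zeta> (\<xi> j)) (a j))"
      define Y where "Y = (\<Sum>i\<in>UNIV. form_scale (\<zeta> $ i) (\<beta> i))"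
      have wsum: "wedge eta (\<Sum>i\<in>S. f i) = (\<Sum>i\<in>S. wedge eta (f i))" for f :: "'z \<Rightarrow> ('m, complex) form" and S
        by (induction S rule: infinite_finite_induct) (simp_all add: wedge_add_right)
      have L: "X \<in> Lambda J 0 p" "Y \<in> Lambda J 0 p"
        unfolding X_def Y_def using a(1) \<beta> by (auto intro!: Lambda_sum Lambda_scale)
      have "wedge eta X us = \<omega> us \<zeta>" for us
        unfolding X_def wsum fun_sum_apply \<omega>' wedge_scale_right
        by (rule sum.cong) (simp_all add: a(2) form_scale_def)
      moreover have "wedge eta Y us = \<omega> us \<zeta>" for us
        unfolding Y_def wsum fun_sum_apply \<omega> wedge_scale_right
        by (rule sum.cong) (simp_all add: form_scale_def)
      ultimately have "wedge eta (X - Y) = 0" by (auto simp: wedge_diff_right pointwise)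
      then have XY: "X = Y" using eta_wedge_inj[of "X - Y" p] Lambda_diff[OF L] by simp
      have "h (\<psi> vs) \<zeta> = (\<Sum>j<N. ?c * (star (a j) vs * h (\<xi> j) \<zeta>))"
        unfolding \<psi> fun_sum_apply h_sum pure_tensor_def h_simps
        by (rule sum.cong) (simp_all add: a tau_eq[OF a(1) p] form_scale_def)
      also have "\<dots> = ?c * star X vs"
        unfolding X_def star_sum star_ops fun_sum_apply sum_distrib_left h_sym[of \<zeta>] complex_cnj_cnj
        by (rule sum.cong) (simp_all add: form_scale_def)
      also have "\<dots> = ?c * star Y vs" by (simp add: XY)
      also have "\<dots> = (\<Sum>i\<in>UNIV. ?c * (star (\<beta> i) vs * h (hdual i) \<zeta>))"
        unfolding Y_def star_sum star_ops fun_sum_apply sum_distrib_left h_sym[of "hdual _" \<zeta>] hdual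
        by (rule sum.cong) (simp_all add: form_scale_def)
      also have "\<dots> = h (?\<psi> vs) \<zeta>" unfolding h_sum h_simps by (simp only: mult.assoc)
      finally show "h (\<psi> vs) \<zeta> = h (?\<psi> vs) \<zeta>" .
    qed
  qed
qed

text \<open>The coefficients of \<open>\<phi>\<close> with respect to \<open>\<eta>\<close> and the standard basis of \<open>E\<close>.\<close>

definition kcoeff :: "('m, 'r) Kbilinear \<Rightarrow> 'r \<Rightarrow> 'r \<Rightarrow> complex" where
  "kcoeff \<phi> i j = \<phi> uframe (axis i 1) (axis j 1) / eta uframe"

lemma K_EE_expand:
  assumes "\<phi> \<in> K_EE n J"
  shows "\<phi> vs u v = (\<Sum>i\<in>UNIV. u $ i * (\<Sum>j\<in>UNIV. kcoeff \<phi> i j * (eta vs * v $ j)))"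
proof -
  have add: "\<phi> vs (u + v) w = \<phi> vs u w + \<phi> vs v w" "\<phi> vs u (v + w) = \<phi> vs u v + \<phi> vs u w" for vs u v w
    using assms by (simp_all add: K_EE_def)
  have sc: "\<phi> vs (a *s u) v = a * \<phi> vs u v" "\<phi> vs u (a *s v) = a * \<phi> vs u v" for vs a u v
    using assms by (simp_all add: K_EE_def)
  have z: "\<phi> vs 0 v = 0" "\<phi> vs u 0 = 0" for vs u v using sc(1)[of vs 0 0 v] sc(2)[of vs u 0 0] by simp_all
  have s1: "\<phi> vs (\<Sum>i\<in>S. f i) w = (\<Sum>i\<in>S. \<phi> vs (f i) w)" for f :: "'r \<Rightarrow> _" and S w
    by (induction S rule: infinite_finite_induct) (simp_all add: add z)
  have s2: "\<phi> vs w (\<Sum>i\<in>S. f i) = (\<Sum>i\<in>S. \<phi> vs w (f i))" for f :: "'r \<Rightarrow> _" and S w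
    by (induction S rule: infinite_finite_induct) (simp_all add: add z)
  have k: "\<phi> vs (axis i 1) (axis j 1) = kcoeff \<phi> i j * eta vs" for i j
  proof -
    have "(\<lambda>vs. \<phi> vs (axis i 1) (axis j 1)) \<in> Lambda J n 0" using assms by (simp add: K_EE_def)
    from fun_cong[OF Lambda_n0[OF this], of vs] show ?thesis by (simp add: kcoeff_def form_scale_def)
  qed
  show ?thesis
  proof -
    have "\<phi> vs u v = (\<Sum>i\<in>UNIV. u $ i * \<phi> vs (axis i 1) v)"
      by (subst vec_expand[of u]) (simp add: s1 sc)
    also have "\<dots> = (\<Sum>i\<in>UNIV. u $ i * (\<Sum>j\<in>UNIV. v $ j * \<phi> vs (axis i 1) (axis j 1)))"
      by (subst vec_expand[of v]) (simp add: s2 sc)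
    finally show ?thesis by (simp add: k mult_ac)
  qed
qed

text \<open>For odd \<open>p\<close> the component of degree \<open>p\<close> of an even spinor is 0, so the sign \<open>(-1)\<^sup>n\<^sup>p\<close> of \<open>\<tau>\<close> disappears and
  the star operator can be applied to the whole spinor.\<close>

lemma A_map_eq:
  assumes n: "odd n" and \<phi>: "\<phi> \<in> K_EE n J" and \<alpha>: "\<alpha> \<in> spinorsE J even"
  shows "A_map n J g h \<phi> \<alpha> =
    (\<lambda>vs. \<Sum>i\<in>UNIV. (tau_factor * star (\<Sum>j\<in>UNIV. form_scale (kcoeff \<phi> i j) (coord \<alpha> j)) vs) *s hdual i)"
proof
  fix vs
  define \<beta> where "\<beta> p i = (\<Sum>j\<in>UNIV. form_scale (kcoeff \<phi> i j) (deg_part p (coord \<alpha> j)))" for p i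
  have \<alpha>j: "coord \<alpha> j \<in> spinors J even" for j using \<alpha> by (simp add: spinorsE_iff)
  have dL: "deg_part p (coord \<alpha> j) \<in> Lambda J 0 p" for p j
    using \<alpha>j[of j] unfolding spinors_def by (cases "even p") (auto simp: Lambda_zero)
  have \<beta>L: "\<beta> p i \<in> Lambda J 0 p" for p i unfolding \<beta>_def by (intro Lambda_sum Lambda_scale dL)
  have dc: "deg_part p \<alpha> us $ j = deg_part p (coord \<alpha> j) us" for p us j
    unfolding deg_part_def by (cases "length us = p") simp_all
  have pw: "phi_wedge \<phi> (deg_part p \<alpha>) = (\<lambda>vs \<zeta>. \<Sum>i\<in>UNIV. \<zeta> $ i * wedge eta (\<beta> p i) vs)" for p
  proof (rule ext, rule ext)
    fix us \<zeta>
    let ?s = "\<lambda>S. (-1) ^ card {(i, j). i \<in> S \<and> j < i \<and> j \<notin> S} :: complex"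
    have "phi_wedge \<phi> (deg_part p \<alpha>) us \<zeta> = (\<Sum>S\<in>Pow {..<length us}. \<Sum>i\<in>UNIV. \<Sum>j\<in>UNIV.
        \<zeta> $ i * (?s S * (eta (nths us S) * (kcoeff \<phi> i j * deg_part p (coord \<alpha> j) (nths us (- S))))))"
      (is "?L = ?R")
    proof -
      have "?L = (\<Sum>S\<in>Pow {..<length us}. ?s S * (\<Sum>i\<in>UNIV. \<zeta> $ i *
         (\<Sum>j\<in>UNIV. kcoeff \<phi> i j * (eta (nths us S) * deg_part p (coord \<alpha> j) (nths us (- S))))))"
        by (simp only: phi_wedge_def wedge_with_def K_EE_expand[OF \<phi>] dc)
      also have "\<dots> = ?R"
        unfolding sum_distrib_left by (intro sum.cong refl) (simp only: mult_ac)
      finally show ?thesis .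
    qed
    also have "\<dots> = (\<Sum>i\<in>UNIV. \<Sum>S\<in>Pow {..<length us}. \<Sum>j\<in>UNIV.
        \<zeta> $ i * (?s S * (eta (nths us S) * (kcoeff \<phi> i j * deg_part p (coord \<alpha> j) (nths us (- S))))))"
      by (rule sum.swap)
    also have "\<dots> = (\<Sum>i\<in>UNIV. \<zeta> $ i * wedge eta (\<beta> p i) us)"
      unfolding wedge_with_def \<beta>_def fun_sum_apply form_scale_def sum_distrib_left ..
    finally show "phi_wedge \<phi> (deg_part p \<alpha>) us \<zeta> = (\<Sum>i\<in>UNIV. \<zeta> $ i * wedge eta (\<beta> p i) us)" .
  qed
  have t: "tau_E n J g h n p (phi_wedge \<phi> (deg_part p \<alpha>)) vs = (\<Sum>i\<in>UNIV. (tau_factor * star (\<beta> p i) vs) *s hdual i)"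
    if "p \<le> n" for p
  proof -
    have "tau_factor * (-1) ^ (n * p) * star (\<beta> p i) vs = tau_factor * star (\<beta> p i) vs" for i
    proof (cases "even p")
      case False
      then have "deg_part p (coord \<alpha> j) = 0" for j using \<alpha>j[of j] by (simp add: spinors_def)
      then have "\<beta> p i = 0" by (simp add: \<beta>_def)
      then show ?thesis by (simp add: star_ops pointwise)
    qed simp
    then show ?thesis unfolding tau_E_eq[OF that \<beta>L pw] by (simp only:)
  qed
  have total: "(\<Sum>p\<le>n. \<beta> p i) = (\<Sum>j\<in>UNIV. form_scale (kcoeff \<phi> i j) (coord \<alpha> j))" for i
  proof -
    have "(\<Sum>p\<le>n. \<beta> p i) = (\<Sum>j\<in>UNIV. \<Sum>p\<le>n. form_scale (kcoeff \<phi> i j) (deg_part p (coord \<alpha> j)))"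
      unfolding \<beta>_def by (rule sum.swap)
    also have "\<dots> = (\<Sum>j\<in>UNIV. form_scale (kcoeff \<phi> i j) (\<Sum>p\<le>n. deg_part p (coord \<alpha> j)))"
    proof -
      have "form_scale c (\<Sum>p\<in>S. f p) = (\<Sum>p\<in>S. form_scale c (f p))" for c and f :: "nat \<Rightarrow> ('m, complex) form" and S
        by (induction S rule: infinite_finite_induct) (simp_all add: form_scale_add)
      then show ?thesis by simp
    qed
    also have "\<dots> = (\<Sum>j\<in>UNIV. form_scale (kcoeff \<phi> i j) (coord \<alpha> j))"
      using spinors_decompose[OF \<alpha>j] by simp
    finally show ?thesis .
  qed
  have "A_map n J g h \<phi> \<alpha> vs = (\<Sum>p\<le>n. \<Sum>i\<in>UNIV. (tau_factor * star (\<beta> p i) vs) *s hdual i)"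
    unfolding A_map_def fun_sum_apply by (rule sum.cong) (simp_all add: t)
  also have "\<dots> = (\<Sum>i\<in>UNIV. \<Sum>p\<le>n. (tau_factor * star (\<beta> p i) vs) *s hdual i)" by (rule sum.swap)
  also have "\<dots> = (\<Sum>i\<in>UNIV. (tau_factor * star (\<Sum>p\<le>n. \<beta> p i) vs) *s hdual i)"
    by (simp add: star_sum fun_sum_apply sum_distrib_left vec.scale_sum_left)
  finally show "A_map n J g h \<phi> \<alpha> vs =
     (\<Sum>i\<in>UNIV. (tau_factor * star (\<Sum>j\<in>UNIV. form_scale (kcoeff \<phi> i j) (coord \<alpha> j)) vs) *s hdual i)"
    unfolding total .
qed

lemma A_map_spinorsE:
  assumes n: "odd n" and \<phi>: "\<phi> \<in> K_EE n J" and \<alpha>: "\<alpha> \<in> spinorsE J even"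
  shows "A_map n J g h \<phi> \<alpha> \<in> spinorsE J odd"
  unfolding spinorsE_iff
proof
  fix k
  let ?\<beta> = "\<lambda>i. \<Sum>j\<in>UNIV. form_scale (kcoeff \<phi> i j) (coord \<alpha> j)"
  have "?\<beta> i \<in> spinors J even" for i
    using \<alpha> by (intro spinors_sum spinors_scale) (simp add: spinorsE_iff)
  then have "star (?\<beta> i) \<in> spinors J odd" for i by (rule spinors_star) (use n in simp)
  then have "(\<Sum>i\<in>UNIV. form_scale (tau_factor * hdual i $ k) (star (?\<beta> i))) \<in> spinors J odd"
    by (intro spinors_sum spinors_scale)
  also have "(\<Sum>i\<in>UNIV. form_scale (tau_factor * hdual i $ k) (star (?\<beta> i))) = coord (A_map n J g h \<phi> \<alpha>) k"
    unfolding A_map_eq[OF assms] by (rule ext) (simp add: fun_sum_apply form_scale_def mult_ac)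
  finally show "coord (A_map n J g h \<phi> \<alpha>) k \<in> spinors J odd" .
qed

text \<open>The pairing is complex bilinear in \<open>\<alpha>\<close> and \<open>\<beta>\<close>, because the star operator and the metric are both
  conjugate linear in the respective argument.\<close>

lemma A_map_pairing:
  assumes n: "odd n" and \<phi>: "\<phi> \<in> K_EE n J" and \<alpha>: "\<alpha> \<in> spinorsE J even"
  shows "ipE \<beta> (A_map n J g h \<phi> \<alpha>) =
     cnj tau_factor * (\<Sum>i\<in>UNIV. \<Sum>j\<in>UNIV. kcoeff \<phi> i j * ip (coord \<beta> i) (star (coord \<alpha> j)))"
proof -
  let ?\<alpha> = "\<lambda>i. \<Sum>j\<in>UNIV. form_scale (kcoeff \<phi> i j) (coord \<alpha> j)"
  have "ipE \<beta> (A_map n J g h \<phi> \<alpha>) =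
      (\<Sum>k\<le>CARD('m). \<Sum>vs\<in>onlists k. \<Sum>i\<in>UNIV. cnj tau_factor * (\<beta> vs $ i * cnj (star (?\<alpha> i) vs)) / fact k)"
    unfolding A_map_eq[OF assms] form_inner_onlists h_sum h_simps hdual sum_divide_distrib
    by (simp add: mult_ac)
  also have "\<dots> = (\<Sum>i\<in>UNIV. \<Sum>k\<le>CARD('m). \<Sum>vs\<in>onlists k. cnj tau_factor * (\<beta> vs $ i * cnj (star (?\<alpha> i) vs)) / fact k)"
    unfolding sum.swap[of _ UNIV "onlists _"] sum.swap[of _ UNIV "{.._}"] ..
  also have "\<dots> = (\<Sum>i\<in>UNIV. cnj tau_factor * ip (coord \<beta> i) (star (?\<alpha> i)))"
    unfolding form_inner_onlists sum_distrib_left sum_divide_distrib times_divide_eq_right ..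
  also have "\<dots> = (\<Sum>i\<in>UNIV. cnj tau_factor * (\<Sum>j\<in>UNIV. kcoeff \<phi> i j * ip (coord \<beta> i) (star (coord \<alpha> j))))"
  proof (intro sum.cong refl arg_cong[of _ _ "(*) (cnj tau_factor)"])
    fix i
    show "ip (coord \<beta> i) (star (?\<alpha> i)) = (\<Sum>j\<in>UNIV. kcoeff \<phi> i j * ip (coord \<beta> i) (star (coord \<alpha> j)))"
    proof -
    have "ip \<gamma> (\<Sum>j\<in>S. f j) = (\<Sum>j\<in>S. ip \<gamma> (f j))" for \<gamma> and f :: "'r \<Rightarrow> ('m, complex) form" and S
      by (induction S rule: infinite_finite_induct) (simp_all add: ip_simps)
    then show ?thesis by (simp add: star_sum star_ops ip_simps)
    qed
  qed
  finally show ?thesis by (simp add: sum_distrib_left)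
qed

text \<open>Exchanging \<open>\<alpha>\<close> and \<open>\<beta>\<close> multiplies the pairing of spinors by the sign \<open>(-1)\<^sup>n\<^sup>(\<^sup>n\<^sup>-\<^sup>1\<^sup>)\<^sup>/\<^sup>2\<close> and exchanges the
  indices of the coefficients of \<open>\<phi>\<close>, which are symmetric with the same sign.\<close>

theorem clifford_A_map_symmetric:
  assumes n: "odd n" and \<phi>: "\<phi> \<in> K_EE n J"
    and sym: "\<And>i j. kcoeff \<phi> j i = (-1) ^ (n * (n - 1) div 2) * kcoeff \<phi> i j"
    and \<gamma>: "linear \<gamma>" and \<alpha>: "\<alpha> \<in> spinorsE J even" and \<beta>: "\<beta> \<in> spinorsE J even"
  shows "ipE (cE \<gamma> \<beta>) (A_map n J g h \<phi> \<alpha>) = ipE (cE \<gamma> \<alpha>) (A_map n J g h \<phi> \<beta>)"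
proof -
  have sgn: "sgn_tri n * (sgn_tri n * z) = z" for z
    by (simp flip: power_mult_distrib mult.assoc)
  have c: "ip (clifford J g \<gamma> (coord \<beta> i)) (star (coord \<alpha> j)) = sgn_tri n * ip (clifford J g \<gamma> (coord \<alpha> j)) (star (coord \<beta> i))" for i j
    using \<alpha> \<beta> by (intro clifford_star_pairing[OF \<gamma>]) (auto simp: spinorsE_iff)
  have "kcoeff \<phi> i j * ip (clifford J g \<gamma> (coord \<beta> i)) (star (coord \<alpha> j)) =
      kcoeff \<phi> j i * ip (clifford J g \<gamma> (coord \<alpha> j)) (star (coord \<beta> i))" for i j
    unfolding c sym[of i j] using sgn by (simp add: mult_ac del: power_mult_distrib)
  then have "(\<Sum>i\<in>UNIV. \<Sum>j\<in>UNIV. kcoeff \<phi> i j * ip (clifford J g \<gamma> (coord \<beta> i)) (star (coord \<alpha> j))) =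
     (\<Sum>i\<in>UNIV. \<Sum>j\<in>UNIV. kcoeff \<phi> j i * ip (clifford J g \<gamma> (coord \<alpha> j)) (star (coord \<beta> i)))" by (simp only:)
  also have "\<dots> = (\<Sum>i\<in>UNIV. \<Sum>j\<in>UNIV. kcoeff \<phi> i j * ip (clifford J g \<gamma> (coord \<alpha> i)) (star (coord \<beta> j)))"
    by (rule sum.swap)
  finally show ?thesis
    unfolding A_map_pairing[OF n \<phi> \<alpha>] A_map_pairing[OF n \<phi> \<beta>] tensor_Id_coord by (simp only:)
qed

text \<open>By skew-adjointness of \<open>c(\<gamma>)\<close>, the symmetry of the preceding theorem says that \<open>- c(\<gamma>) A\<^sub>\<phi> \<alpha>\<close> has the
  property that defines the adjoint.\<close>

theorem real_adjoint_A_map: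
  assumes n: "odd n" and \<phi>: "\<phi> \<in> K_EE n J"
    and sym: "\<And>i j. kcoeff \<phi> j i = (-1) ^ (n * (n - 1) div 2) * kcoeff \<phi> i j"
    and \<gamma>: "linear \<gamma>" and \<alpha>: "\<alpha> \<in> spinorsE J even"
  shows "real_adjoint g h (spinorsE J even) (A_map n J g h \<phi>) (cE \<gamma> \<alpha>) = - cE \<gamma> (A_map n J g h \<phi> \<alpha>)"
  unfolding real_adjoint_def
proof (rule the_equality)
  let ?A = "A_map n J g h \<phi>" let ?V = "spinorsE J even :: ('m, complex^'r) form set"
  let ?\<beta> = "- cE \<gamma> (?A \<alpha>)"
  have A: "?A \<alpha> \<in> spinorsE J odd" by (rule A_map_spinorsE[OF n \<phi> \<alpha>])
  have V: "?\<beta> \<in> ?V" by (intro spinorsE_ops(2) cE_spinorsE(2)[OF \<gamma>] A)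
  have "Re (ipE (?A \<beta>) (cE \<gamma> \<alpha>)) = Re (ipE \<beta> ?\<beta>)" if \<beta>: "\<beta> \<in> ?V" for \<beta>
  proof -
    have "Re (ipE (?A \<beta>) (cE \<gamma> \<alpha>)) = Re (ipE (cE \<gamma> \<alpha>) (?A \<beta>))" by (subst ipE_cnj) simp
    also have "\<dots> = Re (ipE (cE \<gamma> \<beta>) (?A \<alpha>))"
      using clifford_A_map_symmetric[OF n \<phi> sym \<gamma> \<alpha> \<beta>] by simp
    also have "\<dots> = Re (ipE \<beta> ?\<beta>)" using cE_skew[OF \<gamma> \<beta> A] by (simp add: ipE_simps)
    finally show ?thesis .
  qed
  with V show "?\<beta> \<in> ?V \<and> (\<forall>\<beta>\<in>?V. Re (ipE (?A \<beta>) (cE \<gamma> \<alpha>)) = Re (ipE \<beta> ?\<beta>))" by blast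
  fix \<beta>' assume \<beta>': "\<beta>' \<in> ?V \<and> (\<forall>\<beta>\<in>?V. Re (ipE (?A \<beta>) (cE \<gamma> \<alpha>)) = Re (ipE \<beta> \<beta>'))"
  have d: "\<beta>' - ?\<beta> \<in> ?V" using \<beta>' V spinorsE_ops(3) by blast
  have "ipE \<delta> (\<beta>' - \<zeta>) = ipE \<delta> \<beta>' - ipE \<delta> \<zeta>" for \<delta> \<zeta> by (rule ipE_simps(6))
  then have "Re (ipE (\<beta>' - ?\<beta>) (\<beta>' - ?\<beta>)) = Re (ipE (\<beta>' - ?\<beta>) \<beta>') - Re (ipE (\<beta>' - ?\<beta>) ?\<beta>)"
    by (simp only: minus_complex.sel)
  also have "\<dots> = 0" using \<beta>' d \<open>\<And>\<beta>. \<beta> \<in> ?V \<Longrightarrow> Re (ipE (?A \<beta>) (cE \<gamma> \<alpha>)) = Re (ipE \<beta> ?\<beta>)\<close>[OF d] by simp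
  finally have "\<beta>' - ?\<beta> = 0" by (rule ipE_definite(2)[OF d])
  then show "\<beta>' = ?\<beta>" by (rule eq_iff_diff_eq_0[THEN iffD2])
qed

end

section \<open>Calculus of functions with continuous derivatives of order k\<close>

lemma Ck_on_SucE:
  assumes "Ck_on (Suc k) U f"
  shows "x \<in> U \<Longrightarrow> (f has_derivative frechet_derivative f (at x)) (at x)"
    "Ck_on k U (\<lambda>x. frechet_derivative f (at x) v)"
  using assms by (auto simp: frechet_derivative_works[symmetric])

lemma Ck_on_cong:
  assumes "open U" "Ck_on k U f" "\<And>x. x \<in> U \<Longrightarrow> f x = g x"
  shows "Ck_on k U g"
  using assms(2,3)
proof (induction k arbitrary: f g)
  case 0 then show ?case using continuous_on_cong[of U U f g] by simp
next
  case (Suc k)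
  have g: "(g has_derivative frechet_derivative f (at x)) (at x)" if "x \<in> U" for x
    using has_derivative_transform_within_open[OF Ck_on_SucE(1)[OF Suc.prems(1) that] assms(1) that] Suc.prems(2) by blast
  then have "frechet_derivative f (at x) = frechet_derivative g (at x)" if "x \<in> U" for x
    using frechet_derivative_at that by blast
  then have "Ck_on k U (\<lambda>x. frechet_derivative g (at x) v)" for v
    by (intro Suc.IH[OF Ck_on_SucE(2)[OF Suc.prems(1)]]) simp
  then show ?case using g by (auto simp: differentiable_def)
qed

text \<open>Any family of derivatives may be used, not only the one selected by \<open>frechet_derivative\<close>.\<close>

lemma Ck_on_SucI:
  assumes "open U" "\<And>x. x \<in> U \<Longrightarrow> (f has_derivative D x) (at x)" "\<And>v. Ck_on k U (\<lambda>x. D x v)"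
  shows "Ck_on (Suc k) U f"
proof -
  have "D x = frechet_derivative f (at x)" if "x \<in> U" for x
    using frechet_derivative_at assms(2) that by blast
  then have "Ck_on k U (\<lambda>x. frechet_derivative f (at x) v)" for v
    by (intro Ck_on_cong[OF assms(1,3)]) simp
  then show ?thesis using assms(2) by (auto simp: differentiable_def)
qed

lemma Ck_on_subset: "Ck_on k U f \<Longrightarrow> V \<subseteq> U \<Longrightarrow> Ck_on k V f"
  by (induction k arbitrary: f) (auto intro: continuous_on_subset)

lemma Ck_on_continuous: "Ck_on k U f \<Longrightarrow> continuous_on U f"
proof (cases k)
  case (Suc k')
  assume "Ck_on k U f"
  then have "isCont f x" if "x \<in> U" for x
    using Suc that differentiable_imp_continuous_within by auto
  then show ?thesis by (simp add: continuous_at_imp_continuous_on)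
qed simp

lemma Ck_on_Suc_imp: "Ck_on (Suc k) U f \<Longrightarrow> Ck_on k U f"
proof (induction k arbitrary: f)
  case 0 then show ?case using Ck_on_continuous[of "Suc 0" U f] by simp
next
  case (Suc k) then show ?case by (metis Ck_on.simps(2))
qed

lemma Ck_on_local:
  assumes "\<And>x. x \<in> U \<Longrightarrow> \<exists>N. open N \<and> x \<in> N \<and> Ck_on k N f"
  shows "Ck_on k U f"
  using assms
proof (induction k arbitrary: f)
  case 0
  have "isCont f x" if x: "x \<in> U" for x
  proof -
    obtain N where "open N" "x \<in> N" "continuous_on N f" using 0[OF x] by auto
    then show ?thesis by (simp add: continuous_on_eq_continuous_at)
  qed
  then show ?case by (simp add: continuous_at_imp_continuous_on)
next
  case (Suc k)
  have "f differentiable (at x)" if x: "x \<in> U" for x using Suc.prems[OF x] by auto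
  moreover have "Ck_on k U (\<lambda>x. frechet_derivative f (at x) v)" for v
    by (rule Suc.IH) (use Suc.prems in fastforce)
  ultimately show ?case by simp
qed

lemma Ck_on_const: "Ck_on k U (\<lambda>x. c)"
proof (induction k arbitrary: c)
  case (Suc k)
  have "frechet_derivative (\<lambda>x. c) (at x) v = 0" for x :: 'a and v
    by (simp add: frechet_derivative_const)
  then show ?case using Suc.IH[of 0] by simp
qed simp

lemma Ck_on_add:
  assumes U: "open U" shows "Ck_on k U f \<Longrightarrow> Ck_on k U g \<Longrightarrow> Ck_on k U (\<lambda>x. f x + g x)"
proof (induction k arbitrary: f g)
  case 0 then show ?case by (simp add: continuous_on_add)
next
  case (Suc k)
  show ?case
    by (rule Ck_on_SucI[OF U has_derivative_add[OF Ck_on_SucE(1)[OF Suc.prems(1)] Ck_on_SucE(1)[OF Suc.prems(2)]]])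
      (simp_all only: Suc.IH Ck_on_SucE(2)[OF Suc.prems(1)] Ck_on_SucE(2)[OF Suc.prems(2)])
qed

lemma Ck_on_bounded_linear:
  assumes U: "open U" and T: "bounded_linear T" shows "Ck_on k U f \<Longrightarrow> Ck_on k U (\<lambda>x. T (f x))"
proof (induction k arbitrary: f)
  case 0 then show ?case using bounded_linear.continuous_on[OF T] by simp
next
  case (Suc k)
  show ?case
    by (rule Ck_on_SucI[OF U bounded_linear.has_derivative[OF T Ck_on_SucE(1)[OF Suc.prems]]])
      (simp_all only: Suc.IH[OF Ck_on_SucE(2)[OF Suc.prems]])
qed

lemma Ck_on_id: "open U \<Longrightarrow> Ck_on k U (\<lambda>x. x)"
proof (cases k)
  case (Suc k')
  assume "open U"
  then show ?thesis unfolding Suc by (rule Ck_on_SucI[where D = "\<lambda>_ v. v"]) (auto simp: Ck_on_const)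
qed simp

lemma Ck_on_bilinear:
  assumes U: "open U" and B: "bounded_bilinear B"
  shows "Ck_on k U f \<Longrightarrow> Ck_on k U g \<Longrightarrow> Ck_on k U (\<lambda>x. B (f x) (g x))"
proof (induction k arbitrary: f g)
  case 0 then show ?case using bounded_bilinear.continuous_on[OF B] by simp
next
  case (Suc k)
  show ?case
  proof (rule Ck_on_SucI[OF U])
    show "((\<lambda>x. B (f x) (g x)) has_derivative
        (\<lambda>v. B (f x) (frechet_derivative g (at x) v) + B (frechet_derivative f (at x) v) (g x))) (at x)" if "x \<in> U" for x
      by (rule bounded_bilinear.FDERIV[OF B Ck_on_SucE(1)[OF Suc.prems(1) that] Ck_on_SucE(1)[OF Suc.prems(2) that]])
    show "Ck_on k U (\<lambda>x. B (f x) (frechet_derivative g (at x) v) + B (frechet_derivative f (at x) v) (g x))" for v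
      using Suc.prems[THEN Ck_on_Suc_imp] Suc.prems[THEN Ck_on_SucE(2)] by (intro Ck_on_add U Suc.IH)
  qed
qed

lemma Ck_on_sum:
  assumes U: "open U" shows "(\<And>i. i \<in> S \<Longrightarrow> Ck_on k U (f i)) \<Longrightarrow> Ck_on k U (\<lambda>x. \<Sum>i\<in>S. f i x)"
  by (induction S rule: infinite_finite_induct) (simp_all add: Ck_on_const Ck_on_add[OF U])

text \<open>The derivative of \<open>f\<close> occurs with an argument that varies with the point. It is expanded in a
  basis, so that the induction hypothesis for derivatives in fixed directions applies.\<close>

lemma Ck_on_compose:
  fixes g :: "'a::real_normed_vector \<Rightarrow> 'c::euclidean_space" and f :: "'c \<Rightarrow> 'b::real_normed_vector"
  assumes U: "open U" and V: "open V" and gU: "g ` U \<subseteq> V"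
  shows "Ck_on k U g \<Longrightarrow> Ck_on k V f \<Longrightarrow> Ck_on k U (\<lambda>x. f (g x))"
proof (induction k arbitrary: f)
  case 0 then show ?case using continuous_on_compose2[of V f U g] gU by simp
next
  case (Suc k)
  let ?Df = "\<lambda>y. frechet_derivative f (at y)" and ?Dg = "\<lambda>x. frechet_derivative g (at x)"
  have Df: "(f has_derivative ?Df (g x)) (at (g x))" if "x \<in> U" for x
    using Ck_on_SucE(1)[OF Suc.prems(2)] gU that by blast
  have *: "?Df (g x) w = (\<Sum>b\<in>Basis. (w \<bullet> b) *\<^sub>R ?Df (g x) b)" if "x \<in> U" for x w
  proof -
    have l: "linear (?Df (g x))" using Df[OF that] has_derivative_linear by blast
    show ?thesis by (subst euclidean_representation[of w, symmetric]) (simp add: linear_sum[OF l] linear_cmul[OF l])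
  qed
  show ?case
  proof (rule Ck_on_SucI[OF U])
    show "((\<lambda>x. f (g x)) has_derivative (\<lambda>v. \<Sum>b\<in>Basis. (?Dg x v \<bullet> b) *\<^sub>R ?Df (g x) b)) (at x)" if "x \<in> U" for x
      unfolding *[OF that, symmetric] by (rule has_derivative_compose[OF Ck_on_SucE(1)[OF Suc.prems(1) that] Df[OF that]])
    have c: "Ck_on k U (\<lambda>x. ?Df (g x) b)" for b
      by (rule Suc.IH[OF Ck_on_Suc_imp[OF Suc.prems(1)] Ck_on_SucE(2)[OF Suc.prems(2)]])
    have "Ck_on k U (\<lambda>x. ?Dg x v \<bullet> b)" for v b
      by (rule Ck_on_bounded_linear[OF U bounded_linear_inner_left Ck_on_SucE(2)[OF Suc.prems(1)]])
    then show "Ck_on k U (\<lambda>x. \<Sum>b\<in>Basis. (?Dg x v \<bullet> b) *\<^sub>R ?Df (g x) b)" for v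
      by (intro Ck_on_sum U Ck_on_bilinear[OF U bounded_bilinear_scaleR] c)
  qed
qed

text \<open>The derivative is a polynomial in the inverse itself and the derivative of \<open>f\<close>, so the
  induction closes.\<close>

lemma Ck_on_inverse:
  fixes f :: "'a::real_normed_vector \<Rightarrow> real"
  assumes U: "open U" and nz: "\<And>x. x \<in> U \<Longrightarrow> f x \<noteq> 0"
  shows "Ck_on k U f \<Longrightarrow> Ck_on k U (\<lambda>x. inverse (f x))"
proof (induction k)
  case 0 then show ?case using nz by (simp add: continuous_on_inverse)
next
  case (Suc k)
  have k: "Ck_on k U (\<lambda>x. inverse (f x))" using Suc Ck_on_Suc_imp by blast
  show ?case
  proof (rule Ck_on_SucI[OF U])
    show "((\<lambda>x. inverse (f x)) has_derivative (\<lambda>v. - (inverse (f x) * frechet_derivative f (at x) v * inverse (f x)))) (at x)"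
      if "x \<in> U" for x
      by (rule Deriv.has_derivative_inverse[OF nz[OF that] Ck_on_SucE(1)[OF Suc.prems that]])
    show "Ck_on k U (\<lambda>x. - (inverse (f x) * frechet_derivative f (at x) v * inverse (f x)))" for v
      by (intro Ck_on_bounded_linear[OF U bounded_linear_minus[OF bounded_linear_ident]] Ck_on_bilinear[OF U bounded_bilinear_mult]
          k Ck_on_SucE(2)[OF Suc.prems])
  qed
qed

lemma smooth_onI: "(\<And>k. Ck_on k U f) \<Longrightarrow> smooth_on U f" and smooth_onD: "smooth_on U f \<Longrightarrow> Ck_on k U f"
  by (simp_all add: smooth_on_def)

lemma smooth_on_cong: "open U \<Longrightarrow> smooth_on U f \<Longrightarrow> (\<And>x. x \<in> U \<Longrightarrow> f x = g x) \<Longrightarrow> smooth_on U g"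
  by (rule smooth_onI, rule Ck_on_cong[OF _ smooth_onD])

lemma smooth_on_subset: "smooth_on U f \<Longrightarrow> V \<subseteq> U \<Longrightarrow> smooth_on V f"
  by (rule smooth_onI, rule Ck_on_subset[OF smooth_onD])

lemma smooth_on_local:
  assumes "\<And>x. x \<in> U \<Longrightarrow> \<exists>N. open N \<and> x \<in> N \<and> smooth_on N f" shows "smooth_on U f"
proof (rule smooth_onI, rule Ck_on_local)
  fix k x assume "x \<in> U"
  then show "\<exists>N. open N \<and> x \<in> N \<and> Ck_on k N f" using assms smooth_onD by blast
qed

lemma smooth_on_const: "smooth_on U (\<lambda>x. c)"
  by (rule smooth_onI, rule Ck_on_const)

lemma smooth_on_id: "open U \<Longrightarrow> smooth_on U (\<lambda>x. x)"
  by (rule smooth_onI, rule Ck_on_id)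

lemma smooth_on_add: "open U \<Longrightarrow> smooth_on U f \<Longrightarrow> smooth_on U g \<Longrightarrow> smooth_on U (\<lambda>x. f x + g x)"
  by (rule smooth_onI, rule Ck_on_add[OF _ smooth_onD smooth_onD])

lemma smooth_on_bounded_linear: "open U \<Longrightarrow> bounded_linear T \<Longrightarrow> smooth_on U f \<Longrightarrow> smooth_on U (\<lambda>x. T (f x))"
  by (rule smooth_onI, rule Ck_on_bounded_linear[OF _ _ smooth_onD])

lemma smooth_on_bilinear:
  "open U \<Longrightarrow> bounded_bilinear B \<Longrightarrow> smooth_on U f \<Longrightarrow> smooth_on U g \<Longrightarrow> smooth_on U (\<lambda>x. B (f x) (g x))"
  by (rule smooth_onI, rule Ck_on_bilinear[OF _ _ smooth_onD smooth_onD])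

lemma smooth_on_inverse:
  "open U \<Longrightarrow> (\<And>x. x \<in> U \<Longrightarrow> f x \<noteq> (0::real)) \<Longrightarrow> smooth_on U f \<Longrightarrow> smooth_on U (\<lambda>x. inverse (f x))"
  by (rule smooth_onI, rule Ck_on_inverse[OF _ _ smooth_onD])

lemma smooth_on_derivative: "smooth_on U f \<Longrightarrow> smooth_on U (\<lambda>x. frechet_derivative f (at x) v)"
  by (rule smooth_onI, rule Ck_on_SucE(2)[OF smooth_onD])

lemma smooth_on_has_derivative: "smooth_on U f \<Longrightarrow> x \<in> U \<Longrightarrow> (f has_derivative frechet_derivative f (at x)) (at x)"
  by (rule Ck_on_SucE(1)[OF smooth_onD])

lemma smooth_on_sum: "open U \<Longrightarrow> (\<And>i. i \<in> S \<Longrightarrow> smooth_on U (f i)) \<Longrightarrow> smooth_on U (\<lambda>x. \<Sum>i\<in>S. f i x)"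
  by (rule smooth_onI, rule Ck_on_sum) (simp_all add: smooth_onD)

lemma smooth_on_compose:
  fixes g :: "'a::real_normed_vector \<Rightarrow> 'c::euclidean_space"
  shows "open U \<Longrightarrow> open V \<Longrightarrow> g ` U \<subseteq> V \<Longrightarrow> smooth_on U g \<Longrightarrow> smooth_on V f \<Longrightarrow> smooth_on U (\<lambda>x. f (g x))"
  by (rule smooth_onI, rule Ck_on_compose[OF _ _ _ smooth_onD smooth_onD])

lemma smooth_on_continuous: "smooth_on U f \<Longrightarrow> continuous_on U f"
  by (rule Ck_on_continuous[OF smooth_onD])

section \<open>Bump functions\<close>

text \<open>The linear span of these functions is closed under differentiation. For \<open>m = 0\<close> this is the standard
  smooth function that is 0 on the negative half line and positive on the positive one.\<close>

definition flat :: "nat \<Rightarrow> real \<Rightarrow> real" where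
  "flat m t = (if t \<le> 0 then 0 else inverse t ^ m * exp (- inverse t))"

lemma flat_derivative:
  "(flat m has_field_derivative flat (m + 2) t - of_nat m * flat (m + 1) t) (at t)"
proof -
  consider "t < 0" | "t = 0" | "t > 0" by linarith
  then show ?thesis
  proof cases
    case 1
    have "((\<lambda>_. 0) has_field_derivative 0) (at t)" by simp
    then have "(flat m has_field_derivative 0) (at t)"
      by (rule has_field_derivative_transform_within_open[where S = "{..<0}"]) (use 1 in \<open>auto simp: flat_def\<close>)
    then show ?thesis using 1 by (simp add: flat_def)
  next
    case 2
    have "((\<lambda>x::real. x ^ (m + 1) / exp x) \<longlongrightarrow> 0) at_top" by (rule tendsto_power_div_exp_0)
    then have "((\<lambda>h. inverse h ^ (m + 1) / exp (inverse h)) \<longlongrightarrow> (0::real)) (at_right 0)"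
      by (rule filterlim_compose[OF _ filterlim_inverse_at_top_right])
    then have "((\<lambda>h. (flat m (0 + h) - flat m 0) / h) \<longlongrightarrow> 0) (at_right 0)"
    proof (rule Lim_transform_eventually)
      show "eventually (\<lambda>h. inverse h ^ (m + 1) / exp (inverse h) = (flat m (0 + h) - flat m 0) / h) (at_right 0)"
        by (rule eventually_at_rightI[of 0 1]) (auto simp: flat_def exp_minus field_simps)
    qed
    moreover have "((\<lambda>h. (flat m (0 + h) - flat m 0) / h) \<longlongrightarrow> 0) (at_left 0)"
    proof (rule Lim_transform_eventually[OF tendsto_const])
      show "eventually (\<lambda>h. 0 = (flat m (0 + h) - flat m 0) / h) (at_left 0)"
        by (rule eventually_at_leftI[of "-1"]) (auto simp: flat_def)
    qed
    ultimately have "((\<lambda>h. (flat m (0 + h) - flat m 0) / h) \<longlongrightarrow> 0) (at 0)"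
      by (simp add: filterlim_split_at)
    then show ?thesis using 2 by (simp add: DERIV_def flat_def)
  next
    case 3
    have "((\<lambda>t. inverse t ^ m * exp (- inverse t)) has_field_derivative flat (m + 2) t - of_nat m * flat (m + 1) t) (at t)"
    proof -
      have i: "(inverse has_field_derivative - (inverse t * inverse t)) (at t)"
        using DERIV_inverse[of t] 3 by (simp add: power2_eq_square)
      have e: "((\<lambda>t. exp (- inverse t)) has_field_derivative exp (- inverse t) * (inverse t * inverse t)) (at t)"
        using DERIV_fun_exp[OF DERIV_minus[OF i]] by simp
      show ?thesis
        by (rule DERIV_cong[OF DERIV_mult[OF DERIV_power[OF i] e]])
          (cases m; use 3 in \<open>simp add: flat_def algebra_simps power2_eq_square\<close>)
    qed
    then show ?thesis
      by (rule has_field_derivative_transform_within_open[where S = "{0<..}"]) (use 3 in \<open>auto simp: flat_def\<close>)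
  qed
qed

lemma flat_smooth: "smooth_on UNIV (flat m)"
proof (rule smooth_onI)
  fix k show "Ck_on k UNIV (flat m)"
  proof (induction k arbitrary: m)
    case 0
    show ?case using DERIV_isCont[OF flat_derivative] by (simp add: continuous_at_imp_continuous_on)
  next
    case (Suc k)
    show ?case
    proof (rule Ck_on_SucI[OF open_UNIV])
      show "(flat m has_derivative (\<lambda>v. (flat (m + 2) t + (- of_nat m) * flat (m + 1) t) * v)) (at t)" for t
        using flat_derivative[of m t] by (simp add: has_field_derivative_def)
      show "Ck_on k UNIV (\<lambda>t. (flat (m + 2) t + (- of_nat m) * flat (m + 1) t) * v)" for v
        by (intro Ck_on_bilinear[OF open_UNIV bounded_bilinear_mult] Ck_on_add open_UNIV Suc.IH Ck_on_const)
    qed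
  qed
qed

lemma bump_euclidean:
  fixes p :: "'a::euclidean_space" assumes "r > 0"
  shows "\<exists>b. smooth_on UNIV b \<and> b p = (1::real) \<and> (\<forall>q. q \<notin> cball p r \<longrightarrow> b q = 0)"
proof (intro exI conjI allI impI)
  let ?\<rho> = "\<lambda>q. r ^ 2 + (- 1) * ((q + (- p)) \<bullet> (q + (- p)))"
  let ?b = "\<lambda>q. inverse (flat 0 (r ^ 2)) * flat 0 (?\<rho> q)"
  have "smooth_on UNIV ?\<rho>"
    by (intro smooth_on_add smooth_on_bilinear[OF open_UNIV bounded_bilinear_mult]
        smooth_on_bilinear[OF open_UNIV bounded_bilinear_inner] smooth_on_const smooth_on_id open_UNIV)
  then have "smooth_on UNIV (\<lambda>q. flat 0 (?\<rho> q))"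
    by (intro smooth_on_compose[OF open_UNIV open_UNIV _ _ flat_smooth]) auto
  then show "smooth_on UNIV ?b"
    by (intro smooth_on_bilinear[OF open_UNIV bounded_bilinear_mult] smooth_on_const)
  have "flat 0 (r ^ 2) > 0" using assms by (simp add: flat_def)
  then show "?b p = 1" by simp
  fix q assume "q \<notin> cball p r"
  then have "norm (q - p) > r" by (simp add: dist_norm norm_minus_commute)
  then have "norm (q - p) ^ 2 > r ^ 2" using assms by (intro power_strict_mono) auto
  then show "?b q = 0" by (simp add: flat_def power2_norm_eq_inner)
qed

section \<open>Charts, coordinate changes and smooth maps\<close>

abbreviation chart_inv :: "('x, 'm::finite) chart \<Rightarrow> real^'m \<Rightarrow> 'x" where
  "chart_inv c \<equiv> inv_into (fst c) (snd c)"

lemma bounded_linear_euclidean: "linear (f :: 'a::euclidean_space \<Rightarrow> 'b::real_normed_vector) \<Longrightarrow> bounded_linear f"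
  by (simp add: linear_conv_bounded_linear)

locale smooth_manifold =
  fixes A :: "('x::t2_space, 'm::finite) chart set"
  assumes atlas: "smooth_atlas A"
begin

abbreviation sm :: "'x set \<Rightarrow> ('x \<Rightarrow> 'b::real_normed_vector) \<Rightarrow> bool" where
  "sm \<equiv> smooth_map_on A"

lemma sm_iff: "sm W f \<longleftrightarrow> (\<forall>c\<in>A. smooth_on (snd c ` (fst c \<inter> W)) (\<lambda>y. f (chart_inv c y)))"
  by (auto simp: smooth_map_on_def o_def)

lemma chart_cover: "\<exists>c\<in>A. x \<in> fst c"
  using atlas by (auto simp: smooth_atlas_def)

lemma chart_props:
  assumes "c \<in> A"
  shows "open (fst c)" "open (snd c ` fst c)" "continuous_on (snd c ` fst c) (chart_inv c)"
    "x \<in> fst c \<Longrightarrow> chart_inv c (snd c x) = x"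
proof -
  have c: "is_chart c" using atlas assms by (simp add: smooth_atlas_def)
  then show "open (fst c)" "open (snd c ` fst c)" "continuous_on (snd c ` fst c) (chart_inv c)"
    by (auto simp: is_chart_def homeomorphism_def split_beta)
  from c show "x \<in> fst c \<Longrightarrow> chart_inv c (snd c x) = x"
    by (auto simp: is_chart_def homeomorphism_def split_beta)
qed

lemma chart_image_open:
  assumes c: "c \<in> A" and W: "open W" shows "open (snd c ` (fst c \<inter> W))"
proof -
  have "snd c ` (fst c \<inter> W) = snd c ` fst c \<inter> chart_inv c -` W"
    using chart_props(4)[OF c] by force
  then show ?thesis
    using continuous_open_preimage[OF chart_props(3,2)[OF c] W] by simp
qed

lemma transition_smooth:
  assumes "c \<in> A" "d \<in> A" shows "smooth_on (snd c ` (fst c \<inter> fst d)) (\<lambda>y. snd d (chart_inv c y))"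
  using atlas assms unfolding smooth_atlas_def by (fastforce simp: o_def split_beta)

lemma sm_const: "sm W (\<lambda>x. c)"
  by (simp add: sm_iff smooth_on_const)

lemma sm_add: "open W \<Longrightarrow> sm W f \<Longrightarrow> sm W g \<Longrightarrow> sm W (\<lambda>x. f x + g x)"
  by (simp add: sm_iff smooth_on_add chart_image_open)

lemma sm_linear: "open W \<Longrightarrow> bounded_linear T \<Longrightarrow> sm W f \<Longrightarrow> sm W (\<lambda>x. T (f x))"
  by (auto simp: sm_iff intro!: smooth_on_bounded_linear[where T = T] chart_image_open)

lemma sm_bilinear: "open W \<Longrightarrow> bounded_bilinear B \<Longrightarrow> sm W f \<Longrightarrow> sm W g \<Longrightarrow> sm W (\<lambda>x. B (f x) (g x))"
  by (auto simp: sm_iff intro!: smooth_on_bilinear[where B = B] chart_image_open)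

lemma sm_sum: "open W \<Longrightarrow> (\<And>i. i \<in> S \<Longrightarrow> sm W (f i)) \<Longrightarrow> sm W (\<lambda>x. \<Sum>i\<in>S. f i x)"
  by (simp add: sm_iff smooth_on_sum chart_image_open)

lemma sm_inverse: "open W \<Longrightarrow> (\<And>x. x \<in> W \<Longrightarrow> f x \<noteq> (0::real)) \<Longrightarrow> sm W f \<Longrightarrow> sm W (\<lambda>x. inverse (f x))"
  unfolding sm_iff
proof (intro ballI smooth_on_inverse)
  fix c y assume *: "open W" "\<And>x. x \<in> W \<Longrightarrow> f x \<noteq> 0" "c \<in> A" "y \<in> snd c ` (fst c \<inter> W)"
  then show "f (chart_inv c y) \<noteq> 0" using chart_props(4) by fastforce
qed (simp_all add: chart_image_open)

lemma sm_minus: "open W \<Longrightarrow> sm W f \<Longrightarrow> sm W (\<lambda>x. - f x)"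
  by (rule sm_linear[OF _ bounded_linear_minus[OF bounded_linear_ident]])

lemma sm_diff: "open W \<Longrightarrow> sm W f \<Longrightarrow> sm W g \<Longrightarrow> sm W (\<lambda>x. f x - g x)"
  using sm_add[OF _ _ sm_minus, of W f g] by simp

lemma sm_mult: "open W \<Longrightarrow> sm W f \<Longrightarrow> sm W g \<Longrightarrow> sm W (\<lambda>x. f x * g x :: 'b::real_normed_algebra)"
  by (rule sm_bilinear[OF _ bounded_bilinear_mult])

lemma sm_scaleR: "open W \<Longrightarrow> sm W f \<Longrightarrow> sm W g \<Longrightarrow> sm W (\<lambda>x. f x *\<^sub>R g x)"
  by (rule sm_bilinear[OF _ bounded_bilinear_scaleR])

lemma sm_subset: "sm W f \<Longrightarrow> V \<subseteq> W \<Longrightarrow> sm V f"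
  unfolding sm_iff by (blast intro: smooth_on_subset)

lemma sm_cong: "open W \<Longrightarrow> sm W f \<Longrightarrow> (\<And>x. x \<in> W \<Longrightarrow> f x = g x) \<Longrightarrow> sm W g"
  unfolding sm_iff
proof (intro ballI)
  fix c assume *: "open W" "\<forall>c\<in>A. smooth_on (snd c ` (fst c \<inter> W)) (\<lambda>y. f (chart_inv c y))"
    "\<And>x. x \<in> W \<Longrightarrow> f x = g x" "c \<in> A"
  show "smooth_on (snd c ` (fst c \<inter> W)) (\<lambda>y. g (chart_inv c y))"
  proof (rule smooth_on_cong[OF chart_image_open[OF *(4,1)]])
    show "smooth_on (snd c ` (fst c \<inter> W)) (\<lambda>y. f (chart_inv c y))" using * by blast
    fix y assume "y \<in> snd c ` (fst c \<inter> W)"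
    then show "f (chart_inv c y) = g (chart_inv c y)" using chart_props(4)[OF *(4)] *(3) by auto
  qed
qed

lemma sm_local:
  assumes "\<And>x. x \<in> W \<Longrightarrow> \<exists>N. open N \<and> x \<in> N \<and> sm N f" shows "sm W f"
  unfolding sm_iff
proof (intro ballI smooth_on_local)
  fix c y assume c: "c \<in> A" and "y \<in> snd c ` (fst c \<inter> W)"
  then obtain x where x: "x \<in> fst c" "x \<in> W" "y = snd c x" by auto
  obtain N where N: "open N" "x \<in> N" "sm N f" using assms[OF x(2)] by blast
  have "open (snd c ` (fst c \<inter> N))" "y \<in> snd c ` (fst c \<inter> N)"
    "smooth_on (snd c ` (fst c \<inter> N)) (\<lambda>y. f (chart_inv c y))"
    using chart_image_open[OF c N(1)] x N c by (auto simp: sm_iff)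
  then show "\<exists>N. open N \<and> y \<in> N \<and> smooth_on N (\<lambda>y. f (chart_inv c y))" by blast
qed

text \<open>In every other chart the function is the composition with a coordinate change, which is smooth.\<close>

lemma sm_one_chart:
  assumes c: "c \<in> A" and W: "open W" "W \<subseteq> fst c" and f: "smooth_on (snd c ` W) (\<lambda>y. f (chart_inv c y))"
  shows "sm W f"
  unfolding sm_iff
proof
  fix d assume d: "d \<in> A"
  let ?U = "snd d ` (fst d \<inter> W)"
  have oU: "open ?U" by (rule chart_image_open[OF d W(1)])
  have oW: "open (snd c ` W)" using chart_image_open[OF c W(1)] W(2) by (simp add: Int_absorb1)
  have t: "smooth_on ?U (\<lambda>y. snd c (chart_inv d y))"
    by (rule smooth_on_subset[OF transition_smooth[OF d c]]) (use W(2) in blast)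
  have im: "(\<lambda>y. snd c (chart_inv d y)) ` ?U \<subseteq> snd c ` W" using chart_props(4)[OF d] by auto
  have "smooth_on ?U (\<lambda>y. f (chart_inv c (snd c (chart_inv d y))))"
    by (rule smooth_on_compose[OF oU oW im t f])
  then show "smooth_on ?U (\<lambda>y. f (chart_inv d y))"
    by (rule smooth_on_cong[OF oU]) (use chart_props(4)[OF d] chart_props(4)[OF c] W(2) in auto)
qed

lemma chart_at: "chart_at A x \<in> A" "x \<in> fst (chart_at A x)"
proof -
  have "\<exists>c. c \<in> A \<and> x \<in> fst c" using chart_cover by blast
  from someI_ex[OF this] show "chart_at A x \<in> A" "x \<in> fst (chart_at A x)" by (auto simp: chart_at_def)
qed

lemma chart_change_derivative:
  assumes "c \<in> A" "d \<in> A" "x \<in> fst c" "x \<in> fst d"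
  shows "((\<lambda>y. snd d (chart_inv c y)) has_derivative chart_change c d x) (at (snd c x))"
  using smooth_on_has_derivative[OF transition_smooth[OF assms(1,2)], of "snd c x"] assms(3,4)
  unfolding chart_change_def[abs_def] o_def by auto

lemma chart_change_linear:
  "c \<in> A \<Longrightarrow> d \<in> A \<Longrightarrow> x \<in> fst c \<Longrightarrow> x \<in> fst d \<Longrightarrow> linear (chart_change c d x)"
  using chart_change_derivative has_derivative_linear by blast

text \<open>The chain rule.\<close>

lemma chart_change_trans:
  assumes "c \<in> A" "d \<in> A" "e \<in> A" "x \<in> fst c" "x \<in> fst d" "x \<in> fst e"
  shows "chart_change d e x (chart_change c d x u) = chart_change c e x u"
proof -
  let ?U = "snd c ` (fst c \<inter> fst d)"
  have "((\<lambda>y. snd e (chart_inv d y)) has_derivative chart_change d e x) (at (snd d (chart_inv c (snd c x))))"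
    using chart_change_derivative[OF assms(2,3,5,6)] chart_props(4)[OF assms(1,4)] by simp
  from has_derivative_compose[OF chart_change_derivative[OF assms(1,2,4,5)] this]
  have "((\<lambda>y. snd e (chart_inv c y)) has_derivative (\<lambda>u. chart_change d e x (chart_change c d x u))) (at (snd c x))"
  proof (rule has_derivative_transform_within_open)
    show "open ?U" by (rule chart_image_open[OF assms(1) chart_props(1)[OF assms(2)]])
    show "snd c x \<in> ?U" using assms by blast
    show "snd e (chart_inv d (snd d (chart_inv c y))) = snd e (chart_inv c y)" if "y \<in> ?U" for y
      using that chart_props(4)[OF assms(1)] chart_props(4)[OF assms(2)] by auto
  qed
  from has_derivative_unique[OF this chart_change_derivative[OF assms(1,3,4,6)]] show ?thesis
    by (rule fun_cong)
qed

lemma chart_change_self: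
  assumes "c \<in> A" "x \<in> fst c" shows "chart_change c c x u = u"
proof -
  have "((\<lambda>y. snd c (chart_inv c y)) has_derivative (\<lambda>u. u)) (at (snd c x))"
    by (rule has_derivative_transform_within_open[OF has_derivative_ident chart_props(2)[OF assms(1)]])
      (use assms chart_props(4)[OF assms(1)] in auto)
  from has_derivative_unique[OF this chart_change_derivative[OF assms(1,1,2,2)]] show ?thesis by metis
qed

lemma chart_change_smooth:
  assumes "c \<in> A" "d \<in> A" shows "sm (fst c \<inter> fst d) (\<lambda>x. chart_change c d x u)"
proof (rule sm_one_chart[OF assms(1)])
  let ?U = "snd c ` (fst c \<inter> fst d)"
  show "smooth_on ?U (\<lambda>y. chart_change c d (chart_inv c y) u)"
    by (rule smooth_on_cong[OF chart_image_open[OF assms(1) chart_props(1)[OF assms(2)]]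
          smooth_on_derivative[OF transition_smooth[OF assms], of u]])
      (use chart_props(4)[OF assms(1)] in \<open>auto simp: chart_change_def o_def\<close>)
  show "open (fst c \<inter> fst d)" using chart_props(1)[OF assms(1)] chart_props(1)[OF assms(2)] by (rule open_Int)
qed simp

lemma to_chart_from_chart:
  "c \<in> A \<Longrightarrow> d \<in> A \<Longrightarrow> x \<in> fst c \<Longrightarrow> x \<in> fst d \<Longrightarrow> to_chart A d x (from_chart A c x u) = chart_change c d x u"
  unfolding to_chart_def from_chart_def by (rule chart_change_trans) (simp_all add: chart_at)

lemma to_from_chart: "c \<in> A \<Longrightarrow> x \<in> fst c \<Longrightarrow> to_chart A c x (from_chart A c x u) = u"
  by (simp add: to_chart_from_chart chart_change_self)

lemma from_to_chart: "c \<in> A \<Longrightarrow> x \<in> fst c \<Longrightarrow> from_chart A c x (to_chart A c x v) = v"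
  unfolding to_chart_def from_chart_def
  by (subst chart_change_trans) (simp_all add: chart_at chart_change_self)

lemma from_chart_linear: "c \<in> A \<Longrightarrow> x \<in> fst c \<Longrightarrow> linear (from_chart A c x)"
  and to_chart_linear: "c \<in> A \<Longrightarrow> x \<in> fst c \<Longrightarrow> linear (to_chart A c x)"
  unfolding from_chart_def[abs_def] to_chart_def[abs_def] by (simp_all add: chart_change_linear chart_at)

lemma differential_chart:
  assumes f: "sm UNIV f" and c: "c \<in> A" "x \<in> fst c"
  shows "((\<lambda>y. f (chart_inv c y)) has_derivative (\<lambda>u. differential A f x (from_chart A c x u))) (at (snd c x))"
    "linear (differential A f x)"
proof -
  let ?d = "chart_at A x"
  have d: "?d \<in> A" "x \<in> fst ?d" by (rule chart_at)+
  have fd: "((\<lambda>y. f (chart_inv e y)) has_derivative frechet_derivative (\<lambda>y. f (chart_inv e y)) (at (snd e x))) (at (snd e x))"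
    if "e \<in> A" "x \<in> fst e" for e
    by (rule smooth_on_has_derivative[of "snd e ` fst e"]) (use f that in \<open>auto simp: sm_iff\<close>)
  have D: "differential A f x = frechet_derivative (\<lambda>y. f (chart_inv ?d y)) (at (snd ?d x))"
    by (rule ext) (simp add: differential_def split_beta o_def)
  show "linear (differential A f x)" unfolding D using fd[OF d] has_derivative_linear by blast
  let ?U = "snd c ` (fst c \<inter> fst ?d)"
  have "((\<lambda>y. f (chart_inv ?d y)) has_derivative differential A f x) (at (snd ?d (chart_inv c (snd c x))))"
    using fd[OF d] chart_props(4)[OF c] by (simp add: D)
  from has_derivative_compose[OF chart_change_derivative[OF c(1) d(1) c(2) d(2)] this]
  show "((\<lambda>y. f (chart_inv c y)) has_derivative (\<lambda>u. differential A f x (from_chart A c x u))) (at (snd c x))"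
    unfolding from_chart_def
  proof (rule has_derivative_transform_within_open)
    show "open ?U" by (rule chart_image_open[OF c(1) chart_props(1)[OF d(1)]])
    show "snd c x \<in> ?U" using c d by blast
    show "f (chart_inv ?d (snd ?d (chart_inv c y))) = f (chart_inv c y)" if "y \<in> ?U" for y
      using that chart_props(4)[OF c(1)] chart_props(4)[OF d(1)] by auto
  qed
qed

lemma differential_smooth:
  assumes f: "sm UNIV f" and c: "c \<in> A"
  shows "sm (fst c) (\<lambda>x. differential A f x (from_chart A c x u))"
proof (rule sm_one_chart[OF c chart_props(1)[OF c] order.refl])
  show "smooth_on (snd c ` fst c) (\<lambda>y. differential A f (chart_inv c y) (from_chart A c (chart_inv c y) u))"
  proof (rule smooth_on_cong[OF chart_props(2)[OF c]])
    show "smooth_on (snd c ` fst c) (\<lambda>y. frechet_derivative (\<lambda>y. f (chart_inv c y)) (at y) u)"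
      by (rule smooth_on_derivative) (use f c in \<open>auto simp: sm_iff\<close>)
    fix y assume "y \<in> snd c ` fst c"
    then obtain x where x: "x \<in> fst c" "y = snd c x" by auto
    show "frechet_derivative (\<lambda>y. f (chart_inv c y)) (at y) u = differential A f (chart_inv c y) (from_chart A c (chart_inv c y) u)"
      using fun_cong[OF frechet_derivative_at[OF differential_chart(1)[OF f c x(1)]], of u] chart_props(4)[OF c x(1)] x(2)
      by simp
  qed
qed

text \<open>A bump function in a chart is extended by 0. The extension is smooth because the support is compact,
  hence closed in the Hausdorff space. The set \<open>K\<close> is kept for extending products with the bump function
  in the same way.\<close>

lemma bump_exists:
  assumes "open W" "x \<in> W"
  shows "\<exists>b K. closed K \<and> K \<subseteq> W \<and> sm UNIV b \<and> b x = (1::real) \<and> (\<forall>y. y \<notin> K \<longrightarrow> b y = 0)"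
proof -
  let ?c = "chart_at A x" let ?p = "snd ?c x"
  have c: "?c \<in> A" "x \<in> fst ?c" by (rule chart_at)+
  have "open (snd ?c ` (fst ?c \<inter> W))" "?p \<in> snd ?c ` (fst ?c \<inter> W)"
    using chart_image_open[OF c(1) assms(1)] assms(2) c(2) by auto
  then obtain r where r: "r > 0" "cball ?p r \<subseteq> snd ?c ` (fst ?c \<inter> W)" using open_contains_cball by metis
  obtain \<beta> :: "real^'m \<Rightarrow> real" where \<beta>: "smooth_on UNIV \<beta>" "\<beta> ?p = 1" "\<And>q. q \<notin> cball ?p r \<Longrightarrow> \<beta> q = 0"
    using bump_euclidean[OF r(1), of ?p] by blast
  let ?K = "chart_inv ?c ` cball ?p r"
  define b where "b y = (if y \<in> fst ?c then \<beta> (snd ?c y) else 0)" for y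
  have "continuous_on (cball ?p r) (chart_inv ?c)"
    by (rule continuous_on_subset[OF chart_props(3)[OF c(1)]]) (use r(2) in blast)
  then have K: "closed ?K" using compact_continuous_image compact_cball compact_imp_closed by blast
  have KW: "?K \<subseteq> W" using r(2) chart_props(4)[OF c(1)] by fastforce
  have off: "b y = 0" if "y \<notin> ?K" for y
  proof (cases "y \<in> fst ?c")
    case True
    then have "snd ?c y \<notin> cball ?p r" using that chart_props(4)[OF c(1) True] by (metis image_eqI)
    then show ?thesis using \<beta>(3) by (simp add: b_def)
  qed (simp add: b_def)
  have "sm UNIV b"
  proof (rule sm_local)
    fix y
    show "\<exists>N. open N \<and> y \<in> N \<and> sm N b"
    proof (cases "y \<in> fst ?c")
      case True
      have "smooth_on (snd ?c ` fst ?c) (\<lambda>y. b (chart_inv ?c y))"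
        by (rule smooth_on_cong[OF chart_props(2)[OF c(1)] smooth_on_subset[OF \<beta>(1)]])
          (use chart_props(4)[OF c(1)] in \<open>auto simp: b_def\<close>)
      then have "sm (fst ?c) b" by (rule sm_one_chart[OF c(1) chart_props(1)[OF c(1)] order.refl])
      then show ?thesis using True chart_props(1)[OF c(1)] by blast
    next
      case False
      have "?K \<subseteq> fst ?c" using r(2) chart_props(4)[OF c(1)] by fastforce
      then have "y \<in> - ?K" using False by blast
      moreover have "open (- ?K)" using K by (simp add: open_Compl)
      moreover have "sm (- ?K) b" by (rule sm_cong[OF \<open>open (- ?K)\<close> sm_const[of _ 0]]) (use off in simp)
      ultimately show ?thesis by blast
    qed
  qed
  moreover have "b x = 1" using c \<beta>(2) by (simp add: b_def)
  ultimately show ?thesis using K KW off by blast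
qed

lemma bump_extend:
  assumes K: "closed K" "K \<subseteq> Q" and b: "sm UNIV b" "\<And>y. y \<notin> K \<Longrightarrow> b y = (0::real)"
    and Q: "open Q" and W: "open W" and s: "sm (Q \<inter> W) s"
  shows "sm W (\<lambda>y. b y *\<^sub>R s y)"
proof (rule sm_local)
  fix y assume y: "y \<in> W"
  show "\<exists>N. open N \<and> y \<in> N \<and> sm N (\<lambda>y. b y *\<^sub>R s y)"
  proof (cases "y \<in> Q")
    case True
    have "sm (Q \<inter> W) (\<lambda>y. b y *\<^sub>R s y)"
      by (rule sm_scaleR[OF open_Int[OF Q W] sm_subset[OF b(1)] s]) simp
    then show ?thesis using True y Q W by blast
  next
    case False
    have o: "open (- K)" using K by (simp add: open_Compl)
    have "sm (- K) (\<lambda>y. b y *\<^sub>R s y)"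
      by (rule sm_cong[OF o sm_const[of _ 0]]) (use b(2) in simp)
    then show ?thesis using False K o by blast
  qed
qed

text \<open>An affine function of the coordinates, multiplied by a bump function. The derivative of the bump
  function does not contribute, since the affine function is 0 at \<open>x\<close>.\<close>

lemma function_with_differential:
  assumes \<gamma>: "linear (\<gamma> :: real^'m \<Rightarrow> real)"
  shows "\<exists>f. sm UNIV f \<and> f x = 0 \<and> differential A f x = \<gamma>"
proof -
  let ?c = "chart_at A x" let ?p = "snd ?c x"
  have c: "?c \<in> A" "x \<in> fst ?c" by (rule chart_at)+
  obtain b K where b: "closed K" "K \<subseteq> fst ?c" "sm UNIV b" "b x = (1::real)" "\<And>y. y \<notin> K \<Longrightarrow> b y = 0"
    using bump_exists[OF chart_props(1)[OF c(1)] c(2)] by blast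
  define s where "s y = \<gamma> (snd ?c y - ?p)" for y
  have bl: "bounded_linear \<gamma>" using \<gamma> by (rule bounded_linear_euclidean)
  have "smooth_on (snd ?c ` fst ?c) (\<lambda>q. \<gamma> (q + (- ?p)))"
    by (intro smooth_on_bounded_linear[OF chart_props(2)[OF c(1)] bl] smooth_on_add smooth_on_id smooth_on_const chart_props(2)[OF c(1)])
  then have "smooth_on (snd ?c ` fst ?c) (\<lambda>q. s (chart_inv ?c q))"
    by (rule smooth_on_cong[OF chart_props(2)[OF c(1)]]) (use chart_props(4)[OF c(1)] in \<open>auto simp: s_def\<close>)
  then have "sm (fst ?c) s" by (rule sm_one_chart[OF c(1) chart_props(1)[OF c(1)] order.refl])
  then have f: "sm UNIV (\<lambda>y. b y *\<^sub>R s y)"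
    using bump_extend[OF b(1,2,3,5) chart_props(1)[OF c(1)] open_UNIV, of s] by simp
  let ?f = "\<lambda>y. b y *\<^sub>R s y"
  have db: "((\<lambda>q. b (chart_inv ?c q)) has_derivative (\<lambda>u. differential A b x (from_chart A ?c x u))) (at ?p)"
    by (rule differential_chart(1)[OF b(3) c])
  have "((\<lambda>q. \<gamma> (q - ?p)) has_derivative (\<lambda>u. \<gamma> (u - 0))) (at ?p)"
    by (intro bounded_linear.has_derivative[OF bl] has_derivative_diff has_derivative_ident has_derivative_const)
  then have "((\<lambda>q. \<gamma> (q - ?p)) has_derivative \<gamma>) (at ?p)" by simp
  from has_derivative_scaleR[OF db this]
  have d1: "((\<lambda>q. b (chart_inv ?c q) *\<^sub>R \<gamma> (q - ?p)) has_derivative \<gamma>) (at ?p)"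
    using chart_props(4)[OF c] b(4) linear_0[OF \<gamma>] by simp
  have d2: "((\<lambda>q. ?f (chart_inv ?c q)) has_derivative \<gamma>) (at ?p)"
    by (rule has_derivative_transform_within_open[OF d1 chart_props(2)[OF c(1)]])
      (use c chart_props(4)[OF c(1)] in \<open>auto simp: s_def\<close>)
  have "differential A ?f x (from_chart A ?c x u) = \<gamma> u" for u
    using has_derivative_unique[OF differential_chart(1)[OF f c] d2] by metis
  moreover have "from_chart A ?c x u = u" for u by (simp add: from_chart_def chart_change_self c)
  ultimately have "differential A ?f x = \<gamma>" by auto
  moreover have "?f x = 0" by (simp add: s_def linear_0[OF \<gamma>])
  ultimately show ?thesis using f by blast
qed

end

section \<open>Positive definite matrices\<close>

lemma posdef_det_nonzero:
  fixes M :: "real^'m::finite^'m"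
  assumes "\<And>x. x \<noteq> 0 \<Longrightarrow> x \<bullet> (M *v x) > 0" shows "det M \<noteq> 0"
proof -
  have "\<forall>x. M *v x = 0 \<longrightarrow> x = 0" using assms by force
  then have "invertible M" unfolding invertible_left_inverse matrix_left_invertible_ker .
  then show ?thesis by (simp add: invertible_det_nz)
qed

text \<open>The determinant does not vanish on the segment from the identity to \<open>M\<close>.\<close>

lemma posdef_det_pos:
  fixes M :: "real^'m::finite^'m"
  assumes M: "\<And>x. x \<noteq> 0 \<Longrightarrow> x \<bullet> (M *v x) > 0" shows "det M > 0"
proof (rule ccontr)
  assume "\<not> det M > 0"
  let ?N = "\<lambda>t. (1 - t) *\<^sub>R (mat 1 :: real^'m^'m) + t *\<^sub>R M"
  have nz: "det (?N t) \<noteq> 0" if "0 \<le> t" "t \<le> 1" for t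
  proof (rule posdef_det_nonzero)
    fix x :: "real^'m" assume x: "x \<noteq> 0"
    have "x \<bullet> (?N t *v x) = (1 - t) * (x \<bullet> x) + t * (x \<bullet> (M *v x))"
      by (simp add: matrix_vector_mult_add_rdistrib scaleR_matrix_vector_assoc[symmetric] inner_add_right)
    moreover have "x \<bullet> x > 0" "x \<bullet> (M *v x) > 0" using x M by auto
    ultimately show "x \<bullet> (?N t *v x) > 0" using that
      by (cases "t = 0") (auto intro!: add_nonneg_pos mult_nonneg_nonneg mult_pos_pos)
  qed
  have "continuous_on {0..1} (\<lambda>t. det (?N t))"
    unfolding det_def by (intro continuous_intros)
  moreover have "det (?N 1) \<le> 0" "0 \<le> det (?N 0)" using \<open>\<not> det M > 0\<close> by simp_all
  ultimately obtain t where "0 \<le> t" "t \<le> 1" "det (?N t) = 0"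
    using IVT2'[of "\<lambda>t. det (?N t)" 1 0 0] by auto
  then show False using nz by blast
qed

section \<open>Smooth spinor fields\<close>

lemma bounded_bilinear_cscale: "bounded_bilinear ((*s) :: complex \<Rightarrow> complex^'r::finite \<Rightarrow> complex^'r)"
proof -
  have "bilinear ((*s) :: complex \<Rightarrow> complex^'r \<Rightarrow> complex^'r)"
    unfolding bilinear_def by (auto intro!: linearI simp: vec_eq_iff algebra_simps scaleR_conv_of_real[where 'a = complex])
  then show ?thesis by (simp add: bilinear_conv_bounded_bilinear)
qed

lemma of_real_cscale: "complex_of_real r *s (v :: complex^'r) = r *\<^sub>R v"
  by (simp add: vec_eq_iff scaleR_conv_of_real[where 'a = complex])

lemma pure_tensor_ops: "pure_tensor 0 \<xi> = 0" "pure_tensor (\<alpha> + \<beta>) \<xi> = pure_tensor \<alpha> \<xi> + pure_tensor \<beta> \<xi>"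
  "pure_tensor (form_scale a \<alpha>) \<xi> = pure_tensor \<alpha> (a *s \<xi>)"
  by (auto simp: pure_tensor_def pointwise form_scale_def vec_eq_iff algebra_simps)

context smooth_manifold
begin

lemma sm_prod: "open W \<Longrightarrow> (\<And>i. i \<in> S \<Longrightarrow> sm W (f i)) \<Longrightarrow> sm W (\<lambda>x. \<Prod>i\<in>S. f i x :: real)"
  by (induction S rule: infinite_finite_induct) (simp_all add: sm_const sm_mult)

lemma sm_det: "open W \<Longrightarrow> (\<And>i j. sm W (\<lambda>x. M x $ i $ j)) \<Longrightarrow> sm W (\<lambda>x. det (M x :: real^'k::finite^'k))"
  unfolding det_def by (intro sm_sum sm_mult sm_const sm_prod)

lemma sm_vec: "open W \<Longrightarrow> (\<And>i. sm W (f i)) \<Longrightarrow> sm W (\<lambda>x. (\<chi> i. f i x) :: real^'k::finite)"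
proof -
  assume W: "open W" "\<And>i. sm W (f i)"
  have "(\<chi> i. f i x) = (\<Sum>i\<in>UNIV. f i x *\<^sub>R axis i (1::real))" for x
    by (simp add: vec_eq_iff axis_def if_distrib[of "\<lambda>z. _ * z"] cong: if_cong)
  moreover have "sm W (\<lambda>x. \<Sum>i\<in>UNIV. f i x *\<^sub>R axis i (1::real))"
    using W by (intro sm_sum sm_scaleR sm_const)
  ultimately show ?thesis by simp
qed

lemma sm_cscale: "open W \<Longrightarrow> sm W f \<Longrightarrow> sm W v \<Longrightarrow> sm W (\<lambda>x. (f x :: complex) *s (v x :: complex^'k::finite))"
  by (rule sm_bilinear[OF _ bounded_bilinear_cscale])

lemma sm_of_real: "open W \<Longrightarrow> sm W f \<Longrightarrow> sm W (\<lambda>x. complex_of_real (f x))"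
  by (rule sm_linear[OF _ bounded_linear_of_real])

lemma linear_basis_expand:
  assumes "linear (f :: real^'m \<Rightarrow> 'b::real_vector)" shows "f u = (\<Sum>b\<in>Basis. (u \<bullet> b) *\<^sub>R f b)"
  by (subst euclidean_representation[of u, symmetric]) (simp only: linear_sum[OF assms] linear_cmul[OF assms])

lemma sm_covector_form:
  assumes "open N" "\<And>v. sm N (\<lambda>y. \<theta> y (F y v))"
  shows "sm N (\<lambda>y. covector_form (\<theta> y) (map (F y) us))"
  unfolding covector_form_def using assms by (cases us rule: remdups_adj.cases) (simp_all add: sm_const)

lemma sm_wedges:
  assumes N: "open N" and E: "\<And>\<eta> v. \<eta> \<in> set \<eta>s \<Longrightarrow> sm N (\<lambda>y. E \<eta> y (F y v))"
  shows "sm N (\<lambda>y. wedges (map (\<lambda>\<eta>. E \<eta> y) \<eta>s) (map (F y) vs))"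
  using E
proof (induction \<eta>s arbitrary: vs)
  case Nil then show ?case by (simp add: unit_form_def sm_const)
next
  case (Cons \<eta> \<eta>s)
  show ?case
    unfolding list.map wedges_Cons wedge_with_def nths_map length_map
    by (intro sm_sum sm_mult sm_const N sm_covector_form Cons.IH) (use Cons.prems in auto)
qed

end

locale spinor_bundle = smooth_manifold A for A :: "('x::t2_space, 'm::finite) chart set" +
  fixes J :: "'x \<Rightarrow> real^'m \<Rightarrow> real^'m" and g :: "'x \<Rightarrow> real^'m \<Rightarrow> real^'m \<Rightarrow> real" and n :: nat
    and Tr :: "('x, 'r::finite) triv set" and h :: "'x \<Rightarrow> complex^'r \<Rightarrow> complex^'r \<Rightarrow> complex"
  assumes X: "almost_hermitian_manifold A J g" and dim: "CARD('m) = 2 * n" and E: "hermitian_bundle A Tr h"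
begin

lemma spinor_space: "spinor_space (J x) (g x) n (h x)"
proof (intro spinor_space.intro hermitian_space.intro hermitian_metric.intro)
  show "linear (J x)" "J x (J x v) = - v" for v
    using X by (simp_all add: almost_hermitian_manifold_def almost_complex_structure_def)
  show "bilinear (g x)" "g x u v = g x v u" "v \<noteq> 0 \<Longrightarrow> 0 < g x v v" for u v
    using X by (simp_all add: almost_hermitian_manifold_def riemannian_metric_def)
  show "g x (J x u) (J x v) = g x u v" for u v using X by (simp add: almost_hermitian_manifold_def)
  show "CARD('m) = 2 * n" by (rule dim)
  show "h x (u + v) w = h x u w + h x v w" "h x (a *s u) w = a * h x u w" "h x v u = cnj (h x u v)"
    "v \<noteq> 0 \<Longrightarrow> 0 < Re (h x v v)" for u v w a
    using E unfolding hermitian_bundle_def by blast+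
qed

lemma J_smooth: "c \<in> A \<Longrightarrow> sm (fst c) (\<lambda>x. to_chart A c x (J x (from_chart A c x u)))"
  using X by (simp add: almost_hermitian_manifold_def almost_complex_structure_def)

lemma g_smooth: "c \<in> A \<Longrightarrow> sm (fst c) (\<lambda>x. g x (from_chart A c x u) (from_chart A c x v))"
  using X by (simp add: almost_hermitian_manifold_def riemannian_metric_def)

lemma vector_bundle: "complex_vector_bundle A Tr"
  using E unfolding hermitian_bundle_def by (rule conjunct1)

lemmas vector_bundle_props =
  vector_bundle[unfolded complex_vector_bundle_def, THEN conjunct1]
  vector_bundle[unfolded complex_vector_bundle_def, THEN conjunct2, THEN conjunct1]
  vector_bundle[unfolded complex_vector_bundle_def, THEN conjunct2, THEN conjunct2]

lemma triv_cover: "\<exists>tr\<in>Tr. x \<in> fst tr"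
  using vector_bundle_props(1) by (metis UNIV_I UN_iff)

lemma triv_props:
  assumes "tr \<in> Tr"
  shows "open (fst tr)" "x \<in> fst tr \<Longrightarrow> bij (snd tr x)"
    "x \<in> fst tr \<Longrightarrow> snd tr x (u + v) = snd tr x u + snd tr x v" "x \<in> fst tr \<Longrightarrow> snd tr x (a *s v) = a *s snd tr x v"
    "x \<in> fst tr \<Longrightarrow> snd tr x (r *\<^sub>R v) = r *\<^sub>R snd tr x v"
    "x \<in> fst tr \<Longrightarrow> snd tr x (u - v) = snd tr x u - snd tr x v"
    "x \<in> fst tr \<Longrightarrow> snd tr x (\<Sum>i\<in>S. f i) = (\<Sum>i\<in>S. snd tr x (f i))"
    "x \<in> fst tr \<Longrightarrow> linear (snd tr x)"
proof -
  have T: "\<forall>(W, t)\<in>Tr. open W \<and> (\<forall>x\<in>W. bij (t x) \<and>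
        (\<forall>u v. t x (u + v) = t x u + t x v) \<and> (\<forall>a v. t x (a *s v) = a *s t x v))"
    by (rule vector_bundle_props(2))
  show o: "open (fst tr)" "x \<in> fst tr \<Longrightarrow> bij (snd tr x)"
    and a: "x \<in> fst tr \<Longrightarrow> snd tr x (u + v) = snd tr x u + snd tr x v"
    and s: "x \<in> fst tr \<Longrightarrow> snd tr x (a *s v) = a *s snd tr x v" for u v a
    using bspec[OF T assms] by (simp_all add: split_beta)
  show l: "x \<in> fst tr \<Longrightarrow> linear (snd tr x)"
    using a s by (intro linearI) (simp_all flip: of_real_cscale)
  show "x \<in> fst tr \<Longrightarrow> snd tr x (r *\<^sub>R v) = r *\<^sub>R snd tr x v"
    "x \<in> fst tr \<Longrightarrow> snd tr x (u - v) = snd tr x u - snd tr x v"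
    "x \<in> fst tr \<Longrightarrow> snd tr x (\<Sum>i\<in>S. f i) = (\<Sum>i\<in>S. snd tr x (f i))"
    using l by (simp_all add: linear_cmul linear_diff linear_sum)
qed

lemma triv_transition: "tr \<in> Tr \<Longrightarrow> tr' \<in> Tr \<Longrightarrow> sm (fst tr \<inter> fst tr') (\<lambda>x. snd tr' x (inv (snd tr x) v))"
proof -
  assume tr: "tr \<in> Tr" "tr' \<in> Tr"
  have "\<forall>(W, t)\<in>Tr. \<forall>(W', t')\<in>Tr. \<forall>v. sm (W \<inter> W') (\<lambda>x. t' x (inv (t x) v))"
    by (rule vector_bundle_props(3))
  from bspec[OF this tr(1), unfolded split_beta, THEN bspec, OF tr(2)] show ?thesis by (simp add: split_beta)
qed

abbreviation fields :: "(nat \<Rightarrow> bool) \<Rightarrow> ('x \<Rightarrow> ('m, complex^'r) form) set" where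
  "fields P \<equiv> spinorE_fields A Tr J P"

lemma fields_iff: "s \<in> fields P \<longleftrightarrow> (\<forall>x. s x \<in> spinorsE (J x) P) \<and>
   (\<forall>c\<in>A. \<forall>tr\<in>Tr. \<forall>vs. sm (fst c \<inter> fst tr) (\<lambda>x. snd tr x (s x (map (from_chart A c x) vs))))"
  by (auto simp: spinorE_fields_def smooth_formE_def split_beta)

lemma open_Int_domains: "c \<in> A \<Longrightarrow> tr \<in> Tr \<Longrightarrow> open (fst c \<inter> fst tr)"
  using chart_props(1) triv_props(1) by (simp add: open_Int)

lemma fields_zero: "(\<lambda>x. 0) \<in> fields P"
proof -
  have "sm (fst c \<inter> fst tr) (\<lambda>x. snd tr x (0 :: complex^'r))" if "c \<in> A" "tr \<in> Tr" for c tr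
    by (rule sm_cong[OF open_Int_domains[OF that] sm_const[of _ 0]])
      (use triv_props(8)[OF that(2)] in \<open>simp add: linear_0\<close>)
  then show ?thesis by (simp add: fields_iff spinorsE_ops zero_fun_apply)
qed

lemma fields_add: "s \<in> fields P \<Longrightarrow> s' \<in> fields P \<Longrightarrow> (\<lambda>x. s x + s' x) \<in> fields P"
proof -
  assume s: "s \<in> fields P" "s' \<in> fields P"
  have "sm (fst c \<inter> fst tr) (\<lambda>x. snd tr x ((s x + s' x) (map (from_chart A c x) vs)))" if "c \<in> A" "tr \<in> Tr" for c tr vs
    by (rule sm_cong[OF open_Int_domains[OF that] sm_add[OF open_Int_domains[OF that]]])
      (use s that triv_props(3)[OF that(2)] in \<open>auto simp: fields_iff plus_fun_apply\<close>)
  then show ?thesis using s by (simp add: fields_iff spinorsE_ops)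
qed

lemma fields_scale:
  assumes f: "sm UNIV (f :: 'x \<Rightarrow> real)" and s: "s \<in> fields P"
  shows "(\<lambda>x. formE_scale (complex_of_real (f x)) (s x)) \<in> fields P"
proof -
  have "sm (fst c \<inter> fst tr) (\<lambda>x. snd tr x (formE_scale (complex_of_real (f x)) (s x) (map (from_chart A c x) vs)))"
    if "c \<in> A" "tr \<in> Tr" for c tr vs
  proof (rule sm_cong[OF open_Int_domains[OF that]])
    show "sm (fst c \<inter> fst tr) (\<lambda>x. f x *\<^sub>R snd tr x (s x (map (from_chart A c x) vs)))"
      using s that by (intro sm_scaleR open_Int_domains sm_subset[OF f]) (auto simp: fields_iff)
  qed (use triv_props(5)[OF that(2)] in \<open>simp add: formE_scale_def of_real_cscale\<close>)
  then show ?thesis using s by (simp add: fields_iff spinorsE_ops)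
qed

lemma fields_diff: "s \<in> fields P \<Longrightarrow> s' \<in> fields P \<Longrightarrow> (\<lambda>x. s x - s' x) \<in> fields P"
proof -
  assume s: "s \<in> fields P" "s' \<in> fields P"
  have "formE_scale (complex_of_real (-1)) (s' x) = - s' x" for x
    by (rule ext) (simp add: formE_scale_def pointwise vec_eq_iff)
  then show ?thesis using fields_add[OF s(1) fields_scale[OF sm_const[of _ "-1"] s(2)]] by simp
qed

text \<open>Each \<open>\<eta>\<close> is extended with constant coefficients in a chart and then projected to type (0,1); the
  vector \<open>\<xi>\<close> is extended with constant coefficients in a trivialization. A bump function makes the
  product global.\<close>

lemma field_generator:
  assumes \<eta>s: "\<forall>\<eta>\<in>set \<eta>s. type01 (J x) \<eta>" and P: "P (length \<eta>s)"
  shows "\<exists>s\<in>fields P. s x = pure_tensor (wedges \<eta>s) \<xi>"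
proof -
  let ?c = "chart_at A x"
  have c: "?c \<in> A" "x \<in> fst ?c" by (rule chart_at)+
  obtain tr where tr: "tr \<in> Tr" "x \<in> fst tr" using triv_cover by blast
  let ?Q = "fst ?c \<inter> fst tr"
  obtain b K where b: "closed K" "K \<subseteq> ?Q" "sm UNIV b" "b x = (1::real)" "\<And>y. y \<notin> K \<Longrightarrow> b y = 0"
    using bump_exists[OF open_Int_domains[OF c(1) tr(1)], of x] c tr by blast
  define \<kappa> :: "(real^'m \<Rightarrow> complex) \<Rightarrow> 'x \<Rightarrow> real^'m \<Rightarrow> complex" where
    "\<kappa> \<eta> y v = \<eta> (from_chart A ?c x (to_chart A ?c y v))" for \<eta> y v
  \<comment> \<open>the projection of \<open>\<kappa>\<close> to type (0,1); it does not change \<open>\<eta>\<close> at \<open>x\<close> itself\<close>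
  define F :: "(real^'m \<Rightarrow> complex) \<Rightarrow> 'x \<Rightarrow> real^'m \<Rightarrow> complex" where
    "F \<eta> y v = (1 / 2) * (\<kappa> \<eta> y v + \<i> * \<kappa> \<eta> y (J y v))" for \<eta> y v
  define s where "s y = formE_scale (complex_of_real (b y))
      (pure_tensor (wedges (map (\<lambda>\<eta>. F \<eta> y) \<eta>s)) (inv (snd tr y) (snd tr x \<xi>)))" for y
  have lin: "linear \<eta>" if "\<eta> \<in> set \<eta>s" for \<eta> using \<eta>s that by (simp add: type01_def)
  have \<eta>': "linear (\<lambda>u. \<eta> (from_chart A ?c x u))" if "\<eta> \<in> set \<eta>s" for \<eta>
    using linear_compose[OF from_chart_linear[OF c] lin[OF that]] by (simp add: o_def)
  have \<kappa>lin: "linear (\<kappa> \<eta> y)" if "\<eta> \<in> set \<eta>s" "y \<in> fst ?c" for \<eta> y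
    using linear_compose[OF to_chart_linear[OF c(1) that(2)] \<eta>'[OF that(1)]] unfolding \<kappa>_def[abs_def] o_def .
  have type: "type01 (J y) (F \<eta> y)" if "\<eta> \<in> set \<eta>s" "y \<in> fst ?c" for \<eta> y
  proof -
    interpret S: spinor_space "J y" "g y" n "h y" by (rule spinor_space)
    note l = \<kappa>lin[OF that]
    have "linear (F \<eta> y)"
      by (rule linearI) (simp_all add: F_def S.J_simps linear_add[OF l] linear_cmul[OF l] scaleR_conv_of_real[where 'a = complex] algebra_simps)
    moreover have "F \<eta> y (J y v) = - \<i> * F \<eta> y v" for v
      by (simp add: F_def linear_neg[OF l] algebra_simps)
    ultimately show ?thesis by (simp add: type01_def)
  qed
  have Fsm: "sm (fst ?c \<inter> fst d) (\<lambda>y. F \<eta> y (from_chart A d y v))" if \<eta>: "\<eta> \<in> set \<eta>s" and d: "d \<in> A" for \<eta> d v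
  proof (rule sm_cong)
    let ?N = "fst ?c \<inter> fst d" let ?j = "\<lambda>y. to_chart A d y (J y (from_chart A d y v))"
    show N: "open ?N" using chart_props(1)[OF c(1)] chart_props(1)[OF d] by (rule open_Int)
    have cc: "sm ?N (\<lambda>y. chart_change d ?c y u)" for u
      using chart_change_smooth[OF d c(1), of u] by (simp add: Int_commute)
    have j: "sm ?N (\<lambda>y. ?j y \<bullet> b)" for b
      by (rule sm_linear[OF N bounded_linear_inner_left sm_subset[OF J_smooth[OF d]]]) simp
    have bl: "bounded_linear (\<lambda>u. \<eta> (from_chart A ?c x u))" using \<eta>'[OF \<eta>] by (rule bounded_linear_euclidean)
    show "sm ?N (\<lambda>y. (1 / 2) * (\<eta> (from_chart A ?c x (chart_change d ?c y v)) +
        \<i> * \<eta> (from_chart A ?c x (\<Sum>b\<in>Basis. (?j y \<bullet> b) *\<^sub>R chart_change d ?c y b))))"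
      by (intro sm_mult sm_add sm_const sm_linear[OF N bl] sm_sum sm_scaleR N cc j)
    fix y assume y: "y \<in> ?N"
    have "to_chart A ?c y (J y (from_chart A d y v)) = to_chart A ?c y (from_chart A d y (?j y))"
      using from_to_chart[OF d] y by simp
    also have "\<dots> = chart_change d ?c y (?j y)" using to_chart_from_chart[OF d c(1)] y by simp
    also have "\<dots> = (\<Sum>b\<in>Basis. (?j y \<bullet> b) *\<^sub>R chart_change d ?c y b)"
      by (rule linear_basis_expand) (use chart_change_linear[OF d c(1)] y in simp)
    finally have e: "to_chart A ?c y (J y (from_chart A d y v)) = (\<Sum>b\<in>Basis. (?j y \<bullet> b) *\<^sub>R chart_change d ?c y b)" .
    show "(1 / 2) * (\<eta> (from_chart A ?c x (chart_change d ?c y v)) +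
        \<i> * \<eta> (from_chart A ?c x (\<Sum>b\<in>Basis. (?j y \<bullet> b) *\<^sub>R chart_change d ?c y b))) = F \<eta> y (from_chart A d y v)"
      unfolding F_def \<kappa>_def e using to_chart_from_chart[OF d c(1)] y by simp
  qed
  have "s \<in> fields P"
    unfolding fields_iff
  proof (intro conjI allI ballI)
    fix y show "s y \<in> spinorsE (J y) P"
    proof (cases "y \<in> K")
      case True
      have "wedges (map (\<lambda>\<eta>. F \<eta> y) \<eta>s) \<in> Lambda (J y) 0 (length \<eta>s)"
        using Lambda0_wedges[of "map (\<lambda>\<eta>. F \<eta> y) \<eta>s" "J y"] type b(2) True by auto
      then have w: "wedges (map (\<lambda>\<eta>. F \<eta> y) \<eta>s) \<in> spinors (J y) P" using P by (rule Lambda_spinors)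
      have "coord (s y) i = form_scale (complex_of_real (b y) * inv (snd tr y) (snd tr x \<xi>) $ i) (wedges (map (\<lambda>\<eta>. F \<eta> y) \<eta>s))" for i
        by (rule ext) (simp add: s_def formE_scale_def pure_tensor_def form_scale_def)
      then show ?thesis using w by (simp add: spinorsE_iff spinors_scale)
    next
      case False
      then have "s y = 0" using b(5) by (intro ext) (simp add: s_def formE_scale_def zero_fun_apply)
      then show ?thesis by (simp add: spinorsE_ops)
    qed
  next
    fix d tr' vs assume d: "d \<in> A" and tr': "tr' \<in> Tr"
    let ?W = "fst d \<inter> fst tr'"
    let ?s = "\<lambda>y. wedges (map (\<lambda>\<eta>. F \<eta> y) \<eta>s) (map (from_chart A d y) vs) *s snd tr' y (inv (snd tr y) (snd tr x \<xi>))"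
    have o: "open ?W" "open ?Q" using open_Int_domains d tr' c tr by auto
    have oN: "open (?Q \<inter> ?W)" by (rule open_Int[OF o(2,1)])
    have sQ: "sm (?Q \<inter> ?W) ?s"
    proof (intro sm_cscale oN sm_wedges)
      show "sm (?Q \<inter> ?W) (\<lambda>y. snd tr' y (inv (snd tr y) (snd tr x \<xi>)))"
        by (rule sm_subset[OF triv_transition[OF tr(1) tr']]) auto
      show "sm (?Q \<inter> ?W) (\<lambda>y. F \<eta> y (from_chart A d y v))" if "\<eta> \<in> set \<eta>s" for \<eta> v
        by (rule sm_subset[OF Fsm[OF that d]]) auto
    qed
    have "sm ?W (\<lambda>y. b y *\<^sub>R ?s y)"
      by (rule bump_extend[OF b(1,2,3) _ o(2,1) sQ]) (rule b(5))
    then show "sm ?W (\<lambda>y. snd tr' y (s y (map (from_chart A d y) vs)))"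
      by (rule sm_cong[OF o(1)])
        (use triv_props(4)[OF tr'] in \<open>auto simp: s_def formE_scale_def pure_tensor_def simp flip: of_real_cscale\<close>)
  qed
  moreover have "s x = pure_tensor (wedges \<eta>s) \<xi>"
  proof -
    have "F \<eta> x = \<eta>" if "\<eta> \<in> set \<eta>s" for \<eta>
    proof
      fix v
      have "\<eta> (J x v) = - \<i> * \<eta> v" using \<eta>s that by (simp add: type01_def)
      then show "F \<eta> x v = \<eta> v" by (simp add: F_def \<kappa>_def from_to_chart[OF c])
    qed
    then have "map (\<lambda>\<eta>. F \<eta> x) \<eta>s = \<eta>s" by (simp add: map_idI)
    moreover have "inv (snd tr x) (snd tr x \<xi>) = \<xi>" using triv_props(2)[OF tr] by (simp add: bij_is_inj)
    ultimately show ?thesis by (simp add: s_def b(4)) (simp add: formE_scale_def)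
  qed
  ultimately show ?thesis by blast
qed

text \<open>The values of spinor fields at \<open>x\<close> form a vector space, so it suffices to attain products.\<close>

theorem field_with_value:
  assumes e: "e \<in> spinorsE (J x) P" shows "\<exists>s\<in>fields P. s x = e"
proof -
  interpret S: spinor_space "J x" "g x" n "h x" by (rule spinor_space)
  define R where "R \<alpha> \<longleftrightarrow> (\<forall>\<xi>. \<exists>s\<in>fields P. s x = pure_tensor \<alpha> \<xi>)" for \<alpha>
  have R0: "R 0" unfolding R_def using fields_zero by (force simp: pure_tensor_ops)
  have Radd: "R (\<alpha> + \<beta>)" if "R \<alpha>" "R \<beta>" for \<alpha> \<beta>
    unfolding R_def
  proof
    fix \<xi>
    obtain s s' where "s \<in> fields P" "s x = pure_tensor \<alpha> \<xi>" "s' \<in> fields P" "s' x = pure_tensor \<beta> \<xi>"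
      using \<open>R \<alpha>\<close> \<open>R \<beta>\<close> unfolding R_def by blast
    then show "\<exists>s\<in>fields P. s x = pure_tensor (\<alpha> + \<beta>) \<xi>"
      by (intro bexI[OF _ fields_add[of s P s']]) (simp_all add: pure_tensor_ops)
  qed
  have RL: "R \<alpha>" if P: "P q" and \<alpha>: "\<alpha> \<in> Lambda (J x) 0 q" for \<alpha> q
  proof (rule Lambda0_induct[OF \<alpha>, where R = R])
    fix \<omega> \<eta>s a assume "R \<omega>" "length \<eta>s = q" "\<forall>\<eta>\<in>set \<eta>s. type01 (J x) \<eta>"
    then have "R (form_scale a (wedges \<eta>s))"
      unfolding R_def pure_tensor_ops using field_generator[of \<eta>s x P] P by blast
    then show "R (\<omega> + form_scale a (wedges \<eta>s))" using Radd \<open>R \<omega>\<close> by blast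
  qed (rule R0)
  have R: "R (coord e i)" for i
    by (rule S.spinors_linear_induct[where R = R, of _ P]) (use e R0 Radd RL in \<open>auto simp: spinorsE_iff\<close>)
  have "\<exists>s\<in>fields P. s x = (\<Sum>i\<in>I. pure_tensor (coord e i) (axis i 1))" for I
  proof (induction I rule: infinite_finite_induct)
    case (insert i I)
    obtain s s' where "s \<in> fields P" "s x = pure_tensor (coord e i) (axis i 1)"
      "s' \<in> fields P" "s' x = (\<Sum>i\<in>I. pure_tensor (coord e i) (axis i 1))"
      using R insert.IH unfolding R_def by blast
    then show ?case using insert.hyps by (intro bexI[OF _ fields_add[of s P s']]) simp_all
  qed (use fields_zero in force)+
  moreover have "(\<Sum>i\<in>UNIV. pure_tensor (coord e i) (axis i 1)) = e"
    by (rule ext) (use S.vec_expand[symmetric] in \<open>simp add: fun_sum_apply pure_tensor_def\<close>)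
  ultimately show ?thesis by metis
qed

section \<open>Clifford multiplication by the differential of a function\<close>

definition gram :: "('x, 'm) chart \<Rightarrow> 'x \<Rightarrow> real^'m^'m" where
  "gram c y = (\<chi> i j. g y (from_chart A c y (axis i 1)) (from_chart A c y (axis j 1)))"

lemma from_chart_axis:
  assumes "c \<in> A" "y \<in> fst c"
  shows "from_chart A c y u = (\<Sum>j\<in>UNIV. u $ j *\<^sub>R from_chart A c y (axis j 1))"
proof -
  have l: "linear (from_chart A c y)" by (rule from_chart_linear[OF assms])
  have "u = (\<Sum>j\<in>UNIV. u $ j *\<^sub>R axis j 1)"
    by (simp add: vec_eq_iff axis_def if_distrib[of "\<lambda>z. _ * z"] cong: if_cong)
  then have "from_chart A c y u = from_chart A c y (\<Sum>j\<in>UNIV. u $ j *\<^sub>R axis j 1)" by (rule arg_cong)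
  then show ?thesis by (simp only: linear_sum[OF l] linear_cmul[OF l])
qed

lemma gram_vector:
  assumes "c \<in> A" "y \<in> fst c"
  shows "(gram c y *v u) $ i = g y (from_chart A c y (axis i 1)) (from_chart A c y u)"
proof -
  interpret S: spinor_space "J y" "g y" n "h y" by (rule spinor_space)
  show ?thesis
    unfolding from_chart_axis[OF assms, of u] S.g_sum S.g_simps
    by (simp add: gram_def matrix_vector_mult_def mult.commute)
qed

lemma gram_det_pos:
  assumes "c \<in> A" "y \<in> fst c" shows "det (gram c y) > 0"
proof (rule posdef_det_pos)
  interpret S: spinor_space "J y" "g y" n "h y" by (rule spinor_space)
  fix u :: "real^'m" assume "u \<noteq> 0"
  then have "from_chart A c y u \<noteq> 0"
    using to_from_chart[OF assms, of u] linear_0[OF to_chart_linear[OF assms]] by auto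
  then have "0 < g y (from_chart A c y u) (from_chart A c y u)" by (rule S.g_pos)
  also have "\<dots> = u \<bullet> (gram c y *v u)"
    unfolding inner_vec_def gram_vector[OF assms]
    by (subst (1) from_chart_axis[OF assms]) (simp only: S.g_sum S.g_simps inner_real_def)
  finally show "u \<bullet> (gram c y *v u) > 0" .
qed

lemma gram_smooth: "c \<in> A \<Longrightarrow> sm (fst c) (\<lambda>y. gram c y $ i $ j)"
  using g_smooth by (simp add: gram_def)

text \<open>The coordinates of the vector dual to a covector solve a linear system with the Gram matrix. By the
  rule of Cramer they are smooth if the coefficients of the covector are.\<close>

lemma dual_smooth:
  assumes c: "c \<in> A" and N: "open N" "N \<subseteq> fst c"
    and a: "\<And>y. y \<in> N \<Longrightarrow> linear (a y)" "\<And>v. sm N (\<lambda>y. a y (from_chart A c y v))"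
  shows "\<exists>G. sm N G \<and> (\<forall>y\<in>N. \<forall>v. g y (from_chart A c y (G y)) v = (a y v :: real))"
proof -
  let ?F = "from_chart A c"
  define r :: "'x \<Rightarrow> real^'m" where "r y = (\<chi> i. a y (?F y (axis i 1)))" for y
  define G :: "'x \<Rightarrow> real^'m" where
    "G y = (\<chi> k. det (\<chi> i j. if j = k then r y $ i else gram c y $ i $ j) * inverse (det (gram c y)))" for y
  have Ms: "sm N (\<lambda>y. gram c y $ i $ j)" for i j by (rule sm_subset[OF gram_smooth[OF c] N(2)])
  have rs: "sm N (\<lambda>y. r y $ i)" for i using a(2) by (simp add: r_def)
  have nz: "det (gram c y) \<noteq> 0" if "y \<in> N" for y
    using gram_det_pos[OF c, of y] N(2) that by auto
  have "sm N G"
    unfolding G_def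
  proof (intro sm_vec sm_mult sm_inverse sm_det N(1) Ms nz)
    show "sm N (\<lambda>y. (\<chi> i j. if j = k then r y $ i else gram c y $ i $ j) $ i $ j)" for k i j
      using rs Ms by (cases "j = k") simp_all
  qed
  moreover have "g y (?F y (G y)) v = a y v" if y: "y \<in> N" for y v
  proof -
    interpret S: spinor_space "J y" "g y" n "h y" by (rule spinor_space)
    have yc: "y \<in> fst c" using N(2) y by blast
    have "gram c y *v G y = r y" unfolding cramer[OF nz[OF y]] by (simp add: G_def divide_inverse)
    then have i: "g y (?F y (axis i 1)) (?F y (G y)) = a y (?F y (axis i 1))" for i
      using gram_vector[OF c yc, of "G y" i] by (simp add: r_def)
    let ?u = "to_chart A c y v"
    have v: "v = (\<Sum>j\<in>UNIV. ?u $ j *\<^sub>R ?F y (axis j 1))"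
      using from_chart_axis[OF c yc, of ?u] from_to_chart[OF c yc, of v] by simp
    have "g y (?F y (G y)) v = g y v (?F y (G y))" by (rule S.g_sym)
    also have "\<dots> = (\<Sum>j\<in>UNIV. ?u $ j * g y (?F y (axis j 1)) (?F y (G y)))"
      by (subst v) (simp only: S.g_sum S.g_simps)
    also have "\<dots> = a y (\<Sum>j\<in>UNIV. ?u $ j *\<^sub>R ?F y (axis j 1))"
      by (simp add: i linear_sum[OF a(1)[OF y]] linear_cmul[OF a(1)[OF y]])
    finally show ?thesis using v by simp
  qed
  ultimately show ?thesis by blast
qed

text \<open>Only the contraction needs an argument: its two vectors are dual to multiples of \<open>df\<close> and \<open>df \<circ> J\<close>.\<close>

theorem fields_clifford:
  assumes f: "sm UNIV (f :: 'x \<Rightarrow> real)" and s: "s \<in> fields odd"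
  shows "(\<lambda>y. tensor_Id (clifford (J y) (g y) (differential A f y)) (s y)) \<in> fields even"
  unfolding fields_iff
proof (intro conjI allI ballI)
  have df: "linear (differential A f y)" for y using differential_chart(2)[OF f] chart_at by blast
  fix x
  interpret S: spinor_space "J x" "g x" n "h x" by (rule spinor_space)
  show "tensor_Id (clifford (J x) (g x) (differential A f x)) (s x) \<in> spinorsE (J x) even"
    using S.cE_spinorsE(2)[OF df] s by (simp add: fields_iff)
next
  fix c tr vs assume c: "c \<in> A" and tr: "tr \<in> Tr"
  let ?N = "fst c \<inter> fst tr" let ?F = "from_chart A c" let ?d = "differential A f"
  have df: "linear (?d y)" for y using differential_chart(2)[OF f] chart_at by blast
  have N: "open ?N" "?N \<subseteq> fst c" using open_Int_domains[OF c tr] by auto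
  define T where "T us y = snd tr y (s y (map (?F y) us))" for us y
  have Ts: "sm ?N (T us)" for us using s c tr by (simp add: fields_iff T_def[abs_def])
  have Fl: "linear (?F y)" if "y \<in> ?N" for y using from_chart_linear[OF c] that by blast
  have d1: "sm ?N (\<lambda>y. ?d y (?F y v))" for v by (rule sm_subset[OF differential_smooth[OF f c] N(2)])
  have d2: "sm ?N (\<lambda>y. ?d y (J y (?F y v)))" for v
  proof (rule sm_cong[OF N(1)])
    let ?j = "\<lambda>y. to_chart A c y (J y (?F y v))"
    have "sm ?N (\<lambda>y. ?j y \<bullet> b)" for b
      by (rule sm_linear[OF N(1) bounded_linear_inner_left sm_subset[OF J_smooth[OF c] N(2)]])
    then show "sm ?N (\<lambda>y. \<Sum>b\<in>Basis. (?j y \<bullet> b) *\<^sub>R ?d y (?F y b))" by (intro sm_sum sm_scaleR N(1) d1)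
    fix y assume y: "y \<in> ?N"
    have "?d y (J y (?F y v)) = ?d y (?F y (?j y))" using from_to_chart[OF c] y by simp
    also have "\<dots> = (\<Sum>b\<in>Basis. (?j y \<bullet> b) *\<^sub>R ?d y (?F y b))"
      using linear_basis_expand[OF linear_compose[OF Fl[OF y] df[of y]], of "?j y"] by (simp only: o_def)
    finally show "(\<Sum>b\<in>Basis. (?j y \<bullet> b) *\<^sub>R ?d y (?F y b)) = ?d y (J y (?F y v))" by simp
  qed
  have Jl: "linear (J y)" for y using X by (simp add: almost_hermitian_manifold_def almost_complex_structure_def)
  have dJ: "linear (\<lambda>v. ?d y (J y v))" for y using linear_compose[OF Jl df, of y y] by (simp only: o_def)
  have "\<exists>G. sm ?N G \<and> (\<forall>y\<in>?N. \<forall>v. g y (?F y (G y)) v = (1 / 2) *\<^sub>R ?d y v)"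
    by (rule dual_smooth[OF c N linear_compose_scale_right[OF df] sm_scaleR[OF N(1) sm_const d1]])
  then obtain G1 where G1: "sm ?N G1" "\<And>y v. y \<in> ?N \<Longrightarrow> g y (?F y (G1 y)) v = (1 / 2) *\<^sub>R ?d y v" by blast
  have "\<exists>G. sm ?N G \<and> (\<forall>y\<in>?N. \<forall>v. g y (?F y (G y)) v = (- 1 / 2) *\<^sub>R ?d y (J y v))"
    by (rule dual_smooth[OF c N linear_compose_scale_right[OF dJ] sm_scaleR[OF N(1) sm_const d2]])
  then obtain G2 where G2: "sm ?N G2" "\<And>y v. y \<in> ?N \<Longrightarrow> g y (?F y (G2 y)) v = (- 1 / 2) *\<^sub>R ?d y (J y v)" by blast
  let ?sg = "\<lambda>S. (-1) ^ card {(i, j). i \<in> S \<and> j < i \<and> j \<notin> S} :: complex"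
  show "sm ?N (\<lambda>y. snd tr y (tensor_Id (clifford (J y) (g y) (?d y)) (s y) (map (?F y) vs)))"
  proof (rule sm_cong[OF N(1)])
    have th: "sm ?N (\<lambda>y. part01 (J y) (?d y) (?F y v))" for v
    proof -
      have "sm ?N (\<lambda>y. (1 / 2) * (complex_of_real (?d y (?F y v)) + \<i> * complex_of_real (?d y (J y (?F y v)))))"
        by (intro sm_mult sm_add sm_const sm_of_real N(1) d1 d2)
      then show ?thesis by (simp add: part01_def)
    qed
    show "sm ?N (\<lambda>y. complex_of_real (sqrt 2) *s
       ((\<Sum>S\<in>Pow {..<length vs}. (?sg S * covector_form (part01 (J y) (?d y)) (map (?F y) (nths vs S))) *s T (nths vs (- S)) y)
        - ((\<Sum>b\<in>Basis. (G1 y \<bullet> b) *\<^sub>R T (b # vs) y) + \<i> *s (\<Sum>b\<in>Basis. (G2 y \<bullet> b) *\<^sub>R T (b # vs) y))))"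
      by (intro sm_cscale sm_diff sm_add sm_sum sm_mult sm_const sm_scaleR N(1) Ts sm_covector_form th
          sm_linear[OF N(1) bounded_linear_inner_left] G1(1) G2(1))
    fix y assume y: "y \<in> ?N"
    interpret S: spinor_space "J y" "g y" n "h y" by (rule spinor_space)
    let ?w = "sharp (g y) (part10 (J y) (?d y))"
    have p10: "linear (part10 (J y) (?d y))"
      using S.linear_cnj[OF S.part_types(2)[OF df]] unfolding S.part_types(3)[OF df] .
    have w: "fst ?w = ?F y (G1 y)" "snd ?w = ?F y (G2 y)"
      by (rule S.g_ext, simp add: S.sharp_components[OF p10] G1(2)[OF y] G2(2)[OF y] part10_def)+
    have sl: "snd tr y (s y (?F y u # map (?F y) vs)) = (\<Sum>b\<in>Basis. (u \<bullet> b) *\<^sub>R T (b # vs) y)" for u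
    proof -
      have "linear (\<lambda>v. s y (v # map (?F y) vs) $ i)" for i
      proof -
        have "alt_slots linear (coord (s y) i)"
          by (rule S.spinors_alt[of _ odd]) (use s in \<open>simp add: fields_iff spinorsE_iff\<close>)
        then have "linear (\<lambda>v. coord (s y) i ([] @ v # map (?F y) vs))" unfolding alt_slots_def by blast
        then show ?thesis by simp
      qed
      then have "linear (\<lambda>v. s y (v # map (?F y) vs))"
        by (auto simp: linear_iff vec_eq_iff)
      from linear_compose[OF Fl[OF y] linear_compose[OF this triv_props(8)[OF tr, of y]]] y
      have "linear (\<lambda>u. snd tr y (s y (?F y u # map (?F y) vs)))" by (simp add: o_def)
      from linear_basis_expand[OF this, of u] show ?thesis by (simp add: T_def)
    qed
    have e: "tensor_Id (clifford (J y) (g y) (?d y)) (s y) us = complex_of_real (sqrt 2) *s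
       ((\<Sum>S\<in>Pow {..<length us}. (?sg S * covector_form (part01 (J y) (?d y)) (nths us S)) *s s y (nths us (- S)))
        - (s y (fst ?w # us) + \<i> *s s y (snd ?w # us)))" for us
      by (simp add: vec_eq_iff tensor_Id_def clifford_def wedge_with_def contract_def mult.assoc right_diff_distrib distrib_left)
    show "complex_of_real (sqrt 2) *s
       ((\<Sum>S\<in>Pow {..<length vs}. (?sg S * covector_form (part01 (J y) (?d y)) (map (?F y) (nths vs S))) *s T (nths vs (- S)) y)
        - ((\<Sum>b\<in>Basis. (G1 y \<bullet> b) *\<^sub>R T (b # vs) y) + \<i> *s (\<Sum>b\<in>Basis. (G2 y \<bullet> b) *\<^sub>R T (b # vs) y))) =
       snd tr y (tensor_Id (clifford (J y) (g y) (?d y)) (s y) (map (?F y) vs))"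
      unfolding e w length_map nths_map using y
      by (simp only: triv_props(3,4,6,7)[OF tr] Int_iff sl) (simp only: T_def)
  qed
qed

end

section \<open>The Dirac operator and its principal symbol\<close>

context hermitian_space
begin

lemma clifford_covector_add:
  assumes \<gamma>: "linear \<gamma>" "linear \<gamma>'" and \<alpha>: "alt_slots linear \<alpha>"
  shows "clifford J g (\<lambda>v. \<gamma> v + \<gamma>' v) \<alpha> = clifford J g \<gamma> \<alpha> + clifford J g \<gamma>' \<alpha>"
proof -
  have l: "linear (\<lambda>v. \<gamma> v + \<gamma>' v)" using linear_plus[OF \<gamma>] by (simp add: plus_fun_def)
  have p: "part01 J (\<lambda>v. \<gamma> v + \<gamma>' v) = (\<lambda>v. part01 J \<gamma> v + part01 J \<gamma>' v)"
    by (rule ext) (simp add: part01_def field_simps)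
  have c: "covector_form (part01 J (\<lambda>v. \<gamma> v + \<gamma>' v)) = covector_form (part01 J \<gamma>) + covector_form (part01 J \<gamma>')"
    unfolding p by (rule ext) (simp add: covector_form_def pointwise split: list.split)
  have d: "dualct (part01 J (\<lambda>v. \<gamma> v + \<gamma>' v)) \<alpha> = dualct (part01 J \<gamma>) \<alpha> + dualct (part01 J \<gamma>') \<alpha>"
    by (rule ext, simp only: pointwise dualct_onb[OF part_types(2)[OF l] \<alpha>] dualct_onb[OF part_types(2)[OF \<gamma>(1)] \<alpha>]
        dualct_onb[OF part_types(2)[OF \<gamma>(2)] \<alpha>]) (simp add: p sum.distrib distrib_right)
  show ?thesis unfolding clifford_eq[OF l] clifford_eq[OF \<gamma>(1)] clifford_eq[OF \<gamma>(2)] c d wedge_add_left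
    by (simp add: form_scale_add form_scale_diff)
qed

lemma clifford_covector_scale:
  assumes \<gamma>: "linear \<gamma>" and \<alpha>: "alt_slots linear \<alpha>"
  shows "clifford J g (\<lambda>v. c * \<gamma> v) \<alpha> = form_scale (complex_of_real c) (clifford J g \<gamma> \<alpha>)"
proof -
  have l: "linear (\<lambda>v. c * \<gamma> v)" using linear_compose_scale_right[OF \<gamma>, of c] by simp
  have p: "part01 J (\<lambda>v. c * \<gamma> v) = (\<lambda>v. complex_of_real c * part01 J \<gamma> v)"
    by (rule ext) (simp add: part01_def field_simps)
  have cv: "covector_form (part01 J (\<lambda>v. c * \<gamma> v)) = form_scale (complex_of_real c) (covector_form (part01 J \<gamma>))"
    unfolding p by (rule ext) (simp add: covector_form_def form_scale_def split: list.split)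
  have d: "dualct (part01 J (\<lambda>v. c * \<gamma> v)) \<alpha> = form_scale (complex_of_real c) (dualct (part01 J \<gamma>) \<alpha>)"
    by (rule ext, simp only: form_scale_def dualct_onb[OF part_types(2)[OF l] \<alpha>] dualct_onb[OF part_types(2)[OF \<gamma>] \<alpha>])
      (simp add: p sum_distrib_left mult.assoc)
  show ?thesis unfolding clifford_eq[OF l] clifford_eq[OF \<gamma>] cv d wedge_scale_left
    by (simp add: form_scale_diff mult.commute)
qed

text \<open>Clifford multiplication is linear in the covector. For the contraction this uses that a spinor is
  linear in its first argument.\<close>

lemma clifford_basis_expand:
  assumes \<gamma>: "linear \<gamma>" and \<alpha>: "alt_slots linear \<alpha>"
  shows "(\<Sum>b\<in>Basis. form_scale (complex_of_real (\<gamma> b)) (clifford J g (\<lambda>v. v \<bullet> b) \<alpha>)) = clifford J g \<gamma> \<alpha>"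
proof -
  have ib: "linear (\<lambda>v. v \<bullet> b)" for b :: "real^'m" using bounded_linear_inner_left bounded_linear.linear by blast
  have "(\<Sum>b\<in>B. form_scale (complex_of_real (\<gamma> b)) (clifford J g (\<lambda>v. v \<bullet> b) \<alpha>)) =
      clifford J g (\<lambda>v. \<Sum>b\<in>B. \<gamma> b * (v \<bullet> b)) \<alpha>" if "finite B" for B :: "(real^'m) set"
    using that
  proof (induction B)
    case empty
    then show ?case using clifford_covector_scale[OF \<gamma> \<alpha>, of 0] by simp
  next
    case (insert b B)
    have l1: "linear (\<lambda>v. \<gamma> b * (v \<bullet> b))" using linear_compose_scale_right[OF ib, of "\<gamma> b"] by simp
    have l2: "linear (\<lambda>v. \<Sum>b\<in>B. \<gamma> b * (v \<bullet> b))"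
      by (rule linear_compose_sum) (use linear_compose_scale_right[OF ib] in simp)
    show ?case using insert
      by (simp add: clifford_covector_add[OF l1 l2 \<alpha>] clifford_covector_scale[OF ib \<alpha>])
  qed
  from this[OF finite_Basis] show ?thesis
  proof -
    have "(\<Sum>b\<in>Basis. \<gamma> b * (v \<bullet> b)) = \<gamma> v" for v
      by (subst (2) euclidean_representation[of v, symmetric]) (simp add: linear_sum[OF \<gamma>] linear_cmul[OF \<gamma>] mult.commute)
    then show ?thesis using \<open>(\<Sum>b\<in>Basis. form_scale (complex_of_real (\<gamma> b)) (clifford J g (\<lambda>v. v \<bullet> b) \<alpha>)) = _\<close> by simp
  qed
qed

end

context spinor_bundle
begin

abbreviation cl :: "'x \<Rightarrow> (real^'m \<Rightarrow> real) \<Rightarrow> ('m, complex^'r) form \<Rightarrow> ('m, complex^'r) form" where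
  "cl x \<gamma> \<equiv> tensor_Id (clifford (J x) (g x) \<gamma>)"

abbreviation ipF :: "'x \<Rightarrow> ('m, complex^'r) form \<Rightarrow> ('m, complex^'r) form \<Rightarrow> complex" where
  "ipF x \<equiv> form_inner (g x) (h x)"

lemma cl_ops: "cl x \<gamma> (\<alpha> + \<beta>) = cl x \<gamma> \<alpha> + cl x \<gamma> \<beta>"
  "cl x \<gamma> (formE_scale c \<alpha>) = formE_scale c (cl x \<gamma> \<alpha>)"
proof -
  interpret S: spinor_space "J x" "g x" n "h x" by (rule spinor_space)
  show "cl x \<gamma> (\<alpha> + \<beta>) = cl x \<gamma> \<alpha> + cl x \<gamma> \<beta>"
    by (rule form_ext_coord) (simp only: tensor_Id_coord coord_ops S.clifford_ops)
  show "cl x \<gamma> (formE_scale c \<alpha>) = formE_scale c (cl x \<gamma> \<alpha>)"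
    by (rule form_ext_coord) (simp only: tensor_Id_coord coord_ops S.clifford_ops)
qed

lemma cl_basis_expand:
  assumes \<gamma>: "linear \<gamma>" and \<alpha>: "\<alpha> \<in> spinorsE (J x) P"
  shows "(\<Sum>b\<in>Basis. formE_scale (complex_of_real (\<gamma> b)) (cl x (\<lambda>v. v \<bullet> b) \<alpha>)) = cl x \<gamma> \<alpha>"
proof -
  interpret S: spinor_space "J x" "g x" n "h x" by (rule spinor_space)
  have s: "coord (\<Sum>b\<in>B. f b) i = (\<Sum>b\<in>B. coord (f b) i)" for f :: "real^'m \<Rightarrow> ('m, complex^'r) form" and B i
    by (induction B rule: infinite_finite_induct) (simp_all add: coord_ops)
  show ?thesis
  proof (rule form_ext_coord)
    fix i
    have alt: "alt_slots linear (coord \<alpha> i)" using \<alpha> S.spinors_alt unfolding spinorsE_iff by blast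
    show "coord (\<Sum>b\<in>Basis. formE_scale (complex_of_real (\<gamma> b)) (cl x (\<lambda>v. v \<bullet> b) \<alpha>)) i = coord (cl x \<gamma> \<alpha>) i"
      unfolding s coord_ops tensor_Id_coord by (rule S.clifford_basis_expand[OF \<gamma> alt])
  qed
qed

text \<open>The Leibniz rule of the connection, with \<open>df\<close> expanded in the dual basis.\<close>

lemma dirac_leibniz:
  assumes N: "complex_connection A formE_scale (fields even) N"
    and f: "sm UNIV (f :: 'x \<Rightarrow> real)" and s: "s \<in> fields even"
  shows "dirac J g N (\<lambda>y. formE_scale (complex_of_real (f y)) (s y)) x =
    formE_scale (complex_of_real (f x)) (dirac J g N s x) + cl x (differential A f x) (s x)"
proof -
  have L: "N x v (\<lambda>y. formE_scale (complex_of_real (f y)) (s y)) =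
      formE_scale (complex_of_real (differential A f x v)) (s x) + formE_scale (complex_of_real (f x)) (N x v s)" for v
    using N f s unfolding complex_connection_def connection_def by blast
  have df: "linear (differential A f x)" using differential_chart(2)[OF f] chart_at by blast
  have sc: "formE_scale c (\<Sum>b\<in>B. F b) = (\<Sum>b\<in>B. formE_scale c (F b))" for c B and F :: "real^'m \<Rightarrow> ('m, complex^'r) form"
  proof (induction B rule: infinite_finite_induct)
    case (insert b B)
    have "formE_scale c (\<alpha> + \<beta>) = formE_scale c \<alpha> + formE_scale c \<beta>" for \<alpha> \<beta> :: "('m, complex^'r) form"
      by (rule ext) (simp add: formE_scale_def pointwise vector_add_ldistrib)
    then show ?case using insert by simp
  qed (auto simp: formE_scale_def pointwise)
  have sx: "s x \<in> spinorsE (J x) even" using s by (simp add: fields_iff)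
  show ?thesis
    unfolding dirac_def L cl_ops sum.distrib cl_basis_expand[OF df sx] sc by (rule add.commute)
qed

text \<open>The Leibniz rule gives the value; that a function and a section with the prescribed data exist
  makes it the only one.\<close>

theorem symbol_dirac:
  assumes N: "complex_connection A formE_scale (fields even) N"
    and \<gamma>: "linear \<gamma>" and e: "e \<in> spinorsE (J x) even"
  shows "principal_symbol A formE_scale (fields even) (dirac J g N) x \<gamma> e = cl x \<gamma> e"
  unfolding principal_symbol_def
proof (rule the_equality)
  have z: "formE_scale 0 \<alpha> = 0" for \<alpha> :: "('m, complex^'r) form" by (rule ext) (simp add: formE_scale_def pointwise)
  show *: "\<forall>f s. sm UNIV f \<and> f x = 0 \<and> differential A f x = \<gamma> \<and> s \<in> fields even \<and> s x = e \<longrightarrow>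
     dirac J g N (\<lambda>y. formE_scale (complex_of_real (f y)) (s y)) x = cl x \<gamma> e"
    by (auto simp: dirac_leibniz[OF N] z)
  obtain f where f: "sm UNIV f" "f x = 0" "differential A f x = \<gamma>" using function_with_differential[OF \<gamma>] by blast
  obtain s where s: "s \<in> fields even" "s x = e" using field_with_value[OF e] by blast
  fix w assume "\<forall>f s. sm UNIV f \<and> f x = 0 \<and> differential A f x = \<gamma> \<and> s \<in> fields even \<and> s x = e \<longrightarrow>
     dirac J g N (\<lambda>y. formE_scale (complex_of_real (f y)) (s y)) x = w"
  from this[rule_format, of f s] *[rule_format, of f s] f s show "w = cl x \<gamma> e" by simp
qed

section \<open>Positivity of the Riemannian measure\<close>

lemma sm_continuous:
  assumes c: "c \<in> A" and W: "W \<subseteq> fst c" "open W" and f: "sm W f" shows "continuous_on W f"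
proof -
  have "is_chart c" using atlas c by (simp add: smooth_atlas_def)
  then have "continuous_on (fst c) (snd c)" by (auto simp: is_chart_def homeomorphism_def split_beta)
  then have 1: "continuous_on W (snd c)" using W(1) by (rule continuous_on_subset)
  have "smooth_on (snd c ` W) (\<lambda>y. f (chart_inv c y))"
    using f c W(1) unfolding sm_iff by (metis Int_absorb1)
  then have "continuous_on (snd c ` W) (\<lambda>y. f (chart_inv c y))" by (rule smooth_on_continuous)
  from continuous_on_compose2[OF this 1 order.refl] show ?thesis
    by (rule continuous_on_eq) (use chart_props(4)[OF c] W(1) in auto)
qed

text \<open>The density is positive and continuous in a chart, and a nonempty open set is not negligible.\<close>

lemma riemannian_measure_open_pos:
  assumes \<mu>: "riemannian_measure A g \<mu>" and c: "c \<in> A" and V: "open V" "V \<subseteq> fst c" "V \<noteq> {}"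
  shows "emeasure \<mu> V \<noteq> 0"
proof
  assume 0: "emeasure \<mu> V = 0"
  let ?P = "snd c ` V"
  let ?q = "\<lambda>p. det (gram c (chart_inv c p))"
  have P: "open ?P" using chart_image_open[OF c V(1)] V(2) by (simp add: Int_absorb1)
  have qpos: "?q p > 0" if "p \<in> ?P" for p
    using that chart_props(4)[OF c] V(2) gram_det_pos[OF c] by force
  have "smooth_on (snd c ` (fst c \<inter> fst c)) (\<lambda>p. ?q p)"
    using sm_det[OF chart_props(1)[OF c] gram_smooth[OF c]] c unfolding sm_iff by blast
  then have "continuous_on ?P ?q"
    by (intro smooth_on_continuous smooth_on_subset[of _ ?q ?P]) (use V(2) in auto)
  then have "continuous_on ?P (\<lambda>p. sqrt (?q p))" by (rule continuous_on_real_sqrt)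
  then have m: "(\<lambda>p. indicator ?P p *\<^sub>R sqrt (?q p)) \<in> borel_measurable borel"
    using P by (intro borel_measurable_continuous_on_indicator) auto
  let ?H = "\<lambda>p. ennreal (indicator ?P p *\<^sub>R sqrt (?q p))"
  have "emeasure \<mu> V = (\<integral>\<^sup>+ p. indicator ?P p * (let x = chart_inv c p in
        ennreal (sqrt (det (\<chi> i j. g x (from_chart A c x (axis i 1)) (from_chart A c x (axis j 1)))))) \<partial>lborel)"
    using \<mu> c V unfolding riemannian_measure_def by auto
  also have "\<dots> = (\<integral>\<^sup>+ p. ?H p \<partial>lborel)"
    by (rule nn_integral_cong) (auto simp: Let_def gram_def indicator_def)
  finally have "(\<integral>\<^sup>+ p. ?H p \<partial>lborel) = 0" using 0 by simp
  moreover have "?H \<in> borel_measurable lborel" using m by simp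
  ultimately have "AE p in lborel. ?H p = 0" by (simp add: nn_integral_0_iff_AE)
  moreover have "?H p \<noteq> 0" if "p \<in> ?P" for p
    unfolding indicator_simps(1)[OF that] using qpos[OF that] by (simp add: ennreal_eq_0_iff not_le)
  ultimately have "AE p in lborel. p \<notin> ?P"
    using AE_mp[of "\<lambda>p. ?H p = 0" lborel "\<lambda>p. p \<notin> ?P"] by blast
  then have "?P \<in> null_sets lborel" using P AE_iff_null_sets[of ?P lborel] by auto
  then have "negligible ?P" by (simp add: negligible_iff_null_sets null_sets_completionI)
  then show False using open_not_negligible[OF P] V(3) by simp
qed

section \<open>The formal adjoint and its principal symbol\<close>

text \<open>Let \<open>w\<close> be the difference of the two sides. The definition of the adjoint for \<open>s, ft\<close> and for \<open>fs, t\<close>,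
  together with the Leibniz rule for \<open>D\<close> and skew-adjointness of \<open>c(df)\<close>, shows that the integral of
  \<open>\<langle>s, w\<rangle>\<close> vanishes for all smooth fields \<open>s\<close>. As \<open>w\<close> is itself a smooth field, \<open>s = w\<close> is allowed. So
  \<open>w\<close> vanishes almost everywhere, and by continuity everywhere, since nonempty open sets have positive measure.\<close>

lemma formal_adjoint_leibniz:
  assumes N: "complex_connection A formE_scale (fields even) N"
    and \<mu>: "riemannian_measure A g \<mu>"
    and D: "formal_adjoint \<mu> ipF (fields even) (fields odd) (dirac J g N) Q"
    and f: "sm UNIV (f :: 'x \<Rightarrow> real)" and t: "t \<in> fields odd"
  shows "Q (\<lambda>y. formE_scale (complex_of_real (f y)) (t y)) x =
    formE_scale (complex_of_real (f x)) (Q t x) + cl x (differential A f x) (t x)"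
proof -
  let ?f = "\<lambda>s y. formE_scale (complex_of_real (f y)) (s y)"
  let ?c = "\<lambda>s y. cl y (differential A f y) (s y)"
  let ?P = "dirac J g N"
  define w where "w y = Q (?f t) y - ?f (Q t) y - ?c t y" for y
  have df: "linear (differential A f y)" for y using differential_chart(2)[OF f] chart_at by blast
  have ft: "?f t \<in> fields odd" by (rule fields_scale[OF f t])
  have Qt: "Q t \<in> fields even" "Q (?f t) \<in> fields even" using D t ft by (auto simp: formal_adjoint_def)
  have w: "w \<in> fields even"
    unfolding w_def[abs_def] by (intro fields_diff Qt fields_scale f fields_clifford t)
  have spin: "u y \<in> spinorsE (J y) P" if "u \<in> fields P" for u y P using that by (simp add: fields_iff)
  have fw: "?f w \<in> fields even" by (rule fields_scale[OF f w])
  have pair: "\<exists>I. has_bochner_integral \<mu> (\<lambda>y. ipF y (?P u y) (v y)) I \<and> has_bochner_integral \<mu> (\<lambda>y. ipF y (u y) (Q v y)) I"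
    if "u \<in> fields even" "v \<in> fields odd" for u v
    by (rule D[unfolded formal_adjoint_def, THEN conjunct2, THEN bspec, THEN bspec, OF that])
  obtain I1 where I1: "has_bochner_integral \<mu> (\<lambda>y. ipF y (?P w y) (?f t y)) I1"
    "has_bochner_integral \<mu> (\<lambda>y. ipF y (w y) (Q (?f t) y)) I1"
    using pair[OF w ft] by (elim exE conjE)
  obtain I2 where I2: "has_bochner_integral \<mu> (\<lambda>y. ipF y (?P (?f w) y) (t y)) I2"
    "has_bochner_integral \<mu> (\<lambda>y. ipF y (?f w y) (Q t y)) I2"
    using pair[OF fw t] by (elim exE conjE)
  have e: "ipF y (w y) (w y) = (ipF y (w y) (Q (?f t) y) - ipF y (?f w y) (Q t y)) +
      (ipF y (?P (?f w) y) (t y) - ipF y (?P w y) (?f t y))" for y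
  proof -
    interpret S: spinor_space "J y" "g y" n "h y" by (rule spinor_space)
    have "ipF y (?c w y) (t y) = - ipF y (w y) (?c t y)"
      by (rule S.cE_skew[OF df spin[OF w] spin[OF t]])
    moreover have "ipF y (w y) (w y) = ipF y (w y) (Q (?f t) y) - ipF y (w y) (?f (Q t) y) - ipF y (w y) (?c t y)"
      by (subst (2) w_def) (simp only: S.ipE_simps)
    ultimately show ?thesis
      unfolding dirac_leibniz[OF N f w] by (simp add: S.ipE_simps)
  qed
  have "has_bochner_integral \<mu> (\<lambda>y. ipF y (w y) (w y)) ((I1 - I2) + (I2 - I1))"
    unfolding e by (intro has_bochner_integral_add has_bochner_integral_diff I1 I2)
  then have "has_bochner_integral \<mu> (\<lambda>y. Re (ipF y (w y) (w y))) (Re 0)"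
    using has_bochner_integral_bounded_linear[OF bounded_linear_Re] by fastforce
  then have int: "integrable \<mu> (\<lambda>y. Re (ipF y (w y) (w y)))" "(LINT y|\<mu>. Re (ipF y (w y) (w y))) = 0"
    using has_bochner_integral_iff by (force, force)
  have nonneg: "Re (ipF y (w y) (w y)) \<ge> 0" and zero: "Re (ipF y (w y) (w y)) = 0 \<Longrightarrow> w y = 0" for y
    using spinor_space.ipE_definite[OF spinor_space spin[OF w]] by auto
  have AE: "AE y in \<mu>. Re (ipF y (w y) (w y)) = 0"
    using integral_nonneg_eq_0_iff_AE[OF int(1)] nonneg int(2) by auto
  have "w x = 0"
  proof (rule ccontr)
    assume "w x \<noteq> 0"
    then obtain vs where vs: "w x vs \<noteq> 0" by (auto simp: fun_eq_iff pointwise)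
    let ?C = "chart_at A x"
    have c: "?C \<in> A" "x \<in> fst ?C" by (rule chart_at)+
    obtain tr where tr: "tr \<in> Tr" "x \<in> fst tr" using triv_cover by blast
    let ?N = "fst ?C \<inter> fst tr"
    have oN: "open ?N" by (rule open_Int_domains[OF c(1) tr(1)])
    \<comment> \<open>in coordinates of a chart and a trivialization, one component of \<open>w\<close> is continuous and not 0 at \<open>x\<close>\<close>
    define us where "us = map (to_chart A ?C x) vs"
    define F where "F y = snd tr y (w y (map (from_chart A ?C y) us))" for y
    have "sm ?N F" using w c tr by (simp add: fields_iff F_def[abs_def])
    then have "continuous_on ?N F" using sm_continuous[OF c(1) _ oN] by blast
    then have V: "open (?N \<inter> F -` (- {0}))" by (rule continuous_open_preimage) (use oN in auto)
    have "map (from_chart A ?C x) us = vs" by (simp add: us_def map_idI from_to_chart[OF c])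
    then have "F x = snd tr x (w x vs)" by (simp add: F_def)
    moreover have "snd tr x (w x vs) \<noteq> snd tr x 0"
      using triv_props(2)[OF tr] vs by (auto simp: bij_def dest: injD)
    ultimately have Fx: "F x \<noteq> 0" using linear_0[OF triv_props(8)[OF tr]] by simp
    let ?V = "?N \<inter> F -` (- {0})"
    have "w y \<noteq> 0" if "y \<in> ?V" for y
    proof
      assume "w y = 0"
      then have "F y = 0" using that linear_0[OF triv_props(8)[OF tr(1), of y]] by (simp add: F_def zero_fun_apply)
      then show False using that by simp
    qed
    then have VR: "Re (ipF y (w y) (w y)) \<noteq> 0" if "y \<in> ?V" for y using zero that by blast
    have "sets \<mu> = sets borel" using \<mu> by (simp add: riemannian_measure_def)
    then have Vm: "?V \<in> sets \<mu>" using V by auto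
    have "AE y in \<mu>. y \<notin> ?V" using AE by (rule AE_mp) (use VR in \<open>auto intro!: AE_I2\<close>)
    then have "?V \<in> null_sets \<mu>" using AE_iff_null_sets[OF Vm] by blast
    then have "emeasure \<mu> ?V = 0" by blast
    moreover have "emeasure \<mu> ?V \<noteq> 0"
      by (rule riemannian_measure_open_pos[OF \<mu> c(1) V]) (use c tr Fx in auto)
    ultimately show False by blast
  qed
  then show ?thesis unfolding w_def by (simp add: algebra_simps)
qed

theorem symbol_formal_adjoint:
  assumes N: "complex_connection A formE_scale (fields even) N"
    and \<mu>: "riemannian_measure A g \<mu>"
    and D: "formal_adjoint \<mu> ipF (fields even) (fields odd) (dirac J g N) Q"
    and \<gamma>: "linear \<gamma>" and e: "e \<in> spinorsE (J x) odd"
  shows "principal_symbol A formE_scale (fields odd) Q x \<gamma> e = cl x \<gamma> e"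
  unfolding principal_symbol_def
proof (rule the_equality)
  have z: "formE_scale 0 \<alpha> = 0" for \<alpha> :: "('m, complex^'r) form" by (rule ext) (simp add: formE_scale_def pointwise)
  show *: "\<forall>f s. sm UNIV f \<and> f x = 0 \<and> differential A f x = \<gamma> \<and> s \<in> fields odd \<and> s x = e \<longrightarrow>
     Q (\<lambda>y. formE_scale (complex_of_real (f y)) (s y)) x = cl x \<gamma> e"
    by (auto simp: formal_adjoint_leibniz[OF N \<mu> D] z)
  obtain f where f: "sm UNIV f" "f x = 0" "differential A f x = \<gamma>" using function_with_differential[OF \<gamma>] by blast
  obtain s where s: "s \<in> fields odd" "s x = e" using field_with_value[OF e] by blast
  fix w assume "\<forall>f s. sm UNIV f \<and> f x = 0 \<and> differential A f x = \<gamma> \<and> s \<in> fields odd \<and> s x = e \<longrightarrow>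
     Q (\<lambda>y. formE_scale (complex_of_real (f y)) (s y)) x = w"
  from this[rule_format, of f s] *[rule_format, of f s] f s show "w = cl x \<gamma> e" by simp
qed

end

section \<open>The anticommutation of the symbols\<close>

theorem theorem3p2:
  fixes A :: "('x::t2_space, 'm::finite) chart set"
    and J :: "'x \<Rightarrow> real^'m \<Rightarrow> real^'m"
    and g :: "'x \<Rightarrow> real^'m \<Rightarrow> real^'m \<Rightarrow> real"
    and n :: nat
    and Tr :: "('x, 'r::finite) triv set"
    and h :: "'x \<Rightarrow> complex^'r \<Rightarrow> complex^'r \<Rightarrow> complex"
    and nablaE :: "'x \<Rightarrow> real^'m \<Rightarrow> ('x \<Rightarrow> complex^'r) \<Rightarrow> complex^'r"
    and nablaLC :: "'x \<Rightarrow> real^'m \<Rightarrow> ('x \<Rightarrow> real^'m) \<Rightarrow> real^'m"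
    and nablaK nablaS :: "'x \<Rightarrow> real^'m \<Rightarrow> ('x \<Rightarrow> ('m, complex) form) \<Rightarrow> ('m, complex) form"
    and nablaSE :: "'x \<Rightarrow> real^'m \<Rightarrow> ('x \<Rightarrow> ('m, complex^'r) form) \<Rightarrow> ('m, complex^'r) form"
    and D Dadj :: "('x \<Rightarrow> ('m, complex^'r) form) \<Rightarrow> 'x \<Rightarrow> ('m, complex^'r) form"
    and \<mu> :: "'x measure"
    and \<phi> :: "'x \<Rightarrow> ('m, 'r) Kbilinear"
  assumes compact: "compact (UNIV :: 'x set)"
    and X: "almost_hermitian_manifold A J g"
    and dim: "CARD('m) = 2 * n" "CARD('m) mod 8 = 2 \<or> CARD('m) mod 8 = 6"
    and E: "hermitian_bundle A Tr h"
    and nablaE: "hermitian_connection A (*s) (sections A Tr) h nablaE"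
    and nablaS: "spinc_connection n A J g nablaLC nablaK nablaS"
    and nablaSE: "tensor_connection A Tr J even nablaS nablaE nablaSE"
    and D: "D = dirac J g nablaSE"
    and \<mu>: "riemannian_measure A g \<mu>"
    and Dadj: "formal_adjoint \<mu> (\<lambda>x. form_inner (g x) (h x))
                 (spinorE_fields A Tr J even) (spinorE_fields A Tr J odd) D Dadj"
    and \<phi>_smooth: "smooth_Kbilinear A Tr \<phi>"
    and \<phi>_Sym2: "CARD('m) mod 8 = 2 \<Longrightarrow> \<forall>x. \<phi> x \<in> K_Sym2 n (J x)"
    and \<phi>_Alt2: "CARD('m) mod 8 = 6 \<Longrightarrow> \<forall>x. \<phi> x \<in> K_Alt2 n (J x)"
  shows "\<forall>x. \<forall>\<gamma>::real^'m \<Rightarrow> real. linear \<gamma> \<longrightarrow> (\<forall>\<alpha>\<in>spinorsE (J x) even.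
           principal_symbol A formE_scale (spinorE_fields A Tr J odd) Dadj x \<gamma>
             (A_map n (J x) (g x) (h x) (\<phi> x) \<alpha>) +
           real_adjoint (g x) (h x) (spinorsE (J x) even) (A_map n (J x) (g x) (h x) (\<phi> x))
             (principal_symbol A formE_scale (spinorE_fields A Tr J even) D x \<gamma> \<alpha>) = 0)"
proof (intro allI impI ballI)
  fix x and \<gamma> :: "real^'m \<Rightarrow> real" and \<alpha> :: "('m, complex^'r) form"
  assume \<gamma>: "linear \<gamma>" and \<alpha>: "\<alpha> \<in> spinorsE (J x) even"
  interpret B: spinor_bundle A J g n Tr h
    using X E dim(1) by unfold_locales (simp_all add: almost_hermitian_manifold_def)
  interpret S: spinor_space "J x" "g x" n "h x" by (rule B.spinor_space)
  have N: "complex_connection A formE_scale (spinorE_fields A Tr J even) nablaSE"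
    using nablaSE by (simp add: tensor_connection_def)
  let ?A = "A_map n (J x) (g x) (h x) (\<phi> x)"
  consider (sym) k where "n = 4 * k + 1" "\<phi> x \<in> K_Sym2 n (J x)" | (alt) k where "n = 4 * k + 3" "\<phi> x \<in> K_Alt2 n (J x)"
  proof (cases "CARD('m) mod 8 = 2")
    case True
    then have "n = 4 * (n div 4) + 1" using dim(1) by presburger
    then show ?thesis using that(1) \<phi>_Sym2[OF True] by blast
  next
    case False
    then have "CARD('m) mod 8 = 6" using dim(2) by simp
    moreover from this have "n = 4 * (n div 4) + 3" using dim(1) by presburger
    ultimately show ?thesis using that(2) \<phi>_Alt2 by blast
  qed
  \<comment> \<open>the symmetry of \<open>\<phi>\<close> has the sign \<open>(-1)\<^sup>n\<^sup>(\<^sup>n\<^sup>-\<^sup>1\<^sup>)\<^sup>/\<^sup>2\<close> in both cases\<close>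
  then have props: "odd n \<and> \<phi> x \<in> K_EE n (J x) \<and>
      (\<forall>i j. S.kcoeff (\<phi> x) j i = (-1) ^ (n * (n - 1) div 2) * S.kcoeff (\<phi> x) i j)"
  proof cases
    case sym
    have "n * (n - 1) div 2 = 2 * (k * n)" using sym(1) by simp
    then have e: "(-1 :: complex) ^ (n * (n - 1) div 2) = 1" by (simp add: power_mult)
    have s: "S.kcoeff (\<phi> x) j i = S.kcoeff (\<phi> x) i j" for i j
    proof -
      have "\<phi> x S.uframe (axis j 1) (axis i 1) = \<phi> x S.uframe (axis i 1) (axis j 1)"
        using sym(2) unfolding K_Sym2_def by blast
      then show ?thesis by (simp only: S.kcoeff_def)
    qed
    show ?thesis
      unfolding e mult_1_left using sym unfolding K_Sym2_def by (intro conjI allI s) auto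
  next
    case alt
    have "n * (n - 1) div 2 = n * (2 * k + 1)" using alt(1) by simp
    then have e: "(-1 :: complex) ^ (n * (n - 1) div 2) = - 1" using alt(1) by (simp add: power_mult)
    have s: "S.kcoeff (\<phi> x) j i = - S.kcoeff (\<phi> x) i j" for i j
    proof -
      have "\<phi> x S.uframe (axis j 1) (axis i 1) = - \<phi> x S.uframe (axis i 1) (axis j 1)"
        using alt(2) unfolding K_Alt2_def by blast
      then show ?thesis by (simp only: S.kcoeff_def minus_divide_left)
    qed
    show ?thesis
      unfolding e mult_minus1 using alt unfolding K_Alt2_def by (intro conjI allI s) auto
  qed
  note n = props[THEN conjunct1] and \<phi> = props[THEN conjunct2, THEN conjunct1]
    and k = props[THEN conjunct2, THEN conjunct2, rule_format]
  have "principal_symbol A formE_scale (spinorE_fields A Tr J even) D x \<gamma> \<alpha> = S.cE \<gamma> \<alpha>"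
    unfolding D by (rule B.symbol_dirac[OF N \<gamma> \<alpha>])
  moreover have "principal_symbol A formE_scale (spinorE_fields A Tr J odd) Dadj x \<gamma> (?A \<alpha>) = S.cE \<gamma> (?A \<alpha>)"
    by (rule B.symbol_formal_adjoint[OF N \<mu> Dadj[unfolded D] \<gamma> S.A_map_spinorsE[OF n \<phi> \<alpha>]])
  moreover have "real_adjoint (g x) (h x) (spinorsE (J x) even) ?A (S.cE \<gamma> \<alpha>) = - S.cE \<gamma> (?A \<alpha>)"
    by (rule S.real_adjoint_A_map[OF n \<phi> k \<gamma> \<alpha>])
  ultimately show "principal_symbol A formE_scale (spinorE_fields A Tr J odd) Dadj x \<gamma> (?A \<alpha>) +
      real_adjoint (g x) (h x) (spinorsE (J x) even) ?A
        (principal_symbol A formE_scale (spinorE_fields A Tr J even) D x \<gamma> \<alpha>) = 0"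
    by (simp only: add.right_inverse)
qed

end
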